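(* Let $n\ge2$ and let $h(x',t)$ be a test function supported in $\mathbb{R}^{n-1}\times(0,2)$. Define $$v(x',x_n,t)=\frac{2}{(2\pi)^n}\int_{\mathbb{R}^{n-1}}\int_{\partial D^+}e^{i\xi'\cdot x'+i\xi_nx_n-i(\xi'^2+\xi_n^2)t}\,\xi_n\,\widehat h(\xi',-\xi'^2-\xi_n^2)\,d\xi_n\,d\xi'.$$ Then $v$ solves the reduced pure initial-boundary value problem $iv_t+\Delta_{x'}v+\partial_{x_n}^2v=0$ for $(x',x_n)\in\mathbb{R}^{n-1}\times\mathbb{R}^+$, $t\in(0,2)$, $v(x',x_n,0)=0$, $v(x',0,t)=h(x',t)$, and satisfies $$\|v\|_{X^{s,b}_{\mathbb{R}^{n-1}\times\mathbb{R}^+\times(0,2)}}\le c_{s,b}\|h\|_{\mathcal{B}^s},\qquad s>-\tfrac32,\ 0\le b<\tfrac12,$$ $$\|v\|_{Y^{s,b}_{\mathbb{R}^{n-1}\times\mathbb{R}^+\times(0,2)}}\le c_{s,b}\|h\|_{\mathcal{B}^s},\qquad s\ge0,\ 0\le b<\tfrac12,$$ with constants $c_{s,b}$ independent of $h$.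
   Context: Notation: $x=(x',x_n)$, $\xi=(\xi',\xi_n)$, $\xi'^2=|\xi'|^2$, $\xi^2=|\xi|^2$. $\widehat h(\xi',\tau)=\int_{\mathbb{R}}\int_{\mathbb{R}^{n-1}}e^{-i\xi'\cdot x'-i\tau t}h(x',t)dx'dt$, defined for complex $\tau$ since $h$ has compact support in $t$. $\partial D^+$ is the boundary of the first quadrant $\{0<\arg\xi_n<\pi/2\}$ of the complex $\xi_n$-plane, traversed from $i\infty$ down the imaginary axis to $0$ and then along $[0,\infty)$. $\|g\|_{\mathcal{B}^s}^2=\int_{\mathbb{R}^n}(1+\xi'^2+|\tau+\xi'^2|)^s(1+|\tau+\xi'^2|)^{1/2}|\widehat g(\xi',\tau)|^2d\xi'd\tau$. On $\mathbb{R}^{n+1}$: $\|u\|_{X^{s,b}}^2=\int(1+|\xi|)^{2s}(1+|\tau+\xi^2|)^{2b}|\widehat u(\xi,\tau)|^2d\xi d\tau$, $\|u\|_{Y^{s,b}}^2=\int(1+|\tau|)^{s}(1+|\tau+\xi^2|)^{2b}|\widehat u|^2d\xi d\tau$; the spaces with subscript $\mathbb{R}^{n-1}\times\mathbb{R}^+\times(0,2)$ consist of restrictions to that set, normed by the infimum of the norms of all extensions to $\mathbb{R}^{n+1}$. *)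

theory Defs
  imports "HOL-Analysis.Analysis"
begin

definition dderiv :: "'a::real_normed_vector \<Rightarrow> ('a \<Rightarrow> complex) \<Rightarrow> 'a \<Rightarrow> complex" where
  "dderiv e f x = vector_derivative (\<lambda>r::real. f (x + r *\<^sub>R e)) (at 0)"

fun pderivs :: "'a::real_normed_vector list \<Rightarrow> ('a \<Rightarrow> complex) \<Rightarrow> 'a \<Rightarrow> complex" where
  "pderivs [] f = f"
| "pderivs (e # es) f = dderiv e (pderivs es f)"

definition smooth_fun :: "('a::euclidean_space \<Rightarrow> complex) \<Rightarrow> bool" where
  "smooth_fun f \<longleftrightarrow> (\<forall>es. set es \<subseteq> Basis \<longrightarrow>
      continuous_on UNIV (pderivs es f) \<and>
      (\<forall>e\<in>Basis. \<forall>x. (\<lambda>r::real. pderivs es f (x + r *\<^sub>R e)) differentiable (at 0)))"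

definition tsupport :: "('a::topological_space \<Rightarrow> complex) \<Rightarrow> 'a set" where
  "tsupport f = closure {x. f x \<noteq> 0}"

definition test_fun_on :: "'a::euclidean_space set \<Rightarrow> ('a \<Rightarrow> complex) \<Rightarrow> bool" where
  "test_fun_on \<Omega> f \<longleftrightarrow> smooth_fun f \<and> compact (tsupport f) \<and> tsupport f \<subseteq> \<Omega>"

definition hhat :: "((real^'m) \<times> real \<Rightarrow> complex) \<Rightarrow> real^'m \<Rightarrow> complex \<Rightarrow> complex" where
  "hhat h \<xi>' \<tau> = (\<integral>z. exp (- \<i> * of_real (\<xi>' \<bullet> fst z) - \<i> * \<tau> * of_real (snd z)) * h z \<partial>lborel)"

text \<open>Fourier transform on R^(n+1) = (R^(n-1) x R) x R, variables ((x',x_n),t).\<close>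
definition ft_st :: "(((real^'m) \<times> real) \<times> real \<Rightarrow> complex) \<Rightarrow> ((real^'m) \<times> real) \<times> real \<Rightarrow> complex" where
  "ft_st u \<zeta> = (\<integral>z. exp (- \<i> * of_real (fst \<zeta> \<bullet> fst z) - \<i> * of_real (snd \<zeta>) * of_real (snd z)) * u z \<partial>lborel)"

text \<open>Integral over the boundary of the first quadrant, from i\<infinity> down the imaginary axis
  to 0 and then along [0,\<infinity>):  \<open>\<integral>_0^\<infinity> f(r) dr - i \<integral>_0^\<infinity> f(i r) dr\<close>.\<close>
definition contour_dplus :: "(complex \<Rightarrow> complex) \<Rightarrow> complex" where
  "contour_dplus f = (\<integral>r\<in>{0..}. f (of_real r) \<partial>lborel) - \<i> * (\<integral>r\<in>{0..}. f (\<i> * of_real r) \<partial>lborel)"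

definition vsol :: "((real^'m) \<times> real \<Rightarrow> complex) \<Rightarrow> real^'m \<Rightarrow> real \<Rightarrow> real \<Rightarrow> complex" where
  "vsol h x' xn t =
     2 / (2 * pi) ^ (CARD('m) + 1) *
     (\<integral>\<xi>'. contour_dplus (\<lambda>\<zeta>.
         exp (\<i> * of_real (\<xi>' \<bullet> x') + \<i> * \<zeta> * of_real xn
              - \<i> * (of_real ((norm \<xi>')\<^sup>2) + \<zeta>\<^sup>2) * of_real t)
         * \<zeta> * hhat h \<xi>' (- of_real ((norm \<xi>')\<^sup>2) - \<zeta>\<^sup>2)) \<partial>lborel)"

definition twice_diff :: "(real \<Rightarrow> complex) \<Rightarrow> real \<Rightarrow> bool" where
  "twice_diff g r \<longleftrightarrow> (\<forall>\<^sub>F s in nhds r. g differentiable (at s)) \<and>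
      (\<lambda>s. vector_derivative g (at s)) differentiable (at r)"

definition d2 :: "(real \<Rightarrow> complex) \<Rightarrow> real \<Rightarrow> complex" where
  "d2 g r = vector_derivative (\<lambda>s. vector_derivative g (at s)) (at r)"

definition solves_ibvp :: "(real^'m \<Rightarrow> real \<Rightarrow> real \<Rightarrow> complex) \<Rightarrow> ((real^'m) \<times> real \<Rightarrow> complex) \<Rightarrow> bool" where
  "solves_ibvp v h \<longleftrightarrow>
     (\<forall>x' xn t. 0 < xn \<and> 0 < t \<and> t < 2 \<longrightarrow>
        (\<lambda>s. v x' xn s) differentiable (at t) \<and>
        twice_diff (\<lambda>r. v x' r t) xn \<and>
        (\<forall>e\<in>(Basis :: (real^'m) set). twice_diff (\<lambda>r. v (x' + r *\<^sub>R e) xn t) 0) \<and>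
        \<i> * vector_derivative (\<lambda>s. v x' xn s) (at t)
          + (\<Sum>e\<in>(Basis :: (real^'m) set). d2 (\<lambda>r. v (x' + r *\<^sub>R e) xn t) 0)
          + d2 (\<lambda>r. v x' r t) xn = 0)
   \<and> (\<forall>x' xn. 0 \<le> xn \<longrightarrow> v x' xn 0 = 0)
   \<and> (\<forall>x' t. 0 < t \<and> t < 2 \<longrightarrow> v x' 0 t = h (x', t))"

definition Bnorm_sq :: "real \<Rightarrow> ((real^'m) \<times> real \<Rightarrow> complex) \<Rightarrow> ennreal" where
  "Bnorm_sq s h = (\<integral>\<^sup>+ z. ennreal (
      (1 + (norm (fst z))\<^sup>2 + \<bar>snd z + (norm (fst z))\<^sup>2\<bar>) powr s
      * (1 + \<bar>snd z + (norm (fst z))\<^sup>2\<bar>) powr (1/2)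
      * (cmod (hhat h (fst z) (of_real (snd z))))\<^sup>2) \<partial>lborel)"

definition X_weight :: "real \<Rightarrow> real \<Rightarrow> ((real^'m) \<times> real) \<times> real \<Rightarrow> real" where
  "X_weight s b z = (1 + norm (fst z)) powr (2 * s) * (1 + \<bar>snd z + (norm (fst z))\<^sup>2\<bar>) powr (2 * b)"

definition Y_weight :: "real \<Rightarrow> real \<Rightarrow> ((real^'m) \<times> real) \<times> real \<Rightarrow> real" where
  "Y_weight s b z = (1 + \<bar>snd z\<bar>) powr s * (1 + \<bar>snd z + (norm (fst z))\<^sup>2\<bar>) powr (2 * b)"

definition Omega :: "(((real^'m) \<times> real) \<times> real) set" where
  "Omega = {z. 0 < snd (fst z) \<and> 0 < snd z \<and> snd z < 2}"

text \<open>A tempered distribution U on R^(n+1), given through its Fourier transform F (a function),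
  extends w from Omega: for every test function phi supported in Omega,
  <U,phi> = (2 pi)^(-(n+1)) \<integral> F(\<zeta>) phi^(-\<zeta>) d\<zeta> equals \<integral> w phi.\<close>
definition ft_extends :: "(((real^'m) \<times> real) \<times> real \<Rightarrow> complex)
    \<Rightarrow> (((real^'m) \<times> real) \<times> real \<Rightarrow> complex) \<Rightarrow> bool" where
  "ft_extends F w \<longleftrightarrow> F \<in> borel_measurable lborel \<and>
     (\<forall>\<phi>. test_fun_on (Omega :: (((real^'m) \<times> real) \<times> real) set) \<phi> \<longrightarrow>
        (\<integral>\<zeta>. F \<zeta> * ft_st \<phi> (- \<zeta>) \<partial>lborel) / (2 * pi) ^ (CARD('m) + 2)
          = (\<integral>z. w z * \<phi> z \<partial>lborel))"

definition restr_norm_sq :: "((((real^'m) \<times> real) \<times> real) \<Rightarrow> real)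
    \<Rightarrow> (((real^'m) \<times> real) \<times> real \<Rightarrow> complex) \<Rightarrow> ennreal" where
  "restr_norm_sq wt w = (INF F \<in> {F. ft_extends F w}.
      \<integral>\<^sup>+ \<zeta>. ennreal (wt \<zeta> * (cmod (F \<zeta>))\<^sup>2) \<partial>lborel)"

definition vsol_st :: "((real^'m) \<times> real \<Rightarrow> complex) \<Rightarrow> ((real^'m) \<times> real) \<times> real \<Rightarrow> complex" where
  "vsol_st h z = vsol h (fst (fst z)) (snd (fst z)) (snd z)"

end

theory Submission
  imports Defs "HOL-Probability.Characteristic_Functions" "HOL-Probability.Sinc_Integral"
    "HOL-Complex_Analysis.Cauchy_Integral_Theorem"
begin

text \<open>Substituting \<open>\<tau> = - \<xi>'\<^sup>2 - \<zeta>\<^sup>2\<close> on both rays turns the contour integral into the superposition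
  \<open>v = (2\<pi>)^(-n) \<integral> exp (i \<xi>'\<cdot>x' + i \<tau> t - \<kappa>(\<tau> + \<xi>'\<^sup>2) x\<^sub>n) h^(\<xi>', \<tau>)\<close> with \<open>\<kappa>(\<mu>)\<^sup>2 = \<mu>\<close>. Each mode solves the equation,
  Fourier inversion gives the boundary values, and at \<open>t = 0\<close> the integrand is holomorphic and decaying in the
  quadrant, so the contour integral vanishes.

  For the estimates, the modes with \<open>\<mu> \<le> 0\<close> are free waves, which are cut off in time. For \<open>\<mu> > 0\<close> the mode
  \<open>exp (- sqrt \<mu> x\<^sub>n)\<close> is continued to \<open>x\<^sub>n < 0\<close> as \<open>g (sqrt \<mu> x\<^sub>n)\<close>, where \<open>g\<close> equals \<open>exp (- x)\<close> for \<open>x > 0\<close>, is as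
  smooth as \<open>s\<close> requires and has integral \<open>0\<close>. The Fourier transform of \<open>g\<close> then vanishes at \<open>0\<close>, and its square
  is integrable against \<open>\<bar>y\<bar> powr (2 s)\<close> near \<open>0\<close> exactly because \<open>s > -3/2\<close>.\<close>

section \<open>Fourier inversion\<close>

text \<open>\<open>ft_extends\<close> asks only for a density in frequency, so the extension is
  given by its transform and compared with \<open>vsol\<close> through pairings with test functions
  on \<open>Omega\<close>. For \<mu> > 0 the substitution \<eta> = sqrt \<mu> * y splits the weight
  into a function of the boundary frequency and a function of y. Squaring the kernel contributes 1 /
  \<mu>, the substitution sqrt \<mu>, and the modulation weight at most 1 + \<mu> because 2 b < 1,
  so (1 + \<mu>) / sqrt \<mu> remains. For \<mu> \<ge> 1 this has the size of the factor (1 +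
  |\<mu>|) powr (1/2) of the boundary norm. Near \<mu> = 0 it is singular while the boundary norm is
  not; a comparison frequency by frequency cannot repair this, so the support of h in time is used,
  and that argument asks for s \<ge> -3/2 a second time. For \<mu> \<le> 0 the Jacobian 2 \<eta>
  appears squared: one factor changes variables to the boundary frequency, the other is the sqrt
  |\<mu>| that the boundary norm pays for.\<close>

lemma
  fixes f :: "'a::euclidean_space \<Rightarrow> real \<Rightarrow> 'b::{real_normed_field,banach,second_countable_topology}"
  assumes int: "\<And>b. b \<in> Basis \<Longrightarrow> integrable lborel (f b)"
  shows integrable_lborel_prod_Basis: "integrable lborel (\<lambda>x::'a. \<Prod>b\<in>Basis. f b (x \<bullet> b))"
    and integral_lborel_prod_Basis:
      "(\<integral>x. (\<Prod>b\<in>Basis. f b (x \<bullet> b)) \<partial>lborel) = (\<Prod>b\<in>Basis. \<integral>x. f b x \<partial>lborel)"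
proof -
  interpret product_sigma_finite "\<lambda>_::'a. lborel :: real measure"
    by standard
  have meas[measurable]: "\<And>b. b \<in> Basis \<Longrightarrow> f b \<in> borel_measurable borel"
    using borel_measurable_integrable[OF int] by simp
  let ?T = "\<lambda>x. \<Sum>b\<in>Basis. x b *\<^sub>R (b::'a)"
  have T: "?T \<in> Pi\<^sub>M Basis (\<lambda>_::'a. lborel) \<rightarrow>\<^sub>M borel" by measurable
  have F: "(\<lambda>x::'a. \<Prod>b\<in>Basis. f b (x \<bullet> b)) \<in> borel_measurable borel"
    by (intro borel_measurable_prod measurable_compose[OF _ meas]) auto
  have eq: "(\<Prod>b\<in>Basis. f b (?T x \<bullet> b)) = (\<Prod>b\<in>Basis. f b (x b))" for x
    by (intro prod.cong refl) (simp add: inner_sum_left inner_Basis if_distrib cong: if_cong)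
  show "integrable lborel (\<lambda>x::'a. \<Prod>b\<in>Basis. f b (x \<bullet> b))"
    by (subst lborel_eq, subst integrable_distr_eq[OF T F], subst eq) (intro product_integrable_prod int finite_Basis)
  have "(\<integral>x. (\<Prod>b\<in>Basis. f b (x \<bullet> b)) \<partial>lborel) = (\<integral>x. (\<Prod>b\<in>Basis. f b (x b)) \<partial>Pi\<^sub>M Basis (\<lambda>_::'a. lborel))"
    by (subst lborel_eq, subst integral_distr[OF T F], subst eq) simp
  also have "\<dots> = (\<Prod>b\<in>Basis. \<integral>x. f b x \<partial>lborel)"
    by (intro product_integral_prod int finite_Basis)
  finally show "(\<integral>x. (\<Prod>b\<in>Basis. f b (x \<bullet> b)) \<partial>lborel) = (\<Prod>b\<in>Basis. \<integral>x. f b x \<partial>lborel)" .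
qed

lemma
  fixes f :: "'a::euclidean_space \<Rightarrow> 'b::{banach,second_countable_topology}"
  assumes c: "c \<noteq> 0"
  shows integral_lborel_affine: "f \<in> borel_measurable borel \<Longrightarrow>
      (\<integral>x. f x \<partial>lborel) = \<bar>c\<bar> ^ DIM('a) *\<^sub>R (\<integral>x. f (t + c *\<^sub>R x) \<partial>lborel)"
    and integrable_lborel_affine: "integrable lborel f \<Longrightarrow> integrable lborel (\<lambda>x. f (t + c *\<^sub>R x))"
proof -
  assume [measurable]: "f \<in> borel_measurable borel"
  show "(\<integral>x. f x \<partial>lborel) = \<bar>c\<bar> ^ DIM('a) *\<^sub>R (\<integral>x. f (t + c *\<^sub>R x) \<partial>lborel)"
    by (subst lborel_affine[OF c, of t]) (simp add: integral_density integral_distr)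
next
  assume i: "integrable lborel f"
  then have [measurable]: "f \<in> borel_measurable borel" by auto
  from i have "integrable (density (distr lborel borel (\<lambda>x. t + c *\<^sub>R x)) (\<lambda>_. \<bar>c\<bar>^DIM('a))) f"
    using lborel_affine[OF c, of t] by simp
  then have "integrable lborel (\<lambda>x. \<bar>c\<bar>^DIM('a) *\<^sub>R f (t + c *\<^sub>R x))"
    by (simp add: integrable_density integrable_distr_eq)
  from integrable_scaleR_right[OF this, of "1 / \<bar>c\<bar>^DIM('a)"]
  show "integrable lborel (\<lambda>x. f (t + c *\<^sub>R x))"
    using c by simp
qed

lemma
  fixes f :: "'a::euclidean_space \<Rightarrow> 'b::{banach,second_countable_topology}"
  shows integral_lborel_translate: "(\<integral>x. f (t + x) \<partial>lborel) = (\<integral>x. f x \<partial>lborel)"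
    and integrable_lborel_translate: "integrable lborel (\<lambda>x. f (t + x)) \<longleftrightarrow> integrable lborel f"
proof -
  have meas: "f \<in> borel_measurable borel" if "(\<lambda>x. f (t + x)) \<in> borel_measurable borel"
  proof -
    have "(\<lambda>x. f (t + (x - t))) \<in> borel_measurable borel"
      using that by measurable
    then show ?thesis by simp
  qed
  show *: "integrable lborel (\<lambda>x. f (t + x)) \<longleftrightarrow> integrable lborel f"
    using integrable_lborel_affine[of 1 f t] integrable_lborel_affine[of 1 "\<lambda>x. f (t + x)" "-t"] by auto
  show "(\<integral>x. f (t + x) \<partial>lborel) = (\<integral>x. f x \<partial>lborel)"
  proof (cases "integrable lborel f")
    case True
    then show ?thesis using integral_lborel_affine[of 1 f t] by auto
  next
    case False
    \<comment> \<open>Neither function is integrable, so both integrals have the default value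
      0.\<close>
    then show ?thesis using * by (simp add: not_integrable_integral_eq)
  qed
qed

lemma integrable_lborel_pair_mult:
  fixes f :: "'a::euclidean_space \<Rightarrow> 'c::{real_normed_field,banach,second_countable_topology}"
    and g :: "'b::euclidean_space \<Rightarrow> 'c"
  assumes f: "integrable lborel f" and g: "integrable lborel g"
  shows "integrable (lborel \<Otimes>\<^sub>M lborel) (\<lambda>(x, y). f x * g y)"
proof (rule lborel_pair.Fubini_integrable)
  have [measurable]: "f \<in> borel_measurable borel" "g \<in> borel_measurable borel"
    using f g by auto
  show "(\<lambda>(x, y). f x * g y) \<in> borel_measurable (lborel \<Otimes>\<^sub>M lborel)"
    by measurable
  show "integrable lborel (\<lambda>x. \<integral>y. norm (case (x, y) of (x, y) \<Rightarrow> f x * g y) \<partial>lborel)"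
    using f by (simp add: norm_mult)
qed (use g in simp)

lemma measurable_fst_borel[measurable]:
  "fst \<in> (borel :: ('a::euclidean_space \<times> 'b::euclidean_space) measure) \<rightarrow>\<^sub>M borel"
  by (intro borel_measurable_continuous_onI continuous_intros)

lemma measurable_snd_borel[measurable]:
  "snd \<in> (borel :: ('a::euclidean_space \<times> 'b::euclidean_space) measure) \<rightarrow>\<^sub>M borel"
  by (intro borel_measurable_continuous_onI continuous_intros)

text \<open>Stated on any Euclidean space, so that one inversion theorem serves the real line, the
  boundary variables and space-time. With \<open>cis\<close> the unit modulus of the kernel is a
  simplification rule.\<close>

definition ft :: "('a::euclidean_space \<Rightarrow> complex) \<Rightarrow> 'a \<Rightarrow> complex" where
  "ft f \<xi> = (\<integral>z. cis (- (\<xi> \<bullet> z)) * f z \<partial>lborel)"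

lemma measurable_cis[measurable]: "cis \<in> borel_measurable borel"
  by (intro borel_measurable_continuous_onI continuous_intros)

lemma integrable_pointwise_bound:
  fixes f :: "'a \<Rightarrow> 'b::{banach, second_countable_topology}"
    and g :: "'a \<Rightarrow> 'c::{banach, second_countable_topology}"
  assumes "integrable M g" "f \<in> borel_measurable M" "\<And>x. norm (f x) \<le> norm (g x)"
  shows "integrable M f"
  using assms by (intro Bochner_Integration.integrable_bound[OF assms(1)] AE_I2) auto

lemma integrable_cis_mult:
  assumes "integrable M f" "g \<in> borel_measurable M"
  shows "integrable M (\<lambda>x. cis (g x) * f x)"
  using assms(1)
  by (rule Bochner_Integration.integrable_bound)
     (use assms in \<open>auto simp: norm_mult\<close>)

lemma ft_measurable[measurable]:
  assumes [measurable]: "f \<in> borel_measurable borel"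
  shows "ft f \<in> borel_measurable borel"
  unfolding ft_def by measurable

lemma norm_ft_le: "norm (ft f \<xi>) \<le> (\<integral>z. norm (f z) \<partial>lborel)"
  unfolding ft_def by (rule order_trans[OF integral_norm_bound]) (simp add: norm_mult)

lemma gauss_ft_real:
  fixes t :: real
  shows "integrable lborel (\<lambda>x. cis (t * x) * of_real (exp (- x\<^sup>2 / 2)))"
    and "(\<integral>x. cis (t * x) * of_real (exp (- x\<^sup>2 / 2)) \<partial>lborel) = of_real (sqrt (2 * pi) * exp (- t\<^sup>2 / 2))"
proof -
  have int: "integrable lborel (\<lambda>x. exp (- x\<^sup>2 / 2) :: real)"
  proof -
    have "integrable lborel (\<lambda>x. sqrt (2 * pi) * std_normal_density x)" by simp
    then show ?thesis by (simp add: std_normal_density_def)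
  qed
  then show "integrable lborel (\<lambda>x. cis (t * x) * of_real (exp (- x\<^sup>2 / 2)))"
    by (intro integrable_cis_mult) auto
  have "(\<integral>x. cis (t * x) * of_real (exp (- x\<^sup>2 / 2)) \<partial>lborel)
      = of_real (sqrt (2 * pi)) * (\<integral>x. std_normal_density x *\<^sub>R iexp (t * x) \<partial>lborel)"
    unfolding integral_mult_right_zero[symmetric]
    by (intro Bochner_Integration.integral_cong refl)
       (simp add: std_normal_density_def cis_conv_exp scaleR_conv_of_real real_sqrt_mult field_simps)
  also have "\<dots> = of_real (sqrt (2 * pi)) * char std_normal_distribution t"
    unfolding char_def by (simp add: integral_density)
  finally show "(\<integral>x. cis (t * x) * of_real (exp (- x\<^sup>2 / 2)) \<partial>lborel) = of_real (sqrt (2 * pi) * exp (- t\<^sup>2 / 2))"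
    by (simp add: char_std_normal_distribution del: integral_mult_right_zero)
qed

lemma norm_sq_Basis: "(norm (x::'a::euclidean_space))\<^sup>2 = (\<Sum>b\<in>Basis. (x \<bullet> b)\<^sup>2)"
  unfolding power2_norm_eq_inner by (subst euclidean_inner) (simp add: power2_eq_square)

lemma cis_sum: "finite A \<Longrightarrow> cis (\<Sum>a\<in>A. f a) = (\<Prod>a\<in>A. cis (f a))"
  by (induction A rule: finite_induct) (auto simp flip: cis_mult)

abbreviation gauss :: "'a::euclidean_space \<Rightarrow> real" where
  "gauss x \<equiv> exp (- (norm x)\<^sup>2 / 2)"

text \<open>The Gaussian is a product over the coordinates, and in dimension one its transform is
  the characteristic function of the standard normal distribution.\<close>

lemma gauss_ft:
  fixes t :: "'a::euclidean_space"
  shows integrable_gauss_cis: "integrable lborel (\<lambda>x. cis (t \<bullet> x) * of_real (gauss x))"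
    and integral_gauss_cis:
      "(\<integral>x. cis (t \<bullet> x) * of_real (gauss x) \<partial>lborel) = of_real (sqrt (2 * pi) ^ DIM('a) * gauss t)"
proof -
  have g: "gauss x = (\<Prod>b\<in>Basis. exp (- (x \<bullet> b)\<^sup>2 / 2))" for x :: 'a
    by (simp add: norm_sq_Basis exp_sum[symmetric] sum_negf sum_divide_distrib)
  have eq: "cis (t \<bullet> x) * of_real (gauss x) = (\<Prod>b\<in>Basis. cis ((t \<bullet> b) * (x \<bullet> b)) * of_real (exp (- (x \<bullet> b)\<^sup>2 / 2)))" for x
    unfolding g by (simp add: prod.distrib euclidean_inner[of t x] cis_sum)
  show "integrable lborel (\<lambda>x. cis (t \<bullet> x) * of_real (gauss x))"
    unfolding eq by (rule integrable_lborel_prod_Basis) (rule gauss_ft_real)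
  show "(\<integral>x. cis (t \<bullet> x) * of_real (gauss x) \<partial>lborel) = of_real (sqrt (2 * pi) ^ DIM('a) * gauss t)"
    unfolding eq
    by (subst integral_lborel_prod_Basis, rule gauss_ft_real, subst gauss_ft_real)
       (simp only: g[of t] of_real_mult of_real_prod of_real_power prod.distrib prod_constant)
qed

lemma integrable_gauss: "integrable lborel (gauss :: 'a::euclidean_space \<Rightarrow> real)"
  using integrable_norm[OF integrable_gauss_cis[of "0::'a"]] by simp


text \<open>The integral is regularised by the factor \<open>gauss (e n *\<^sub>R \<xi>)\<close> and
  its limit is taken in two ways. Dominated convergence with majorant
  \<open>norm (ft f \<xi>)\<close> gives the left side; Fubini turns the regularised integral into
  an average of \<open>f\<close> against a Gaussian concentrating at \<open>x\<close>, which gives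
  the right side.\<close>

theorem ft_inversion:
  fixes f :: "'a::euclidean_space \<Rightarrow> complex"
  assumes cont: "continuous_on UNIV f" and f: "integrable lborel f" and bdd: "\<And>x. norm (f x) \<le> B"
    and ftf: "integrable lborel (ft f)"
  shows "(\<integral>\<xi>. cis (\<xi> \<bullet> x) * ft f \<xi> \<partial>lborel) = of_real ((2 * pi) ^ DIM('a)) * f x"
proof -
  have [measurable]: "f \<in> borel_measurable borel" using f by auto
  define e where "e n = 1 / (real n + 1)" for n
  have e: "e n > 0" "e n \<noteq> 0" for n by (auto simp: e_def)
  have e0: "e \<longlonglongrightarrow> 0" unfolding e_def by real_asymp
  define J where "J n = (\<integral>\<xi>. cis (\<xi> \<bullet> x) * ft f \<xi> * of_real (gauss (e n *\<^sub>R \<xi>)) \<partial>lborel)" for n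
  have "J \<longlonglongrightarrow> (\<integral>\<xi>. cis (\<xi> \<bullet> x) * ft f \<xi> \<partial>lborel)"
    unfolding J_def
  proof (rule integral_dominated_convergence[where w = "\<lambda>\<xi>. norm (ft f \<xi>)"])
    show "AE \<xi> in lborel. (\<lambda>n. cis (\<xi> \<bullet> x) * ft f \<xi> * of_real (gauss (e n *\<^sub>R \<xi>))) \<longlonglongrightarrow> cis (\<xi> \<bullet> x) * ft f \<xi>"
    proof (rule AE_I2)
      fix \<xi> :: 'a
      have "(\<lambda>n. cis (\<xi> \<bullet> x) * ft f \<xi> * of_real (gauss (e n *\<^sub>R \<xi>))) \<longlonglongrightarrow> cis (\<xi> \<bullet> x) * ft f \<xi> * of_real (gauss (0 *\<^sub>R \<xi>))"
        by (intro tendsto_intros e0) auto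
      then show "(\<lambda>n. cis (\<xi> \<bullet> x) * ft f \<xi> * of_real (gauss (e n *\<^sub>R \<xi>))) \<longlonglongrightarrow> cis (\<xi> \<bullet> x) * ft f \<xi>"
        by simp
    qed
    show "integrable lborel (\<lambda>\<xi>. norm (ft f \<xi>))" using ftf by simp
    show "AE \<xi> in lborel. norm (cis (\<xi> \<bullet> x) * ft f \<xi> * of_real (gauss (e n *\<^sub>R \<xi>))) \<le> norm (ft f \<xi>)" for n
      by (rule AE_I2) (auto simp: norm_mult intro!: mult_right_le_one_le)
  qed measurable
  moreover have "J \<longlonglongrightarrow> of_real ((2 * pi) ^ DIM('a)) * f x"
  proof -
    let ?c = "sqrt (2 * pi) ^ DIM('a)"
    have J: "J n = (\<integral>z. of_real ?c * (f (x + e n *\<^sub>R z) * of_real (gauss z)) \<partial>lborel)" for n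
    proof -
      have gint: "integrable lborel (\<lambda>\<xi>::'a. gauss (e n *\<^sub>R \<xi>))"
        using integrable_lborel_affine[OF e(2), OF integrable_gauss, of 0] by simp
      have inner: "(\<integral>\<xi>. cis (\<xi> \<bullet> (x - y)) * of_real (gauss (e n *\<^sub>R \<xi>)) \<partial>lborel)
          = of_real (?c / e n ^ DIM('a) * gauss ((y - x) /\<^sub>R e n))" for y
      proof -
        have "of_real (?c * gauss ((x - y) /\<^sub>R e n)) = (\<integral>\<xi>. cis (((x - y) /\<^sub>R e n) \<bullet> \<xi>) * of_real (gauss \<xi>) \<partial>lborel)"
          by (rule integral_gauss_cis[symmetric])
        also have "\<dots> = \<bar>e n\<bar> ^ DIM('a) *\<^sub>R (\<integral>\<xi>. cis (((x - y) /\<^sub>R e n) \<bullet> (0 + e n *\<^sub>R \<xi>)) * of_real (gauss (0 + e n *\<^sub>R \<xi>)) \<partial>lborel)"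
          by (rule integral_lborel_affine) (use e in auto)
        also have "\<dots> = of_real (e n ^ DIM('a)) * (\<integral>\<xi>. cis (\<xi> \<bullet> (x - y)) * of_real (gauss (e n *\<^sub>R \<xi>)) \<partial>lborel)"
          using e[of n]
          by (simp add: scaleR_conv_of_real inner_commute less_imp_le mult.assoc[symmetric])
        finally show ?thesis
          using e[of n] by (simp add: field_simps norm_minus_commute)
      qed
      have cis_split: "cis (\<xi> \<bullet> (x - y)) = cis (\<xi> \<bullet> x) * cis (- (\<xi> \<bullet> y))" for \<xi> y
        by (simp add: cis_mult inner_diff_right)
      have "J n = (\<integral>\<xi>. \<integral>y. cis (\<xi> \<bullet> (x - y)) * of_real (gauss (e n *\<^sub>R \<xi>)) * f y \<partial>lborel \<partial>lborel)"
        unfolding J_def ft_def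
        unfolding integral_mult_right_zero[symmetric] integral_mult_left_zero[symmetric] cis_split
        by (simp only: mult_ac)
      also have "\<dots> = (\<integral>y. \<integral>\<xi>. cis (\<xi> \<bullet> (x - y)) * of_real (gauss (e n *\<^sub>R \<xi>)) * f y \<partial>lborel \<partial>lborel)"
      proof (rule lborel_pair.Fubini_integral)
        have "integrable (lborel \<Otimes>\<^sub>M lborel) (\<lambda>(y, \<xi>::'a). f y * complex_of_real (gauss (e n *\<^sub>R \<xi>)))"
          by (intro integrable_lborel_pair_mult f) (rule integrable_of_real[OF gint])
        then show "integrable (lborel \<Otimes>\<^sub>M lborel) (\<lambda>(y, \<xi>). cis (\<xi> \<bullet> (x - y)) * of_real (gauss (e n *\<^sub>R \<xi>)) * f y)"
        proof (rule integrable_pointwise_bound)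
          show "(\<lambda>(y, \<xi>::'a). cis (\<xi> \<bullet> (x - y)) * of_real (gauss (e n *\<^sub>R \<xi>)) * f y) \<in> borel_measurable (lborel \<Otimes>\<^sub>M lborel)"
            by measurable
          fix p :: "'a \<times> 'a"
          show "norm (case p of (y, \<xi>) \<Rightarrow> cis (\<xi> \<bullet> (x - y)) * of_real (gauss (e n *\<^sub>R \<xi>)) * f y)
            \<le> norm (case p of (y, \<xi>) \<Rightarrow> f y * complex_of_real (gauss (e n *\<^sub>R \<xi>)))"
            by (cases p) (simp add: norm_mult)
        qed
      qed
      also have "\<dots> = (\<integral>y. of_real (?c / e n ^ DIM('a) * gauss ((y - x) /\<^sub>R e n)) * f y \<partial>lborel)"
        by (simp only: integral_mult_left_zero inner)
      \<comment> \<open>Substituting y = x + e n z moves the concentration into the argument of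
        \<open>f\<close>: the powers of \<open>e n\<close> cancel, continuity gives pointwise
        convergence, and \<open>B * gauss z\<close> is a fixed majorant up to a constant.\<close>
      also have "\<dots> = \<bar>e n\<bar> ^ DIM('a) *\<^sub>R (\<integral>z. of_real (?c / e n ^ DIM('a) * gauss (((x + e n *\<^sub>R z) - x) /\<^sub>R e n)) * f (x + e n *\<^sub>R z) \<partial>lborel)"
        by (rule integral_lborel_affine[OF e(2)]) measurable
      also have "\<dots> = (\<integral>z. of_real ?c * (f (x + e n *\<^sub>R z) * of_real (gauss z)) \<partial>lborel)"
        using e[of n]
        unfolding scaleR_conv_of_real integral_mult_right_zero[symmetric]
        by (intro Bochner_Integration.integral_cong refl) (simp add: less_imp_le)
      finally show ?thesis .
    qed
    have "(\<lambda>n. \<integral>z. of_real ?c * (f (x + e n *\<^sub>R z) * of_real (gauss z)) \<partial>lborel)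
        \<longlonglongrightarrow> (\<integral>z. of_real ?c * (f x * of_real (gauss (z::'a))) \<partial>lborel)"
    proof (rule integral_dominated_convergence[where w = "\<lambda>z. ?c * (B * gauss z)"])
      show "AE z in lborel. (\<lambda>n. of_real ?c * (f (x + e n *\<^sub>R z) * of_real (gauss z))) \<longlonglongrightarrow> of_real ?c * (f x * of_real (gauss z))"
      proof (rule AE_I2)
        fix z
        have "(\<lambda>n. x + e n *\<^sub>R z) \<longlonglongrightarrow> x + 0 *\<^sub>R z" by (intro tendsto_intros e0)
        then have "(\<lambda>n. f (x + e n *\<^sub>R z)) \<longlonglongrightarrow> f x"
          using cont by (auto intro!: continuous_on_tendsto_compose[OF cont])
        then show "(\<lambda>n. of_real ?c * (f (x + e n *\<^sub>R z) * of_real (gauss z))) \<longlonglongrightarrow> of_real ?c * (f x * of_real (gauss z))"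
          by (intro tendsto_intros)
      qed
      show "integrable lborel (\<lambda>z::'a. ?c * (B * gauss z))" using integrable_gauss by auto
      show "AE z in lborel. norm (of_real ?c * (f (x + e n *\<^sub>R z) * of_real (gauss z))) \<le> ?c * (B * gauss z)" for n
        by (rule AE_I2) (auto simp: norm_mult norm_power intro!: mult_left_mono mult_right_mono bdd)
    qed measurable
    also have "(\<integral>z. of_real ?c * (f x * of_real (gauss (z::'a))) \<partial>lborel) = of_real ((2 * pi) ^ DIM('a)) * f x"
    proof -
      have "(\<integral>z. complex_of_real (gauss (z::'a)) \<partial>lborel) = of_real ?c"
        using integral_gauss_cis[of "0::'a"] by simp
      then have "(\<integral>z. of_real ?c * (f x * of_real (gauss (z::'a))) \<partial>lborel) = of_real (?c * ?c) * f x"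
        by (simp only: integral_mult_right_zero of_real_mult mult_ac)
      also have "?c * ?c = (2 * pi) ^ DIM('a)"
        by (subst power_mult_distrib[symmetric]) simp
      finally show ?thesis .
    qed
    finally show ?thesis unfolding J .
  qed
  ultimately show ?thesis by (rule LIMSEQ_unique)
qed

section \<open>Fourier transforms of test functions\<close>

lemma test_fun_on_mono: "test_fun_on A f \<Longrightarrow> A \<subseteq> B \<Longrightarrow> test_fun_on B f"
  by (auto simp: test_fun_on_def)

lemma not_in_tsupport: "x \<notin> tsupport f \<Longrightarrow> f x = 0"
  using closure_subset[of "{x. f x \<noteq> 0}"] by (auto simp: tsupport_def)

lemma dderiv_eq_0:
  assumes "open S" "x \<in> S" "\<And>y. y \<in> S \<Longrightarrow> f y = 0"
  shows "dderiv e f x = 0"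
proof -
  have "((\<lambda>r::real. x + r *\<^sub>R e) \<longlongrightarrow> x + 0 *\<^sub>R e) (nhds 0)"
    by (intro tendsto_intros filterlim_ident)
  then have "\<forall>\<^sub>F r in nhds (0::real). x + r *\<^sub>R e \<in> S"
    using assms(1,2) by (auto dest!: topological_tendstoD)
  then have "\<forall>\<^sub>F r in nhds (0::real). (0::complex) = f (x + r *\<^sub>R e)"
    by eventually_elim (simp add: assms(3))
  then have "((\<lambda>r::real. f (x + r *\<^sub>R e)) has_vector_derivative 0) (at 0)"
    by (subst has_vector_derivative_cong_ev[where g = "\<lambda>_. 0"])
       (auto elim: eventually_mono dest: eventually_nhds_x_imp_x)
  then show ?thesis by (simp add: dderiv_def vector_derivative_at)
qed

lemma tsupport_dderiv: "tsupport (dderiv e f) \<subseteq> tsupport f"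
proof -
  have "dderiv e f x = 0" if "x \<notin> tsupport f" for x
    using that by (intro dderiv_eq_0[of "- tsupport f"]) (simp_all add: not_in_tsupport, simp add: tsupport_def open_Compl)
  then have "{x. dderiv e f x \<noteq> 0} \<subseteq> tsupport f" by auto
  then show ?thesis by (simp add: tsupport_def closure_minimal)
qed

lemma pderivs_append: "pderivs (es @ fs) f = pderivs es (pderivs fs f)"
  by (induction es) auto

lemma test_fun_dderiv:
  assumes "test_fun_on A f" "e \<in> Basis"
  shows "test_fun_on A (dderiv e f)"
proof -
  have "smooth_fun (dderiv e f)"
    unfolding smooth_fun_def
  proof (intro allI impI)
    fix es :: "'a list" assume "set es \<subseteq> Basis"
    \<comment> \<open>\<open>pderivs\<close> applies the head of its list last, so a derivative
      taken first belongs at the end of the list.\<close>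
    then have "set (es @ [e]) \<subseteq> Basis" using assms by auto
    then show "continuous_on UNIV (pderivs es (dderiv e f)) \<and>
      (\<forall>e'\<in>Basis. \<forall>x. (\<lambda>r::real. pderivs es (dderiv e f) (x + r *\<^sub>R e')) differentiable (at 0))"
      using assms(1) unfolding test_fun_on_def smooth_fun_def
      by (auto simp: pderivs_append dest!: spec[of _ "es @ [e]"])
  qed
  moreover have "compact (tsupport (dderiv e f))"
    using assms(1) tsupport_dderiv[of e f] unfolding test_fun_on_def
    by (metis closed_closure compact_Int_closed inf.absorb_iff2 tsupport_def)
  ultimately show ?thesis
    using assms(1) tsupport_dderiv[of e f] by (auto simp: test_fun_on_def)
qed

lemma test_fun_continuous: "test_fun_on A f \<Longrightarrow> continuous_on UNIV f"
  unfolding test_fun_on_def smooth_fun_def by (metis empty_subsetI list.set(1) pderivs.simps(1))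

lemma test_fun_differentiable:
  "test_fun_on A f \<Longrightarrow> e \<in> Basis \<Longrightarrow> (\<lambda>r::real. f (x + r *\<^sub>R e)) differentiable (at 0)"
  unfolding test_fun_on_def smooth_fun_def by (metis empty_subsetI list.set(1) pderivs.simps(1))

lemma test_fun_measurable: "test_fun_on A f \<Longrightarrow> f \<in> borel_measurable borel"
  by (intro borel_measurable_continuous_onI test_fun_continuous)

lemma test_fun_bounded:
  assumes "test_fun_on A f"
  obtains B where "\<And>x. norm (f x) \<le> B" "B \<ge> 0"
proof -
  have "compact (f ` tsupport f)"
    using assms continuous_on_subset[OF test_fun_continuous[OF assms]]
    by (intro compact_continuous_image) (auto simp: test_fun_on_def)
  then obtain B where B: "\<And>x. x \<in> tsupport f \<Longrightarrow> norm (f x) \<le> B"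
    by (metis compact_imp_bounded bounded_iff imageI)
  have "norm (f x) \<le> \<bar>B\<bar>" for x
    by (cases "x \<in> tsupport f") (use B[of x] in \<open>auto simp: not_in_tsupport\<close>)
  then show ?thesis by (intro that[of "\<bar>B\<bar>"]) auto
qed

lemma integrable_indicator_compact: "compact K \<Longrightarrow> integrable lborel (indicator K :: 'a::euclidean_space \<Rightarrow> real)"
  by (rule integrable_real_indicator[OF _ emeasure_compact_finite]) (auto simp: compact_imp_closed)

lemma integrable_exp_linear_test_fun:
  fixes f :: "'a::euclidean_space \<Rightarrow> complex" and L :: "'a \<Rightarrow> complex"
  assumes f: "test_fun_on A f" and L: "bounded_linear L"
  shows "integrable lborel (\<lambda>z. exp (L z) * f z)"
proof -
  have c: "continuous_on S L" for S using L by (rule bounded_linear.continuous_on) (rule continuous_on_id)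
  have cf: "continuous_on S f" for S using test_fun_continuous[OF f] continuous_on_subset by blast
  have "integrable lborel (\<lambda>z. indicator (tsupport f) z *\<^sub>R (exp (L z) * f z))"
    using f by (intro borel_integrable_compact[unfolded set_integrable_def] continuous_intros c cf) (auto simp: test_fun_on_def)
  also have "(\<lambda>z. indicator (tsupport f) z *\<^sub>R (exp (L z) * f z)) = (\<lambda>z. exp (L z) * f z)"
    by (auto simp: indicator_def not_in_tsupport)
  finally show ?thesis .
qed

lemma integrable_test_fun: "test_fun_on A f \<Longrightarrow> integrable lborel f"
  using integrable_exp_linear_test_fun[of A f "\<lambda>_. 0"] by simp

text \<open>\<open>smooth_fun\<close> speaks of lines only at parameter 0; moving the base point
  along the line gives every parameter.\<close>

lemma test_fun_has_dderiv:
  assumes f: "test_fun_on A f" and e: "e \<in> Basis"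
  shows "((\<lambda>r::real. f (x + r *\<^sub>R e)) has_vector_derivative dderiv e f (x + r *\<^sub>R e)) (at r)"
proof -
  have "((\<lambda>s::real. f (x + r *\<^sub>R e + s *\<^sub>R e)) has_vector_derivative dderiv e f (x + r *\<^sub>R e)) (at 0)"
    unfolding dderiv_def using test_fun_differentiable[OF f e]
    by (intro vector_derivative_works[THEN iffD1])
  then have "((\<lambda>s::real. f (x + r *\<^sub>R e + (s - r) *\<^sub>R e)) has_vector_derivative dderiv e f (x + r *\<^sub>R e)) (at r)"
    using vector_diff_chain_at[of "\<lambda>s. s - r" 1 r "\<lambda>s. f (x + r *\<^sub>R e + s *\<^sub>R e)" "dderiv e f (x + r *\<^sub>R e)"]
    by (force simp: o_def has_vector_derivative_def intro!: derivative_eq_intros)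
  then show ?thesis by (simp add: algebra_simps)
qed

text \<open>With the scalar difference quotient, differentiating an integral becomes a limit along
  sequences, to which dominated convergence applies.\<close>

lemma has_vector_derivative_at_iff_quotient:
  fixes f :: "real \<Rightarrow> 'a::real_normed_vector"
  shows "(f has_vector_derivative D) (at r) \<longleftrightarrow> ((\<lambda>s. (f (r + s) - f r) /\<^sub>R s) \<longlongrightarrow> D) (at 0)"
proof -
  have "(f has_vector_derivative D) (at r) \<longleftrightarrow> ((\<lambda>s. norm (f (r + s) - f r - s *\<^sub>R D) / norm s) \<longlongrightarrow> 0) (at 0)"
    by (simp add: has_vector_derivative_def has_derivative_at bounded_linear_scaleR_left)
  also have "\<dots> \<longleftrightarrow> ((\<lambda>s. norm ((f (r + s) - f r) /\<^sub>R s - D)) \<longlongrightarrow> 0) (at 0)"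
  proof (rule filterlim_cong[OF refl refl])
    have "norm (f (r + s) - f r - s *\<^sub>R D) / norm s = norm ((f (r + s) - f r) /\<^sub>R s - D)" if "s \<noteq> 0" for s
    proof -
      have "(f (r + s) - f r) /\<^sub>R s - D = (f (r + s) - f r - s *\<^sub>R D) /\<^sub>R s"
        using that by (simp add: scaleR_diff_right)
      then show ?thesis by (simp add: divide_inverse mult.commute)
    qed
    then show "\<forall>\<^sub>F s in at 0. norm (f (r + s) - f r - s *\<^sub>R D) / norm s = norm ((f (r + s) - f r) /\<^sub>R s - D)"
      by (simp add: eventually_at_filter)
  qed
  also have "\<dots> \<longleftrightarrow> ((\<lambda>s. (f (r + s) - f r) /\<^sub>R s) \<longlongrightarrow> D) (at 0)"
    by (simp add: tendsto_norm_zero_iff LIM_zero_iff)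
  finally show ?thesis .
qed

text \<open>Obtained by differentiating \<open>\<integral> exp (L z) f (z + r e) dz = exp (- r L e) \<integral> exp (L z) f z dz\<close> at
  \<open>r = 0\<close>, which avoids a product rule and Fubini.\<close>

lemma integral_exp_linear_dderiv:
  fixes f :: "'a::euclidean_space \<Rightarrow> complex" and L :: "'a \<Rightarrow> complex"
  assumes f: "test_fun_on A f" and e: "e \<in> Basis" and L: "bounded_linear L"
  shows "(\<integral>z. exp (L z) * dderiv e f z \<partial>lborel) = - L e * (\<integral>z. exp (L z) * f z \<partial>lborel)"
proof -
  interpret L: bounded_linear L by fact
  have cL: "continuous_on S L" for S using L by (rule bounded_linear.continuous_on) (rule continuous_on_id)
  have [measurable]: "L \<in> borel_measurable borel" by (rule borel_measurable_continuous_onI[OF cL])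
  have [measurable]: "f \<in> borel_measurable borel" "dderiv e f \<in> borel_measurable borel"
    using f test_fun_dderiv[OF f e] by (auto intro: test_fun_measurable)
  obtain B where B: "\<And>x. norm (dderiv e f x) \<le> B" "B \<ge> 0"
    using test_fun_bounded[OF test_fun_dderiv[OF f e]] by metis
  obtain R where R: "\<And>x. x \<in> tsupport f \<Longrightarrow> norm x \<le> R"
    using f unfolding test_fun_on_def by (metis compact_imp_bounded bounded_iff)
  \<comment> \<open>Since \<open>r n \<le> 1\<close>, the ball of radius \<open>R + 1\<close>
    contains the support of \<open>f\<close> and all translates of it that occur, so a multiple of
    its indicator dominates the difference quotients.\<close>
  have "compact ((\<lambda>z. exp (L z)) ` cball 0 (R + 1))"
    by (intro compact_continuous_image continuous_intros cL compact_cball)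
  then obtain E where E: "\<And>z. norm z \<le> R + 1 \<Longrightarrow> norm (exp (L z)) \<le> E"
    by (metis compact_imp_bounded bounded_iff imageI mem_cball_0)
  define I where "I = (\<integral>z. exp (L z) * f z \<partial>lborel)"
  define r where "r n = 1 / (real n + 1)" for n
  have r: "0 < r n" "r n \<le> 1" "r n \<noteq> 0" for n by (auto simp: r_def)
  have r0: "r \<longlonglongrightarrow> 0" unfolding r_def by real_asymp
  have diff_bound: "norm (f (z + s *\<^sub>R e) - f z) \<le> B * s" if "0 < s" for z s
  proof -
    have "norm (f (z + s *\<^sub>R e) - f (z + 0 *\<^sub>R e)) \<le> B * norm (s - 0)"
    proof (rule differentiable_bound[where S = UNIV and f' = "\<lambda>r h. h *\<^sub>R dderiv e f (z + r *\<^sub>R e)"])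
      show "((\<lambda>r. f (z + r *\<^sub>R e)) has_derivative (\<lambda>h. h *\<^sub>R dderiv e f (z + r *\<^sub>R e))) (at r within UNIV)" for r
        using test_fun_has_dderiv[OF f e, of z r] by (simp add: has_vector_derivative_def)
      show "onorm (\<lambda>h. h *\<^sub>R dderiv e f (z + r *\<^sub>R e)) \<le> B" for r :: real
        by (rule onorm_le) (use mult_left_mono[OF B(1)] in \<open>simp add: mult.commute[of B]\<close>)
    qed auto
    then show ?thesis using that by simp
  qed
  let ?q = "\<lambda>n z. exp (L z) * ((f (z + r n *\<^sub>R e) - f z) /\<^sub>R r n)"
  have lim: "(\<lambda>n. \<integral>z. ?q n z \<partial>lborel) \<longlonglongrightarrow> (\<integral>z. exp (L z) * dderiv e f z \<partial>lborel)"
  proof (rule integral_dominated_convergence[where w = "\<lambda>z. E * B * indicator (cball 0 (R + 1)) z"])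
    show "integrable lborel (\<lambda>z::'a. E * B * indicator (cball 0 (R + 1)) z)"
      by (intro integrable_mult_right integrable_indicator_compact compact_cball)
    show "AE z in lborel. norm (?q n z) \<le> E * B * indicator (cball 0 (R + 1)) z" for n
    proof (rule AE_I2)
      fix z :: 'a
      show "norm (?q n z) \<le> E * B * indicator (cball 0 (R + 1)) z"
      proof (cases "norm z \<le> R + 1")
        case True
        have "norm (exp (L z)) * norm ((f (z + r n *\<^sub>R e) - f z) /\<^sub>R r n) \<le> E * B"
        proof (intro mult_mono)
          show "norm ((f (z + r n *\<^sub>R e) - f z) /\<^sub>R r n) \<le> B"
            using diff_bound[OF r(1), of z n] r[of n] unfolding norm_scaleR
            by (simp add: divide_inverse[symmetric] inverse_eq_divide pos_divide_le_eq)
          show "norm (exp (L z)) \<le> E" using E True by auto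
          then show "0 \<le> E" using norm_ge_zero order_trans by blast
        qed auto
        then show ?thesis using True by (simp add: norm_mult mult.left_commute)
      next
        case False
        then have "z \<notin> tsupport f" using R[of z] by auto
        moreover have "z + r n *\<^sub>R e \<notin> tsupport f"
        proof
          assume "z + r n *\<^sub>R e \<in> tsupport f"
          then have "norm (z + r n *\<^sub>R e) \<le> R" by (rule R)
          moreover have "norm z \<le> norm (z + r n *\<^sub>R e) + norm (r n *\<^sub>R e)"
            using norm_triangle_ineq4[of "z + r n *\<^sub>R e" "r n *\<^sub>R e"] by simp
          ultimately show False using False r[of n] e by simp
        qed
        ultimately show ?thesis using False by (simp add: not_in_tsupport)
      qed
    qed
    show "AE z in lborel. (\<lambda>n. ?q n z) \<longlonglongrightarrow> exp (L z) * dderiv e f z"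
    proof (rule AE_I2)
      fix z
      have "((\<lambda>s::real. f (z + s *\<^sub>R e)) has_vector_derivative dderiv e f z) (at 0)"
        using test_fun_has_dderiv[OF f e, of z 0] by simp
      then have "((\<lambda>s. (f (z + s *\<^sub>R e) - f z) /\<^sub>R s) \<longlongrightarrow> dderiv e f z) (at 0)"
        by (simp add: has_vector_derivative_at_iff_quotient)
      then have "(\<lambda>n. (f (z + r n *\<^sub>R e) - f z) /\<^sub>R r n) \<longlonglongrightarrow> dderiv e f z"
        by (rule filterlim_compose) (use r r0 in \<open>auto simp: filterlim_at\<close>)
      then show "(\<lambda>n. ?q n z) \<longlonglongrightarrow> exp (L z) * dderiv e f z"
        by (intro tendsto_intros)
    qed
  qed measurable
  have q: "(\<integral>z. ?q n z \<partial>lborel) = ((exp (- r n *\<^sub>R L e) - 1) /\<^sub>R r n) * I" for n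
  proof -
    have i: "integrable lborel (\<lambda>z. exp (L z) * f z)"
      by (rule integrable_exp_linear_test_fun[OF f L])
    have eq: "exp (L z) * f (z + r n *\<^sub>R e) = exp (- r n *\<^sub>R L e) * (exp (L (r n *\<^sub>R e + z)) * f (r n *\<^sub>R e + z))" for z
      by (simp add: L.add L.scaleR exp_add exp_minus add.commute)
    have i': "integrable lborel (\<lambda>z. exp (L z) * f (z + r n *\<^sub>R e))"
      unfolding eq using i by (intro integrable_mult_right) (subst integrable_lborel_translate)
    have "(\<integral>z. ?q n z \<partial>lborel) = (\<integral>z. (exp (L z) * f (z + r n *\<^sub>R e) - exp (L z) * f z) /\<^sub>R r n \<partial>lborel)"
      by (simp add: algebra_simps)
    also have "\<dots> = ((\<integral>z. exp (L z) * f (z + r n *\<^sub>R e) \<partial>lborel) - I) /\<^sub>R r n"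
      using i i' by (simp add: I_def)
    also have "(\<integral>z. exp (L z) * f (z + r n *\<^sub>R e) \<partial>lborel) = exp (- r n *\<^sub>R L e) * I"
      unfolding eq I_def
      by (subst integral_mult_right_zero, subst integral_lborel_translate[where f = "\<lambda>z. exp (L z) * f z"]) simp
    finally show ?thesis by (simp add: algebra_simps)
  qed
  have "(\<lambda>n. ((exp (- r n *\<^sub>R L e) - 1) /\<^sub>R r n) * I) \<longlonglongrightarrow> - L e * I"
  proof -
    have "((\<lambda>s::real. exp (- s *\<^sub>R L e)) has_vector_derivative (- L e)) (at 0)"
      using exp_scaleR_has_vector_derivative_left[of "- L e" 0] by simp
    then have "((\<lambda>s::real. (exp (- s *\<^sub>R L e) - 1) /\<^sub>R s) \<longlongrightarrow> - L e) (at 0)"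
      by (simp add: has_vector_derivative_at_iff_quotient)
    then have "(\<lambda>n. (exp (- r n *\<^sub>R L e) - 1) /\<^sub>R r n) \<longlonglongrightarrow> - L e"
      by (rule filterlim_compose) (use r r0 in \<open>auto simp: filterlim_at\<close>)
    then show ?thesis by (intro tendsto_intros)
  qed
  from LIMSEQ_unique[OF lim[unfolded q] this] show ?thesis
    by (simp add: I_def)
qed

lemma ft_conv_exp: "ft f \<xi> = (\<integral>z. exp (- \<i> * of_real (\<xi> \<bullet> z)) * f z \<partial>lborel)"
  by (simp add: ft_def cis_conv_exp)

lemma bounded_linear_inner_complex: "bounded_linear (\<lambda>z. - \<i> * complex_of_real (\<xi> \<bullet> z))"
  by (intro bounded_linear_const_mult bounded_linear_compose[OF bounded_linear_of_real] bounded_linear_inner_right)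

lemma ft_dderiv:
  assumes "test_fun_on A f" "b \<in> Basis"
  shows "norm (ft (dderiv b f) \<xi>) = \<bar>\<xi> \<bullet> b\<bar> * norm (ft f \<xi>)"
  unfolding ft_conv_exp
  by (subst integral_exp_linear_dderiv[OF assms bounded_linear_inner_complex]) (simp add: norm_mult)

text \<open>The functions \<open>p\<close> such that \<open>p \<cdot> ft f\<close> is bounded for every test function \<open>f\<close> are closed under
  sums and under multiplication by \<open>\<bar>\<xi> \<bullet> b\<bar>\<close>, which replaces \<open>f\<close> by a derivative; so all polynomial weights
  are obtained by induction.\<close>

definition ft_growth :: "('a::euclidean_space \<Rightarrow> real) \<Rightarrow> bool" where
  "ft_growth p \<longleftrightarrow> (\<forall>f. test_fun_on UNIV f \<longrightarrow> (\<exists>C. \<forall>\<xi>. p \<xi> * norm (ft f \<xi>) \<le> C))"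

lemma ft_growthD:
  assumes "ft_growth p" "test_fun_on A f"
  obtains C where "\<And>\<xi>. p \<xi> * norm (ft f \<xi>) \<le> C"
  using assms test_fun_on_mono[of A f UNIV] by (auto simp: ft_growth_def)

lemma ft_growth_1: "ft_growth (\<lambda>_. 1)"
  unfolding ft_growth_def using norm_ft_le by auto

lemma ft_growth_mono: "ft_growth q \<Longrightarrow> (\<And>\<xi>. p \<xi> \<le> q \<xi>) \<Longrightarrow> ft_growth p"
  unfolding ft_growth_def by (meson mult_right_mono norm_ge_zero order_trans)

lemma ft_growth_add: "ft_growth p \<Longrightarrow> ft_growth q \<Longrightarrow> ft_growth (\<lambda>\<xi>. p \<xi> + q \<xi>)"
  unfolding ft_growth_def by (simp add: distrib_right) (meson add_mono)

lemma ft_growth_sum: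
  assumes "\<And>b. b \<in> A \<Longrightarrow> ft_growth (p b)"
  shows "ft_growth (\<lambda>\<xi>. \<Sum>b\<in>A. p b \<xi>)"
  using assms
proof (induction A rule: infinite_finite_induct)
  case (insert x F)
  then show ?case by (simp add: ft_growth_add)
qed (auto intro: ft_growth_mono[OF ft_growth_1])

lemma ft_growth_mult_coord:
  assumes "ft_growth p" "b \<in> Basis"
  shows "ft_growth (\<lambda>\<xi>. p \<xi> * \<bar>\<xi> \<bullet> b\<bar>)"
  unfolding ft_growth_def
proof (intro allI impI)
  fix f :: "'a \<Rightarrow> complex" assume f: "test_fun_on UNIV f"
  obtain C where "\<And>\<xi>. p \<xi> * norm (ft (dderiv b f) \<xi>) \<le> C"
    using ft_growthD[OF assms(1) test_fun_dderiv[OF f assms(2)]] by blast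
  then show "\<exists>C. \<forall>\<xi>. p \<xi> * \<bar>\<xi> \<bullet> b\<bar> * norm (ft f \<xi>) \<le> C"
    by (auto simp: ft_dderiv[OF f assms(2)] mult.assoc)
qed

lemma ft_growth_mult_norm:
  assumes p: "ft_growth p" and nn: "\<And>\<xi>. p \<xi> \<ge> 0"
  shows "ft_growth (\<lambda>\<xi>. p \<xi> * (1 + norm \<xi>) ^ N)"
proof (induction N)
  case 0
  then show ?case using p by simp
next
  case (Suc N)
  have "ft_growth (\<lambda>\<xi>. p \<xi> * (1 + norm \<xi>) ^ N + (\<Sum>b\<in>Basis. p \<xi> * (1 + norm \<xi>) ^ N * \<bar>\<xi> \<bullet> b\<bar>))"
    by (intro ft_growth_add ft_growth_sum ft_growth_mult_coord Suc)
  then show ?case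
  proof (rule ft_growth_mono)
    fix \<xi> :: 'a
    have "p \<xi> * (1 + norm \<xi>) ^ N * (1 + norm \<xi>) \<le> p \<xi> * (1 + norm \<xi>) ^ N * (1 + (\<Sum>b\<in>Basis. \<bar>\<xi> \<bullet> b\<bar>))"
      using nn[of \<xi>] norm_le_l1[of \<xi>] by (intro mult_left_mono) auto
    then show "p \<xi> * (1 + norm \<xi>) ^ Suc N \<le> p \<xi> * (1 + norm \<xi>) ^ N + (\<Sum>b\<in>Basis. p \<xi> * (1 + norm \<xi>) ^ N * \<bar>\<xi> \<bullet> b\<bar>)"
      by (simp add: algebra_simps sum_distrib_left)
  qed
qed

text \<open>A product over the coordinates rather than a power of the norm, so that integrability of
  the reciprocal reduces to 1 / (1 + x * x) on the line.\<close>

definition coord_weight :: "'a::euclidean_space \<Rightarrow> real" where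
  "coord_weight \<xi> = (\<Prod>b\<in>Basis. 1 + (\<xi> \<bullet> b)\<^sup>2)"

lemma coord_weight_ge_1: "1 \<le> coord_weight \<xi>"
  unfolding coord_weight_def by (intro prod_ge_1) auto

lemma ft_growth_coord_weight: "ft_growth coord_weight"
proof -
  have "ft_growth (\<lambda>\<xi>. \<Prod>b\<in>A. 1 + (\<xi> \<bullet> b)\<^sup>2)" if "A \<subseteq> Basis" for A :: "'a set"
    using finite_subset[OF that finite_Basis] that
  proof (induction A rule: finite_induct)
    case empty
    then show ?case by (simp add: ft_growth_1)
  next
    case (insert a A)
    then have "ft_growth (\<lambda>\<xi>. (\<Prod>b\<in>A. 1 + (\<xi> \<bullet> b)\<^sup>2) + (\<Prod>b\<in>A. 1 + (\<xi> \<bullet> b)\<^sup>2) * \<bar>\<xi> \<bullet> a\<bar> * \<bar>\<xi> \<bullet> a\<bar>)"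
      (is "ft_growth ?p")
      by (intro ft_growth_add ft_growth_mult_coord) auto
    also have "?p = (\<lambda>\<xi>. \<Prod>b\<in>insert a A. 1 + (\<xi> \<bullet> b)\<^sup>2)"
      using insert.hyps by (simp add: mult.assoc power2_eq_square[symmetric]) (simp add: algebra_simps)
    finally show ?case .
  qed
  from this[of Basis] show ?thesis by (simp add: coord_weight_def[abs_def])
qed

lemma ft_decay:
  fixes f :: "'a::euclidean_space \<Rightarrow> complex"
  assumes "test_fun_on A f"
  obtains C where "\<And>\<xi>. (1 + norm \<xi>) ^ N * norm (ft f \<xi>) \<le> C / coord_weight \<xi>" "C \<ge> 0"
proof -
  have "ft_growth (\<lambda>\<xi>::'a. coord_weight \<xi> * (1 + norm \<xi>) ^ N)"
    using coord_weight_ge_1 by (intro ft_growth_mult_norm ft_growth_coord_weight) (blast intro: order_trans[OF zero_le_one])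
  then obtain C where C: "\<And>\<xi>. coord_weight \<xi> * (1 + norm \<xi>) ^ N * norm (ft f \<xi>) \<le> C"
    using assms by (rule ft_growthD) blast
  have pos: "0 < coord_weight \<xi>" for \<xi> :: 'a
    using coord_weight_ge_1[of \<xi>] by linarith
  show ?thesis
  proof (rule that[of "\<bar>C\<bar>"])
    fix \<xi>
    show "(1 + norm \<xi>) ^ N * norm (ft f \<xi>) \<le> \<bar>C\<bar> / coord_weight \<xi>"
      using C[of \<xi>] pos[of \<xi>] by (simp add: field_simps)
  qed auto
qed

lemma integrable_inverse_1_plus_sq: "integrable lborel (\<lambda>x::real. 1 / (1 + x\<^sup>2))"
  using integrable_inverse_1_plus_square
  by (simp add: set_integrable_def einterval_def divide_inverse)

lemma integrable_coord_weight: "integrable lborel (\<lambda>\<xi>::'a::euclidean_space. 1 / coord_weight \<xi>)"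
  using integrable_lborel_prod_Basis[of "\<lambda>_ x. 1 / (1 + x\<^sup>2)", OF integrable_inverse_1_plus_sq]
  by (simp add: coord_weight_def prod_dividef)

lemma integrable_ft:
  fixes f :: "'a::euclidean_space \<Rightarrow> complex"
  assumes f: "test_fun_on A f"
  shows "integrable lborel (\<lambda>\<xi>. (1 + norm \<xi>) ^ N * norm (ft f \<xi>))"
proof -
  have [measurable]: "f \<in> borel_measurable borel" using f by (rule test_fun_measurable)
  obtain C where C: "\<And>\<xi>. (1 + norm \<xi>) ^ N * norm (ft f \<xi>) \<le> C / coord_weight \<xi>" "C \<ge> 0"
    using ft_decay[OF f] by metis
  show ?thesis
  proof (rule integrable_pointwise_bound)
    show "integrable lborel (\<lambda>\<xi>::'a. C * (1 / coord_weight \<xi>))"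
      by (intro integrable_mult_right integrable_coord_weight)
    show "norm ((1 + norm \<xi>) ^ N * norm (ft f \<xi>)) \<le> norm (C * (1 / coord_weight \<xi>))" for \<xi>
      using C(1)[of \<xi>] C(2) coord_weight_ge_1[of \<xi>] by (simp add: abs_mult)
  qed measurable
qed

lemma integrable_ft_0:
  assumes f: "test_fun_on A f"
  shows "integrable lborel (ft f)"
proof -
  have [measurable]: "f \<in> borel_measurable borel" using f by (rule test_fun_measurable)
  from integrable_ft[OF f, of 0] show ?thesis
    by (simp add: integrable_norm_iff)
qed

section \<open>Inversion and Parseval for test functions\<close>

lemma test_fun_inversion:
  fixes f :: "'a::euclidean_space \<Rightarrow> complex"
  assumes f: "test_fun_on A f"
  shows "(\<integral>\<xi>. cis (\<xi> \<bullet> x) * ft f \<xi> \<partial>lborel) = of_real ((2 * pi) ^ DIM('a)) * f x"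
  using test_fun_bounded[OF f] ft_inversion[OF test_fun_continuous[OF f] integrable_test_fun[OF f] _ integrable_ft_0[OF f]]
  by metis

text \<open>The roles are asymmetric: inversion is applied to \<open>f\<close> alone, while
  \<open>g\<close> is only integrable, because integrability and Fourier decay are what the cutoffs
  provide.\<close>

lemma parseval_real:
  fixes f g :: "real \<Rightarrow> complex"
  assumes cont: "continuous_on UNIV f" and f: "integrable lborel f" and bdd: "\<And>x. norm (f x) \<le> B"
    and ftf: "integrable lborel (ft f)" and g: "integrable lborel g"
  shows "(\<integral>y. ft g y * ft f (- y) \<partial>lborel) = 2 * pi * (\<integral>x. g x * f x \<partial>lborel)"
proof -
  have [measurable]: "f \<in> borel_measurable borel" "g \<in> borel_measurable borel"
    using f g by auto
  have ftf': "integrable lborel (\<lambda>y. ft f (- y))"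
    using lborel_integrable_real_affine[OF ftf, of "-1" 0] by simp
  have "(\<integral>y. ft g y * ft f (- y) \<partial>lborel) = (\<integral>y. \<integral>x. cis (- (y * x)) * g x * ft f (- y) \<partial>lborel \<partial>lborel)"
    unfolding ft_def[of g] by simp
  also have "\<dots> = (\<integral>x. \<integral>y. cis (- (y * x)) * g x * ft f (- y) \<partial>lborel \<partial>lborel)"
  proof (rule lborel_pair.Fubini_integral)
    have "integrable (lborel \<Otimes>\<^sub>M lborel) (\<lambda>(x, y). g x * ft f (- y))"
      by (rule integrable_lborel_pair_mult[OF g ftf'])
    then show "integrable (lborel \<Otimes>\<^sub>M lborel) (\<lambda>(x, y). cis (- (y * x)) * g x * ft f (- y))"
    proof (rule integrable_pointwise_bound)
      fix p :: "real \<times> real"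
      show "norm (case p of (x, y) \<Rightarrow> cis (- (y * x)) * g x * ft f (- y)) \<le> norm (case p of (x, y) \<Rightarrow> g x * ft f (- y))"
        by (cases p) (simp add: norm_mult)
    qed measurable
  qed
  also have "\<dots> = (\<integral>x. g x * (\<integral>y. cis (y * x) * ft f y \<partial>lborel) \<partial>lborel)"
  proof (intro Bochner_Integration.integral_cong refl)
    fix x
    have "(\<integral>y. cis (y * x) * ft f y \<partial>lborel) = (\<integral>y. cis (- (y * x)) * ft f (- y) \<partial>lborel)"
      using lborel_integral_real_affine[of "-1" "\<lambda>y. cis (y * x) * ft f y" 0] by simp
    then show "(\<integral>y. cis (- (y * x)) * g x * ft f (- y) \<partial>lborel) = g x * (\<integral>y. cis (y * x) * ft f y \<partial>lborel)"
      by (simp add: mult_ac flip: integral_mult_right_zero)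
  qed
  also have "\<dots> = (\<integral>x. g x * (of_real (2 * pi) * f x) \<partial>lborel)"
    using ft_inversion[OF cont f bdd ftf] by simp
  also have "\<dots> = (\<integral>x. of_real (2 * pi) * (g x * f x) \<partial>lborel)"
    by (simp only: mult_ac)
  also have "\<dots> = 2 * pi * (\<integral>x. g x * f x \<partial>lborel)"
    by simp
  finally show ?thesis .
qed

definition partial_ft :: "('a::euclidean_space \<times> real \<Rightarrow> complex) \<Rightarrow> 'a \<Rightarrow> real \<Rightarrow> complex" where
  "partial_ft f \<xi> t = (\<integral>x. cis (- (\<xi> \<bullet> x)) * f (x, t) \<partial>lborel)"

lemma
  fixes f :: "'a::euclidean_space \<times> real \<Rightarrow> complex"
  assumes f: "test_fun_on A f"
  shows partial_ft_continuous: "continuous_on UNIV (partial_ft f \<xi>)"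
    and partial_ft_integrable: "integrable lborel (partial_ft f \<xi>)"
    and partial_ft_bounded: "\<exists>B. \<forall>t. norm (partial_ft f \<xi> t) \<le> B"
    and ft_partial_ft: "ft (partial_ft f \<xi>) = (\<lambda>\<tau>. ft f (\<xi>, \<tau>))"
    and ft_partial_ft_integrable: "integrable lborel (\<lambda>\<tau>. ft f (\<xi>, \<tau>))"
proof -
  have cf: "continuous_on UNIV f" by (rule test_fun_continuous[OF f])
  have [measurable]: "f \<in> borel_measurable borel" using f by (rule test_fun_measurable)
  have [measurable]: "f \<in> borel_measurable (borel \<Otimes>\<^sub>M borel)" by (simp add: borel_prod)
  obtain B where B: "\<And>z. norm (f z) \<le> B" "B \<ge> 0" using test_fun_bounded[OF f] by metis
  define K where "K = fst ` tsupport f"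
  have K: "compact K"
    unfolding K_def using f by (intro compact_continuous_image continuous_intros) (auto simp: test_fun_on_def)
  have fK: "norm (f (x, t)) \<le> B * indicator K x" for x t
  proof (cases "(x, t) \<in> tsupport f")
    case True
    then have "x \<in> K" by (force simp: K_def)
    then show ?thesis using B by simp
  qed (use B in \<open>simp add: not_in_tsupport\<close>)
  have iK: "integrable lborel (\<lambda>x. B * indicator K x :: real)"
    by (intro integrable_mult_right integrable_indicator_compact K)
  show "continuous_on UNIV (partial_ft f \<xi>)"
    unfolding continuous_on_sequentially
  proof (intro allI impI ballI)
    fix X :: "nat \<Rightarrow> real" and t :: real
    assume "t \<in> UNIV" and X: "(\<forall>n. X n \<in> UNIV) \<and> X \<longlonglongrightarrow> t"
    show "(partial_ft f \<xi> \<circ> X) \<longlonglongrightarrow> partial_ft f \<xi> t"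
      unfolding partial_ft_def o_def
    proof (rule integral_dominated_convergence[OF _ _ iK])
      show "AE x in lborel. (\<lambda>n. cis (- (\<xi> \<bullet> x)) * f (x, X n)) \<longlonglongrightarrow> cis (- (\<xi> \<bullet> x)) * f (x, t)"
        using X by (intro AE_I2 tendsto_intros continuous_on_tendsto_compose[OF cf] tendsto_Pair) auto
      show "AE x in lborel. norm (cis (- (\<xi> \<bullet> x)) * f (x, X n)) \<le> B * indicator K x" for n
        using fK by (intro AE_I2) (simp add: norm_mult)
    qed measurable
  qed
  have "norm (partial_ft f \<xi> t) \<le> (\<integral>x. B * indicator K x \<partial>lborel)" for t
    unfolding partial_ft_def
    by (rule Bochner_Integration.integral_norm_bound_integral[OF _ iK])
       (use fK in \<open>auto simp: norm_mult intro!: integrable_pointwise_bound[OF iK] order_trans[OF _ abs_ge_self]\<close>)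
  then show "\<exists>B. \<forall>t. norm (partial_ft f \<xi> t) \<le> B" by blast
  have i: "integrable (lborel \<Otimes>\<^sub>M lborel) (\<lambda>(x, t). cis (- (\<xi> \<bullet> x)) * (cis (- (\<tau> * t)) * f (x, t)))" for \<tau>
  proof (rule integrable_pointwise_bound)
    show "integrable (lborel \<Otimes>\<^sub>M lborel) f"
      using integrable_test_fun[OF f] by (simp add: lborel_prod)
    fix p :: "'a \<times> real"
    show "norm (case p of (x, t) \<Rightarrow> cis (- (\<xi> \<bullet> x)) * (cis (- (\<tau> * t)) * f (x, t))) \<le> norm (f p)"
      by (cases p) (simp add: norm_mult)
  qed measurable
  show "integrable lborel (partial_ft f \<xi>)"
    using lborel_pair.integrable_snd[OF i[of 0]] by (simp add: partial_ft_def[abs_def])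
  show *: "ft (partial_ft f \<xi>) = (\<lambda>\<tau>. ft f (\<xi>, \<tau>))"
  proof
    fix \<tau> :: real
    have "ft (partial_ft f \<xi>) \<tau> = (\<integral>t. \<integral>x. cis (- (\<xi> \<bullet> x)) * (cis (- (\<tau> * t)) * f (x, t)) \<partial>lborel \<partial>lborel)"
      unfolding ft_def partial_ft_def inner_real_def integral_mult_right_zero[symmetric]
      by (simp only: mult_ac)
    also have "\<dots> = (\<integral>p. cis (- (\<xi> \<bullet> fst p)) * (cis (- (\<tau> * snd p)) * f p) \<partial>(lborel \<Otimes>\<^sub>M lborel))"
      using lborel_pair.integral_snd[OF i[of \<tau>]] by (simp add: case_prod_unfold)
    also have "\<dots> = ft f (\<xi>, \<tau>)"
      unfolding ft_def lborel_prod inner_prod_def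
      by (intro Bochner_Integration.integral_cong refl) (simp add: mult.assoc[symmetric] cis_mult)
    finally show "ft (partial_ft f \<xi>) \<tau> = ft f (\<xi>, \<tau>)" .
  qed
  show "integrable lborel (\<lambda>\<tau>. ft f (\<xi>, \<tau>))"
  proof -
    \<comment> \<open>Fubini would give integrability in \<tau> only for almost every \<xi>; the
      pointwise decay gives it for each \<xi>, as the slice identities below require.\<close>
    obtain C where C: "\<And>\<zeta>. (1 + norm \<zeta>) ^ 2 * norm (ft f \<zeta>) \<le> C / coord_weight \<zeta>" "C \<ge> 0"
      using ft_decay[OF f] by metis
    show ?thesis
    proof (rule integrable_pointwise_bound)
      show "integrable lborel (\<lambda>\<tau>::real. C * (1 / (1 + \<tau>\<^sup>2)))"
        by (intro integrable_mult_right integrable_inverse_1_plus_sq)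
      fix \<tau> :: real
      have "(1 + \<tau>\<^sup>2) * norm (ft f (\<xi>, \<tau>)) \<le> (1 + norm (\<xi>, \<tau>)) ^ 2 * norm (ft f (\<xi>, \<tau>))"
        by (intro mult_right_mono) (auto simp: norm_prod_def power2_sum algebra_simps intro!: add_nonneg_nonneg)
      also have "\<dots> \<le> C / coord_weight (\<xi>, \<tau>)" by (rule C)
      also have "\<dots> \<le> C" using C(2) coord_weight_ge_1[of "(\<xi>, \<tau>)"] mult_left_mono[of 1 "coord_weight (\<xi>, \<tau>)" C]
        by (simp add: field_simps)
      finally have le: "(1 + \<tau>\<^sup>2) * norm (ft f (\<xi>, \<tau>)) \<le> C" .
      have pos: "0 < 1 + \<tau>\<^sup>2" by (simp add: add_pos_nonneg)
      show "norm (ft f (\<xi>, \<tau>)) \<le> norm (C * (1 / (1 + \<tau>\<^sup>2)))"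
        using le C(2) pos by (simp add: pos_le_divide_eq mult.commute)
    qed measurable
  qed
qed

text \<open>Parseval in the last variable at a fixed frequency of the others. It serves three times:
  in x_n for the decaying modes, in t for the free waves, and in t for \<open>h\<close> itself in
  \<open>ft_local_average\<close>.\<close>

lemma parseval_partial_ft:
  assumes f: "test_fun_on A f" and g: "integrable lborel g"
  shows "(\<integral>\<tau>. ft g \<tau> * ft f (\<xi>, - \<tau>) \<partial>lborel) = 2 * pi * (\<integral>t. g t * partial_ft f \<xi> t \<partial>lborel)"
proof -
  obtain B where "\<And>t. norm (partial_ft f \<xi> t) \<le> B"
    using partial_ft_bounded[OF f] by metis
  from parseval_real[OF partial_ft_continuous[OF f] partial_ft_integrable[OF f] this, of g]
  show ?thesis using g ft_partial_ft_integrable[OF f, of \<xi>] by (simp add: ft_partial_ft[OF f])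
qed

section \<open>Cutoffs with decaying Fourier transform\<close>

text \<open>Convolution with the indicator of [-1, 0]. Each application gains one power of Fourier
  decay, and since \<open>g\<close> is read only to the right of \<open>x\<close>, an identity on a
  right half-line survives.\<close>

definition avg :: "(real \<Rightarrow> complex) \<Rightarrow> real \<Rightarrow> complex" where
  "avg g x = (\<integral>u. indicator {0..1} u *\<^sub>R g (x + u) \<partial>lborel)"

lemma
  assumes g: "integrable lborel g"
  shows integrable_avg: "integrable lborel (avg g)"
    and ft_avg: "ft (avg g) y = (\<integral>u. indicator {0..1} u *\<^sub>R cis (y * u) \<partial>lborel) * ft g y"
proof -
  have [measurable]: "g \<in> borel_measurable borel" using g by auto
  have gt: "integrable lborel (\<lambda>x. g (x + u))" for u
    using g integrable_lborel_translate[of g u] by (simp add: add.commute)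
  have nt: "(\<integral>x. norm (g (x + u)) \<partial>lborel) = (\<integral>x. norm (g x) \<partial>lborel)" for u
    using integral_lborel_translate[of "\<lambda>x. norm (g x)" u] by (simp add: add.commute)
  have i: "integrable (lborel \<Otimes>\<^sub>M lborel) (\<lambda>(u, x). indicator {0..1::real} u *\<^sub>R g (x + u))"
  proof (rule lborel_pair.Fubini_integrable)
    have "integrable lborel (\<lambda>u. indicator {0..1::real} u * (\<integral>x. norm (g x) \<partial>lborel) :: real)"
      by (intro integrable_mult_left integrable_indicator_compact compact_Icc)
    then show "integrable lborel (\<lambda>u. \<integral>x. norm (case (u, x) of (u, x) \<Rightarrow> indicator {0..1::real} u *\<^sub>R g (x + u)) \<partial>lborel)"
      by (simp add: nt)
  qed (measurable, use gt in simp)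
  show "integrable lborel (avg g)"
    using lborel_pair.integrable_snd[OF i] by (simp add: avg_def[abs_def])
  have "ft (avg g) y = (\<integral>x. \<integral>u. cis (- (y * x)) * (indicator {0..1} u *\<^sub>R g (x + u)) \<partial>lborel \<partial>lborel)"
    unfolding ft_def avg_def integral_mult_right_zero[symmetric] by (simp only: inner_real_def)
  also have "\<dots> = (\<integral>u. \<integral>x. cis (- (y * x)) * (indicator {0..1} u *\<^sub>R g (x + u)) \<partial>lborel \<partial>lborel)"
  proof (rule lborel_pair.Fubini_integral)
    from i show "integrable (lborel \<Otimes>\<^sub>M lborel) (\<lambda>(u, x). cis (- (y * x)) * (indicator {0..1} u *\<^sub>R g (x + u)))"
      by (rule integrable_pointwise_bound) (auto simp: norm_mult)
  qed
  also have "\<dots> = (\<integral>u. indicator {0..1} u *\<^sub>R cis (y * u) * ft g y \<partial>lborel)"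
  proof (intro Bochner_Integration.integral_cong refl)
    fix u :: real
    have "(\<integral>x. cis (- (y * x)) * g (x + u) \<partial>lborel) = (\<integral>x. cis (y * u) * (cis (- (y * (u + x))) * g (u + x)) \<partial>lborel)"
      by (simp add: mult.assoc[symmetric] cis_mult add.commute algebra_simps)
    also have "\<dots> = cis (y * u) * ft g y"
      unfolding ft_def
      by (subst integral_mult_right_zero, subst integral_lborel_translate[where f = "\<lambda>x. cis (- (y * x)) * g x"]) simp
    finally have *: "(\<integral>x. cis (- (y * x)) * g (x + u) \<partial>lborel) = cis (y * u) * ft g y" .
    show "(\<integral>x. cis (- (y * x)) * (indicator {0..1} u *\<^sub>R g (x + u)) \<partial>lborel)
        = indicator {0..1} u *\<^sub>R cis (y * u) * ft g y"
      by (cases "u \<in> {0..1}") (auto simp: *)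
  qed
  finally show "ft (avg g) y = (\<integral>u. indicator {0..1} u *\<^sub>R cis (y * u) \<partial>lborel) * ft g y"
    by (simp only: integral_mult_left_zero)
qed

text \<open>The integral is (exp (i y) - 1) / (i y): at most 1 as an average, and at most 2 / |y| by
  the explicit formula, whence 3.\<close>

lemma norm_avg_multiplier: "norm (\<integral>u. indicator {0..1} u *\<^sub>R cis (y * u) \<partial>lborel) * (1 + \<bar>y\<bar>) \<le> 3"
proof -
  let ?m = "\<integral>u. indicator {0..1} u *\<^sub>R cis (y * u) \<partial>lborel"
  have "norm ?m \<le> (\<integral>u. norm (indicator {0..1} u *\<^sub>R cis (y * u)) \<partial>lborel)"
    by (rule integral_norm_bound)
  also have "\<dots> = (\<integral>u. indicator {0..1::real} u \<partial>lborel)"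
    by simp
  finally have 1: "norm ?m \<le> 1" by simp
  have 2: "norm ?m * \<bar>y\<bar> \<le> 2"
  proof (cases "y = 0")
    case False
    have "?m = cis (y * 1) / (\<i> * y) - cis (y * 0) / (\<i> * y)"
    proof (rule integral_FTC_Icc)
      fix x :: real
      show "((\<lambda>u. cis (y * u) / (\<i> * y)) has_vector_derivative cis (y * x)) (at x within {0..1})"
        using False unfolding cis_conv_exp
        by (auto intro!: derivative_eq_intros has_vector_derivative_real_field simp: field_simps)
    qed (auto intro!: continuous_intros)
    then have "norm ?m = norm (cis y - 1) / \<bar>y\<bar>"
      using False by (simp add: diff_divide_distrib[symmetric] norm_divide norm_mult)
    also have "norm (cis y - 1) \<le> 2"
      using norm_triangle_ineq4[of "cis y" 1] by simp
    finally show ?thesis using False by (simp add: field_simps)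
  qed simp
  from 1 2 show ?thesis by (simp add: distrib_left)
qed

text \<open>The factor \<open>w\<close> records the behaviour at 0, which averaging leaves intact:
  it is 1 for the time cutoff and \<open>min 1 \<bar>y\<bar>\<close> for the continued
  exponential.\<close>

lemma ft_avg_decay:
  assumes g: "integrable lborel g" and C: "\<And>y. norm (ft g y) * (1 + \<bar>y\<bar>) ^ N \<le> C * w y"
  shows "norm (ft (avg g) y) * (1 + \<bar>y\<bar>) ^ Suc N \<le> 3 * C * w y"
proof -
  let ?m = "\<integral>u. indicator {0..1} u *\<^sub>R cis (y * u) \<partial>lborel"
  have "norm (ft (avg g) y) * (1 + \<bar>y\<bar>) ^ Suc N = (norm ?m * (1 + \<bar>y\<bar>)) * (norm (ft g y) * (1 + \<bar>y\<bar>) ^ N)"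
    by (simp add: ft_avg[OF g] norm_mult)
  also have "\<dots> \<le> 3 * (C * w y)"
    by (intro mult_mono norm_avg_multiplier C) auto
  finally show ?thesis by simp
qed

lemma ft_mult_left: "ft (\<lambda>x. c * f x) y = c * ft f y"
  unfolding ft_def by (simp add: mult.left_commute)

text \<open>Start from an indicator and average N times. Each average looks one unit to the right,
  so the induction must provide the value 1 on an interval longer by 1; hence \<open>L\<close> is
  arbitrary in it.\<close>

lemma exists_time_cutoff:
  "\<exists>g. integrable lborel g \<and> (\<forall>x. 0 < x \<and> x < L \<longrightarrow> g x = 1)
      \<and> (\<exists>C. \<forall>y. norm (ft g y) * (1 + \<bar>y\<bar>) ^ N \<le> C)"
proof (induction N arbitrary: L)
  case 0
  have "integrable lborel (\<lambda>x. complex_of_real (indicator {0..L} x))"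
    by (intro integrable_of_real integrable_indicator_compact compact_Icc)
  moreover have "\<exists>C. \<forall>y. norm (ft g y) * (1 + \<bar>y\<bar>) ^ 0 \<le> C" for g :: "real \<Rightarrow> complex"
    using norm_ft_le[of g] by auto
  ultimately show ?case
    by (intro exI[of _ "\<lambda>x. complex_of_real (indicator {0..L} x)"]) auto
next
  case (Suc N)
  obtain g C where g: "integrable lborel g" "\<And>x. 0 < x \<Longrightarrow> x < L + 1 \<Longrightarrow> g x = 1"
    "\<And>y. norm (ft g y) * (1 + \<bar>y\<bar>) ^ N \<le> C"
    using Suc[of "L + 1"] by auto
  have "avg g x = 1" if "0 < x" "x < L" for x
  proof -
    have "avg g x = (\<integral>u. complex_of_real (indicator {0..1::real} u) \<partial>lborel)"
      unfolding avg_def using that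
      by (intro Bochner_Integration.integral_cong refl) (auto simp: indicator_def g(2))
    then show ?thesis by simp
  qed
  moreover have "norm (ft (avg g) y) * (1 + \<bar>y\<bar>) ^ Suc N \<le> 3 * C * 1" for y
    by (rule ft_avg_decay[OF g(1)]) (use g(3) in simp)
  ultimately show ?case
    by (intro exI[of _ "avg g"]) (use integrable_avg[OF g(1)] in auto)
qed

lemma integrable_exp_decay:
  assumes "u > 0"
  shows "integrable lborel (\<lambda>x::real. indicator {0<..} x * exp (- x * u))"
    and "(\<integral>x. indicator {0<..} x * exp (- x * u) \<partial>lborel) = 1 / u"
proof -
  have [simp]: "einterval 0 \<infinity> = {0<..}" by (auto simp: einterval_def)
  show "integrable lborel (\<lambda>x::real. indicator {0<..} x * exp (- x * u))"
    and "(\<integral>x. indicator {0<..} x * exp (- x * u) \<partial>lborel) = 1 / u"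
  using integrable_I0i_exp_mscale[OF assms] LBINT_I0i_exp_mscale[OF assms]
  by (auto simp: interval_lebesgue_integrable_def set_integrable_def interval_lebesgue_integral_def
      set_lebesgue_integral_def)
qed

text \<open>Subtracting the indicator of \<open>(-1, 0)\<close> makes the integral vanish, so that the Fourier
  transform is \<open>O(y)\<close> at \<open>0\<close>; the averages below preserve this and \<open>exp (- x)\<close> on the half-line.\<close>

lemma exists_exp_extension:
  "\<exists>g. integrable lborel g \<and> (\<forall>x>0. g x = of_real (exp (- x)))
      \<and> (\<exists>C. \<forall>y. norm (ft g y) * (1 + \<bar>y\<bar>) ^ N \<le> C * min 1 \<bar>y\<bar>)"
proof (induction N)
  case 0
  define f where "f x = indicator {0<..} x * exp (- x) - indicator {-1<..<0::real} x" for x :: real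
  have [measurable]: "f \<in> borel_measurable borel" unfolding f_def by measurable
  have i1: "integrable lborel (\<lambda>x. indicator {0<..} x * exp (- x) :: real)"
    using integrable_exp_decay(1)[of 1] by simp
  have i2: "integrable lborel (\<lambda>x. indicator {-1<..<0::real} x :: real)"
    by (rule integrable_real_indicator) auto
  have f: "integrable lborel f" unfolding f_def using i1 i2 by (rule Bochner_Integration.integrable_diff)
  have "(\<integral>x. f x \<partial>lborel) = 0"
    unfolding f_def using integrable_exp_decay(2)[of 1] i1 i2 by simp
  then have f0: "(\<integral>x. complex_of_real (f x) \<partial>lborel) = 0" by simp
  \<comment> \<open>A finite first moment together with the vanishing integral makes the transform
    O(y) at 0, because \<open>cis (- (y * x)) - 1\<close> is at most |y x| in modulus. Half of the
    exponential absorbs the factor x.\<close>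
  have xf: "integrable lborel (\<lambda>x. x * f x)"
  proof (rule integrable_pointwise_bound)
    show "integrable lborel (\<lambda>x::real. 2 * (indicator {0<..} x * exp (- x * (1/2))) + indicator {-1<..<0::real} x)"
      by (intro Bochner_Integration.integrable_add integrable_mult_right integrable_exp_decay i2) auto
    fix x :: real
    have "\<bar>x\<bar> * exp (- x) \<le> 2 * exp (- x / 2)" if "0 < x"
    proof -
      have "x / 2 \<le> exp (x / 2)" using exp_ge_add_one_self[of "x / 2"] by linarith
      then have "x / 2 * exp (- x) \<le> exp (x / 2) * exp (- x)" by (intro mult_right_mono) auto
      then show ?thesis using that by (simp add: exp_add[symmetric])
    qed
    then show "norm (x * f x) \<le> norm (2 * (indicator {0<..} x * exp (- x * (1/2))) + indicator {-1<..<0::real} x)"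
      by (auto simp: f_def indicator_def abs_mult)
  qed measurable
  define C where "C = (\<integral>x. norm (f x) \<partial>lborel) + (\<integral>x. norm (x * f x) \<partial>lborel)"
  have b1: "norm (ft (\<lambda>x. of_real (f x)) y) \<le> (\<integral>x. norm (f x) \<partial>lborel)" for y
    using norm_ft_le[of "\<lambda>x. of_real (f x)" y] by simp
  have b2: "norm (ft (\<lambda>x. of_real (f x)) y) \<le> (\<integral>x. norm (x * f x) \<partial>lborel) * \<bar>y\<bar>" for y
  proof -
    have ic: "integrable lborel (\<lambda>x. cis (- (y * x)) * complex_of_real (f x))"
      using f by (intro integrable_cis_mult) auto
    have "ft (\<lambda>x. of_real (f x)) y = (\<integral>x. cis (- (y * x)) * of_real (f x) \<partial>lborel) - (\<integral>x. of_real (f x) \<partial>lborel)"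
      unfolding f0 ft_def by simp
    also have "\<dots> = (\<integral>x. cis (- (y * x)) * of_real (f x) - of_real (f x) \<partial>lborel)"
      using ic f by (subst Bochner_Integration.integral_diff) auto
    also have "norm \<dots> \<le> (\<integral>x. norm (x * f x) * \<bar>y\<bar> \<partial>lborel)"
    proof (rule Bochner_Integration.integral_norm_bound_integral)
      fix x :: real
      have "norm (cis (- (y * x)) - 1) \<le> \<bar>y * x\<bar>"
        using iexp_approx1[of "- (y * x)" 0] by (simp add: cis_conv_exp)
      moreover have eq: "cis (- (y * x)) * of_real (f x) - of_real (f x) = (cis (- (y * x)) - 1) * of_real (f x)"
        by (simp add: left_diff_distrib)
      ultimately show "norm (cis (- (y * x)) * of_real (f x) - of_real (f x)) \<le> norm (x * f x) * \<bar>y\<bar>"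
        using mult_right_mono[of "norm (cis (- (y * x)) - 1)" "\<bar>y * x\<bar>" "\<bar>f x\<bar>"]
        by (simp add: norm_mult abs_mult mult_ac)
    qed (use ic f xf in auto)
    finally show ?thesis by simp
  qed
  have "norm (ft (\<lambda>x. of_real (f x)) y) * (1 + \<bar>y\<bar>) ^ 0 \<le> C * min 1 \<bar>y\<bar>" for y
  proof -
    have "(\<integral>x. norm (x * f x) \<partial>lborel) * \<bar>y\<bar> \<le> C * \<bar>y\<bar>" unfolding C_def by (intro mult_right_mono) auto
    moreover have "(\<integral>x. norm (f x) \<partial>lborel) \<le> C" unfolding C_def by simp
    ultimately show ?thesis using b1[of y] b2[of y] by (auto simp: min_def)
  qed
  moreover have "\<forall>x>0. complex_of_real (f x) = of_real (exp (- x))"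
    by (simp add: f_def)
  ultimately show ?case
    using f by (intro exI[of _ "\<lambda>x. of_real (f x)"]) auto
next
  case (Suc N)
  obtain g C where g: "integrable lborel g" "\<And>x. 0 < x \<Longrightarrow> g x = of_real (exp (- x))"
    "\<And>y. norm (ft g y) * (1 + \<bar>y\<bar>) ^ N \<le> C * min 1 \<bar>y\<bar>"
    using Suc by auto
  \<comment> \<open>Averaging multiplies exp (- x) by the integral of exp (- u) over [0, 1], which
    is 1 - exp (- 1); dividing by it restores the exponential.\<close>
  define c where "c = complex_of_real (1 - exp (- 1))"
  have "exp (- 1) < (1::real)" by simp
  then have c: "c \<noteq> 0" unfolding c_def by (metis diff_gt_0_iff_gt less_irrefl of_real_eq_0_iff)
  have "avg g x = c * of_real (exp (- x))" if "0 < x" for x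
  proof -
    have g: "g (x + u) = of_real (exp (- x)) * of_real (exp (- u))" if "0 \<le> u" for u
      using g(2)[of "x + u"] that \<open>0 < x\<close> by (simp add: exp_add[symmetric] flip: of_real_mult)
    have "avg g x = (\<integral>u. of_real (exp (- x)) * complex_of_real (indicator {0..1::real} u *\<^sub>R exp (- u)) \<partial>lborel)"
      unfolding avg_def using that
      by (intro Bochner_Integration.integral_cong refl) (auto simp: indicator_def g)
    also have "\<dots> = of_real (exp (- x)) * of_real (\<integral>u. indicator {0..1::real} u *\<^sub>R exp (- u) \<partial>lborel)"
      by (simp only: integral_mult_right_zero integral_complex_of_real)
    also have "(\<integral>u. indicator {0..1::real} u *\<^sub>R exp (- u) \<partial>lborel) = - exp (- 1) - (- exp (- 0))"
      by (rule integral_FTC_Icc)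
         (auto intro!: derivative_eq_intros continuous_intros simp: has_real_derivative_iff_has_vector_derivative[symmetric])
    finally show ?thesis by (simp add: c_def mult.commute)
  qed
  moreover have "norm (ft (\<lambda>x. (1 / c) * avg g x) y) * (1 + \<bar>y\<bar>) ^ Suc N \<le> (norm (1 / c) * 3 * C) * min 1 \<bar>y\<bar>" for y
    using mult_left_mono[OF ft_avg_decay[OF g(1,3), of y], of "norm (1 / c)"]
    by (simp only: ft_mult_left norm_mult mult.assoc norm_ge_zero)
  ultimately show ?case
    using c by (intro exI[of _ "\<lambda>x. (1 / c) * avg g x"]) (use integrable_avg[OF g(1)] in auto)
qed

text \<open>An identity of measures, so that the substitution is available for nonnegative and for
  complex integrands alike, with no continuity assumed of them. The substitution rule on compact
  intervals [0, n] is passed to the half-line by monotone convergence.\<close>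

lemma distr_square: "distr (density lborel (\<lambda>r. ennreal (2 * r) * indicator {0..} r)) borel (\<lambda>r::real. r\<^sup>2)
    = density lborel (indicator {0..})" (is "?M = ?N")
proof (rule measure_eqI)
  show "sets ?M = sets ?N" by simp
  fix A assume "A \<in> sets ?M"
  then have [measurable]: "A \<in> sets borel" by simp
  have "emeasure ?M A = (\<integral>\<^sup>+r. ennreal (2 * r) * indicator {0..} r * indicator A (r\<^sup>2) \<partial>lborel)"
    by (subst nn_integral_indicator[symmetric], simp) (simp add: nn_integral_distr nn_integral_density del: nn_integral_indicator)
  also have "\<dots> = (\<integral>\<^sup>+r. (SUP n. ennreal (indicator A (r\<^sup>2) * (2 * r)) * indicator {0..real n} r) \<partial>lborel)"
  proof (intro nn_integral_cong)
    fix r :: real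
    obtain m where m: "r \<le> real m" using real_arch_simple by blast
    have "(SUP n. indicator {0..real n} r) = (indicator {0..} r :: ennreal)"
      by (intro antisym SUP_least SUP_upper2[of m]) (auto simp: indicator_def m)
    then show "ennreal (2 * r) * indicator {0..} r * indicator A (r\<^sup>2)
        = (SUP n. ennreal (indicator A (r\<^sup>2) * (2 * r)) * indicator {0..real n} r)"
      by (simp add: SUP_mult_left_ennreal[symmetric]) (auto simp: indicator_def)
  qed
  also have "\<dots> = (SUP n. \<integral>\<^sup>+r. ennreal (indicator A (r\<^sup>2) * (2 * r)) * indicator {0..real n} r \<partial>lborel)"
    by (intro nn_integral_monotone_convergence_SUP)
       (auto simp: incseq_def le_fun_def indicator_def)
  also have "\<dots> = (SUP n. \<integral>\<^sup>+x. ennreal (indicator A x) * indicator {0\<^sup>2..(real n)\<^sup>2} x \<partial>lborel)"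
  proof (intro SUP_cong refl)
    fix n
    show "(\<integral>\<^sup>+r. ennreal (indicator A (r\<^sup>2) * (2 * r)) * indicator {0..real n} r \<partial>lborel)
      = (\<integral>\<^sup>+x. ennreal (indicator A x) * indicator {0\<^sup>2..(real n)\<^sup>2} x \<partial>lborel)"
      unfolding nn_integral_set_ennreal
      by (rule nn_integral_substitution[where f = "indicator A" and g = "\<lambda>r. r\<^sup>2" and g' = "\<lambda>r. 2 * r"
            and a = 0 and b = "real n", symmetric])
         (auto intro!: derivative_eq_intros continuous_intros simp: set_borel_measurable_def)
  qed
  also have "\<dots> = (\<integral>\<^sup>+x. (SUP n. ennreal (indicator A x) * indicator {0\<^sup>2..(real n)\<^sup>2} x) \<partial>lborel)"
  proof (intro nn_integral_monotone_convergence_SUP[symmetric])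
    have sq: "(real m)\<^sup>2 \<le> (real n)\<^sup>2" if "m \<le> n" for m n using that by (intro power_mono) auto
    have "indicator {0\<^sup>2..(real m)\<^sup>2} x \<le> (indicator {0\<^sup>2..(real n)\<^sup>2} x :: ennreal)" if "m \<le> n" for m n and x :: real
      by (auto simp: indicator_def intro: order_trans[OF _ sq[OF that]])
    then show "incseq (\<lambda>n x. ennreal (indicator A x) * indicator {0\<^sup>2..(real n)\<^sup>2} x)"
      unfolding incseq_def le_fun_def by (intro allI impI mult_left_mono) auto
  qed simp
  also have "\<dots> = (\<integral>\<^sup>+x. indicator {0..} x * indicator A x \<partial>lborel)"
  proof (intro nn_integral_cong)
    fix x :: real
    obtain m where m: "x \<le> real m" using real_arch_simple by blast
    have "x \<le> (real m)\<^sup>2"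
    proof (cases "m = 0")
      case False
      then have "real m * 1 \<le> real m * real m" by (intro mult_left_mono) auto
      then show ?thesis using m by (simp add: power2_eq_square)
    qed (use m in auto)
    then have "(SUP n. indicator {0\<^sup>2..(real n)\<^sup>2} x) = (indicator {0..} x :: ennreal)"
      by (intro antisym SUP_least SUP_upper2[of m]) (auto simp: indicator_def)
    then show "(SUP n. ennreal (indicator A x) * indicator {0\<^sup>2..(real n)\<^sup>2} x) = indicator {0..} x * indicator A x"
      by (simp add: SUP_mult_left_ennreal[symmetric]) (auto simp: indicator_def)
  qed
  also have "\<dots> = emeasure ?N A"
    by (simp add: emeasure_density)
  finally show "emeasure ?M A = emeasure ?N A" .
qed

lemma nn_integral_square:
  assumes [measurable]: "f \<in> borel_measurable borel"
  shows "(\<integral>\<^sup>+r. ennreal (2 * r) * indicator {0..} r * f (r\<^sup>2) \<partial>lborel) = (\<integral>\<^sup>+x. indicator {0..} x * f x \<partial>lborel)"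
proof -
  have "(\<integral>\<^sup>+x. f x \<partial>distr (density lborel (\<lambda>r. ennreal (2 * r) * indicator {0..} r)) borel (\<lambda>r::real. r\<^sup>2))
      = (\<integral>\<^sup>+r. ennreal (2 * r) * indicator {0..} r * f (r\<^sup>2) \<partial>lborel)"
    by (simp add: nn_integral_distr nn_integral_density)
  then show ?thesis
    unfolding distr_square by (simp add: nn_integral_density)
qed

lemma integral_square:
  fixes f :: "real \<Rightarrow> complex"
  assumes [measurable]: "f \<in> borel_measurable borel"
  shows "(\<integral>r. (2 * r * indicator {0..} r) *\<^sub>R f (r\<^sup>2) \<partial>lborel) = (\<integral>x. indicator {0..} x *\<^sub>R f x \<partial>lborel)"
proof -
  have e: "ennreal (2 * r) * indicator {0..} r = ennreal (2 * r * indicator {0..} r)" for r :: real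
    by (auto simp: indicator_def)
  have e': "(indicator {0..} :: real \<Rightarrow> ennreal) = (\<lambda>r. ennreal (indicator {0..} r))"
    by (auto simp: indicator_def)
  have n: "0 \<le> 2 * r * (indicator {0..} r::real)" for r :: real by (auto simp: indicator_def)
  have "(\<integral>x. f x \<partial>distr (density lborel (\<lambda>r. ennreal (2 * r) * indicator {0..} r)) borel (\<lambda>r::real. r\<^sup>2))
      = (\<integral>r. (2 * r * indicator {0..} r) *\<^sub>R f (r\<^sup>2) \<partial>lborel)"
    unfolding e by (simp add: integral_distr integral_density n)
  then show ?thesis
    unfolding distr_square by (simp add: e' integral_density)
qed

section \<open>The initial-boundary value problem\<close>

text \<open>The derivative of exp is bounded by 1 on the left half-plane, which is convex. This is
  the majorant of the difference quotients of the modes.\<close>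

lemma norm_exp_diff_le:
  assumes "Re a \<le> 0" "Re b \<le> 0"
  shows "norm (exp a - exp b) \<le> norm (a - b)"
proof -
  have "norm (exp a - exp b) \<le> 1 * norm (a - b)"
  proof (rule field_differentiable_bound[where S = "{z. Re z \<le> 0}" and f' = exp])
    show "convex {z. Re z \<le> 0}" by (rule convex_halfspace_Re_le)
  qed (use assms in \<open>auto intro!: derivative_eq_intros\<close>)
  then show ?thesis by simp
qed

text \<open>The phase of a mode is affine in t, in x_n and along each tangential direction, so one
  lemma covers all derivatives. The set \<open>S\<close> is the open half-line for x_n, where the
  modes stay bounded, and the whole line otherwise.\<close>

lemma has_vector_derivative_integral_exp:
  fixes a l c :: "'b \<Rightarrow> complex"
  assumes [measurable]: "a \<in> borel_measurable M" "l \<in> borel_measurable M"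
    and c: "integrable M c" and cl: "integrable M (\<lambda>w. c w * l w)"
    and S: "open S" "r \<in> S" and Re: "\<And>w s. s \<in> S \<Longrightarrow> Re (a w + of_real s * l w) \<le> 0"
  shows "((\<lambda>r. \<integral>w. c w * exp (a w + of_real r * l w) \<partial>M) has_vector_derivative
      (\<integral>w. c w * l w * exp (a w + of_real r * l w) \<partial>M)) (at r)"
  unfolding has_vector_derivative_at_iff_quotient tendsto_at_iff_sequentially o_def
proof (intro allI impI)
  fix X :: "nat \<Rightarrow> real" assume X0: "\<forall>i. X i \<in> UNIV - {0}" and X: "X \<longlonglongrightarrow> 0"
  have [measurable]: "c \<in> borel_measurable M" using c by auto
  let ?e = "\<lambda>s w. exp (a w + of_real s * l w)"
  have ne: "norm (?e s w) \<le> 1" if "s \<in> S" for s w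
    using Re[OF that] by simp
  have int: "integrable M (\<lambda>w. c w * ?e s w)" if "s \<in> S" for s
    by (rule integrable_pointwise_bound[OF c]) (use ne[OF that] in \<open>auto simp: norm_mult mult_left_le\<close>)
  have "(\<lambda>i. r + X i) \<longlonglongrightarrow> r + 0" by (intro tendsto_intros X)
  then have "\<forall>\<^sub>F i in sequentially. r + X i \<in> S"
    using S by (auto dest: topological_tendstoD)
  \<comment> \<open>Dropping the first \<open>N\<close> terms keeps all evaluation points in
    \<open>S\<close>, where the exponent has nonpositive real part.\<close>
  then obtain N where N: "\<And>i. i \<ge> N \<Longrightarrow> r + X i \<in> S"
    by (auto simp: eventually_sequentially)
  have lim: "(\<lambda>i. \<integral>w. c w * ((?e (r + X (i + N)) w - ?e r w) /\<^sub>R X (i + N)) \<partial>M) \<longlonglongrightarrow> (\<integral>w. c w * l w * ?e r w \<partial>M)"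
  proof (rule integral_dominated_convergence[where w = "\<lambda>w. norm (c w * l w)"])
    show "AE w in M. (\<lambda>i. c w * ((?e (r + X (i + N)) w - ?e r w) /\<^sub>R X (i + N))) \<longlonglongrightarrow> c w * l w * ?e r w"
    proof (rule AE_I2)
      fix w
      have "((\<lambda>s. ?e s w) has_vector_derivative l w * ?e r w) (at r)"
        by (rule has_vector_derivative_real_field) (auto intro!: derivative_eq_intros)
      then have "((\<lambda>s. (?e (r + s) w - ?e r w) /\<^sub>R s) \<longlongrightarrow> l w * ?e r w) (at 0)"
        by (simp only: has_vector_derivative_at_iff_quotient)
      then have "(\<lambda>i. (?e (r + X i) w - ?e r w) /\<^sub>R X i) \<longlonglongrightarrow> l w * ?e r w"
        using X0 X by (auto simp: tendsto_at_iff_sequentially o_def)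
      then have "(\<lambda>i. (?e (r + X (i + N)) w - ?e r w) /\<^sub>R X (i + N)) \<longlonglongrightarrow> l w * ?e r w"
        by (rule LIMSEQ_ignore_initial_segment)
      then have "(\<lambda>i. c w * ((?e (r + X (i + N)) w - ?e r w) /\<^sub>R X (i + N))) \<longlonglongrightarrow> c w * (l w * ?e r w)"
        by (intro tendsto_intros)
      then show "(\<lambda>i. c w * ((?e (r + X (i + N)) w - ?e r w) /\<^sub>R X (i + N))) \<longlonglongrightarrow> c w * l w * ?e r w"
        by (simp only: mult.assoc)
    qed
    show "AE w in M. norm (c w * ((?e (r + X (i + N)) w - ?e r w) /\<^sub>R X (i + N))) \<le> norm (c w * l w)" for i
    proof (rule AE_I2)
      fix w
      have "norm (?e (r + X (i + N)) w - ?e r w) \<le> norm ((a w + of_real (r + X (i + N)) * l w) - (a w + of_real r * l w))"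
        by (intro norm_exp_diff_le Re S N) auto
      also have "\<dots> = norm (of_real (X (i + N)) * l w)"
        by (simp add: algebra_simps)
      finally have "norm ((?e (r + X (i + N)) w - ?e r w) /\<^sub>R X (i + N)) \<le> norm (l w)"
        using X0 unfolding norm_scaleR by (simp add: norm_mult field_simps)
      then show "norm (c w * ((?e (r + X (i + N)) w - ?e r w) /\<^sub>R X (i + N))) \<le> norm (c w * l w)"
        unfolding norm_mult by (rule mult_left_mono) auto
    qed
  qed (use cl in \<open>auto\<close>)
  have q: "(\<integral>w. c w * ((?e (r + X (i + N)) w - ?e r w) /\<^sub>R X (i + N)) \<partial>M)
      = ((\<integral>w. c w * ?e (r + X (i + N)) w \<partial>M) - (\<integral>w. c w * ?e r w \<partial>M)) /\<^sub>R X (i + N)" for i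
  proof -
    have "(\<integral>w. c w * ((?e (r + X (i + N)) w - ?e r w) /\<^sub>R X (i + N)) \<partial>M)
      = (\<integral>w. (c w * ?e (r + X (i + N)) w - c w * ?e r w) /\<^sub>R X (i + N) \<partial>M)"
      by (simp only: mult_scaleR_right right_diff_distrib)
    also have "\<dots> = ((\<integral>w. c w * ?e (r + X (i + N)) w \<partial>M) - (\<integral>w. c w * ?e r w \<partial>M)) /\<^sub>R X (i + N)"
      using int[OF N, of "i + N"] int[OF S(2)]
      by (simp only: integral_scaleR_right Bochner_Integration.integral_diff le_add2)
    finally show ?thesis .
  qed
  from lim[unfolded q] show "(\<lambda>i. ((\<integral>w. c w * ?e (r + X i) w \<partial>M) - (\<integral>w. c w * ?e r w \<partial>M)) /\<^sub>R X i) \<longlonglongrightarrow> (\<integral>w. c w * l w * ?e r w \<partial>M)"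
    by (rule LIMSEQ_offset)
qed

lemma twice_diffI:
  assumes S: "open S" "r \<in> S" and g: "\<And>s. s \<in> S \<Longrightarrow> (g has_vector_derivative g1 s) (at s)"
    and g1: "(g1 has_vector_derivative D) (at r)"
  shows "twice_diff g r" "d2 g r = D"
proof -
  have "\<forall>\<^sub>F s in nhds r. g differentiable (at s)"
    using S g by (auto simp: eventually_nhds intro: differentiableI_vector)
  moreover have *: "((\<lambda>s. vector_derivative g (at s)) has_vector_derivative D) (at r)"
    using g1 S by (rule has_vector_derivative_transform_within_open) (rule vector_derivative_at[OF g, symmetric])
  ultimately show "twice_diff g r" by (auto simp: twice_diff_def intro: differentiableI_vector)
  show "d2 g r = D" using * by (simp add: d2_def vector_derivative_at)
qed

lemma twice_diff_integral_exp:
  fixes a l c :: "'b \<Rightarrow> complex"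
  assumes meas: "a \<in> borel_measurable M" "l \<in> borel_measurable M"
    and c: "integrable M c" "integrable M (\<lambda>w. c w * l w)" "integrable M (\<lambda>w. c w * l w * l w)"
    and S: "open S" "r \<in> S" and Re: "\<And>w s. s \<in> S \<Longrightarrow> Re (a w + of_real s * l w) \<le> 0"
    and g: "\<And>s. s \<in> S \<Longrightarrow> g s = (\<integral>w. c w * exp (a w + of_real s * l w) \<partial>M)"
  shows "twice_diff g r" "d2 g r = (\<integral>w. c w * l w * l w * exp (a w + of_real r * l w) \<partial>M)"
proof -
  have d: "(g has_vector_derivative (\<integral>w. c w * l w * exp (a w + of_real s * l w) \<partial>M)) (at s)" if "s \<in> S" for s
    by (rule has_vector_derivative_transform_within_open[OF
          has_vector_derivative_integral_exp[OF meas c(1,2) S(1) that Re] S(1) that]) (simp_all add: g)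
  note d2 = has_vector_derivative_integral_exp[OF meas c(2,3) S Re]
  show "twice_diff g r" by (rule twice_diffI(1)[OF S d d2])
  show "d2 g r = (\<integral>w. c w * l w * l w * exp (a w + of_real r * l w) \<partial>M)" by (rule twice_diffI(2)[OF S d d2])
qed

section \<open>The solution as a superposition of modes\<close>

lemma hhat_eq_ft: "hhat h \<xi> (of_real \<tau>) = ft h (\<xi>, \<tau>)"
  unfolding hhat_def ft_conv_exp
  by (intro Bochner_Integration.integral_cong refl) (simp add: inner_prod_def algebra_simps)

text \<open>The square root of \<open>\<mu>\<close> with nonnegative real part whose values at negative \<open>\<mu>\<close> are limits from the lower
  half-plane. The substitution \<open>\<mu> = - \<zeta>\<^sup>2\<close> maps the quadrant \<open>D\<^sup>+\<close> to the lower half-plane and \<open>- \<i> \<zeta>\<close> to \<open>kap \<mu>\<close>.\<close>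

definition kap :: "real \<Rightarrow> complex" where
  "kap \<mu> = (if 0 \<le> \<mu> then of_real (sqrt \<mu>) else - \<i> * of_real (sqrt (- \<mu>)))"

lemma kap_square: "(kap \<mu>)\<^sup>2 = of_real \<mu>"
  by (auto simp: kap_def power_mult_distrib simp flip: of_real_power)

lemma Re_kap: "0 \<le> Re (kap \<mu>)"
  by (auto simp: kap_def)

lemma norm_kap: "norm (kap \<mu>) = sqrt \<bar>\<mu>\<bar>"
  by (auto simp: kap_def norm_mult)

lemma measurable_kap[measurable]: "kap \<in> borel_measurable borel"
  unfolding kap_def[abs_def] by measurable

text \<open>This is \<mu>: the modes oscillate in x_n where it is negative and decay where it is
  positive.\<close>

abbreviation symb :: "(real^'m) \<times> real \<Rightarrow> real" where
  "symb w \<equiv> snd w + (norm (fst w))\<^sup>2"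

definition phase :: "(real^'m) \<times> real \<Rightarrow> real^'m \<Rightarrow> real \<Rightarrow> real \<Rightarrow> complex" where
  "phase w x xn t = \<i> * of_real (fst w \<bullet> x) - kap (symb w) * of_real xn + \<i> * of_real (snd w) * of_real t"

lemma Re_phase: "0 \<le> xn \<Longrightarrow> Re (phase w x xn t) \<le> 0"
  by (auto simp: phase_def Re_kap)

lemma measurable_phase[measurable]: "(\<lambda>w. phase w x xn t) \<in> borel_measurable borel"
  unfolding phase_def by measurable

lemma norm_exp_phase: "0 \<le> xn \<Longrightarrow> norm (exp (phase w x xn t)) \<le> 1"
  using Re_phase by simp

lemma contour_dplus_eq:
  fixes h :: "(real^'m) \<times> real \<Rightarrow> complex"
  assumes h: "test_fun_on A h" and xn: "0 \<le> xn"
  shows "contour_dplus (\<lambda>\<zeta>. exp (\<i> * of_real (\<xi> \<bullet> x) + \<i> * \<zeta> * of_real xn - \<i> * (of_real ((norm \<xi>)\<^sup>2) + \<zeta>\<^sup>2) * of_real t)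
         * \<zeta> * hhat h \<xi> (- of_real ((norm \<xi>)\<^sup>2) - \<zeta>\<^sup>2))
    = (\<integral>\<tau>. exp (phase (\<xi>, \<tau>) x xn t) * ft h (\<xi>, \<tau>) \<partial>lborel) / 2" (is "contour_dplus ?f = _")
proof -
  have [measurable]: "h \<in> borel_measurable borel" using h by (rule test_fun_measurable)
  define c where "c = (norm \<xi>)\<^sup>2"
  define e where "e \<tau> = exp (phase (\<xi>, \<tau>) x xn t) * ft h (\<xi>, \<tau>)" for \<tau>
  have "(\<lambda>w. exp (phase w x xn t) * ft h w) \<in> borel_measurable borel"
    by measurable
  moreover have "(\<lambda>\<tau>. (\<xi>, \<tau>)) \<in> borel \<rightarrow>\<^sub>M borel"
    by (intro borel_measurable_continuous_onI continuous_intros)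
  ultimately have [measurable]: "e \<in> borel_measurable borel"
    unfolding e_def by (rule measurable_compose[rotated])
  have e: "integrable lborel e"
    by (rule integrable_pointwise_bound[OF ft_partial_ft_integrable[OF h, of \<xi>]])
       (use norm_exp_phase[OF xn] in \<open>auto simp: e_def norm_mult intro!: mult_left_le_one_le simp del: norm_exp_eq_Re\<close>)
  have e': "integrable lborel (\<lambda>\<mu>. e (\<mu> - c))" "integrable lborel (\<lambda>\<mu>. e (- \<mu> - c))"
    using lborel_integrable_real_affine[OF e, of 1 "- c"] lborel_integrable_real_affine[OF e, of "-1" "- c"]
    by (simp_all add: algebra_simps)
  \<comment> \<open>On the real ray \<mu> = - r * r and \<open>kap \<mu> = - \<i> * r\<close>; the
    factor \<zeta> d\<zeta> = r dr is half the density of the squaring substitution, the origin of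
    the final division by 2.\<close>
  have 1: "(\<integral>r\<in>{0..}. ?f (of_real r) \<partial>lborel) = (\<integral>\<mu>. indicator {0..} \<mu> *\<^sub>R e (- \<mu> - c) \<partial>lborel) / 2"
  proof -
    have f: "?f (of_real r) = of_real r * e (- r\<^sup>2 - c)" if "0 \<le> r" for r
    proof -
      have "(- of_real ((norm \<xi>)\<^sup>2) - (of_real r)\<^sup>2) = complex_of_real (- r\<^sup>2 - c)"
        by (simp add: c_def)
      moreover have "kap (- r\<^sup>2) = - \<i> * of_real r"
        using that by (cases "r = 0") (auto simp: kap_def)
      ultimately show ?thesis
        by (simp only: hhat_eq_ft) (simp add: e_def phase_def c_def algebra_simps)
    qed
    have "(\<integral>r\<in>{0..}. ?f (of_real r) \<partial>lborel) = (\<integral>r. (2 * r * indicator {0..} r) *\<^sub>R (\<lambda>\<mu>. e (- \<mu> - c)) (r\<^sup>2) / 2 \<partial>lborel)"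
      unfolding set_lebesgue_integral_def
    proof (intro Bochner_Integration.integral_cong refl)
      fix r :: real
      show "indicator {0..} r *\<^sub>R ?f (of_real r) = (2 * r * indicator {0..} r) *\<^sub>R (\<lambda>\<mu>. e (- \<mu> - c)) (r\<^sup>2) / 2"
      proof (cases "0 \<le> r")
        case True
        then show ?thesis unfolding f[OF True] by (simp add: scaleR_conv_of_real mult.assoc[symmetric])
      qed simp
    qed
    also have "\<dots> = (\<integral>\<mu>. indicator {0..} \<mu> *\<^sub>R e (- \<mu> - c) \<partial>lborel) / 2"
      by (subst integral_divide_zero, subst integral_square) auto
    finally show ?thesis .
  qed
  \<comment> \<open>On the imaginary ray the factor \<zeta> = i r meets the - i of the orientation,
    which again leaves the positive density r dr, now with \<mu> = r * r.\<close>
  have 2: "- \<i> * (\<integral>r\<in>{0..}. ?f (\<i> * of_real r) \<partial>lborel) = (\<integral>\<mu>. indicator {0..} \<mu> *\<^sub>R e (\<mu> - c) \<partial>lborel) / 2"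
  proof -
    have f: "?f (\<i> * of_real r) = \<i> * of_real r * e (r\<^sup>2 - c)" if "0 \<le> r" for r
    proof -
      have "(- of_real ((norm \<xi>)\<^sup>2) - (\<i> * of_real r)\<^sup>2) = complex_of_real (r\<^sup>2 - c)"
        by (simp add: c_def power_mult_distrib)
      moreover have "kap (r\<^sup>2) = of_real r"
        using that by (auto simp: kap_def)
      ultimately show ?thesis
        by (simp only: hhat_eq_ft) (simp add: e_def phase_def c_def algebra_simps power_mult_distrib)
    qed
    have "- \<i> * (\<integral>r\<in>{0..}. ?f (\<i> * of_real r) \<partial>lborel) = (\<integral>r. (2 * r * indicator {0..} r) *\<^sub>R (\<lambda>\<mu>. e (\<mu> - c)) (r\<^sup>2) / 2 \<partial>lborel)"
      unfolding set_lebesgue_integral_def integral_mult_right_zero[symmetric]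
    proof (intro Bochner_Integration.integral_cong refl)
      fix r :: real
      show "- \<i> * (indicator {0..} r *\<^sub>R ?f (\<i> * of_real r)) = (2 * r * indicator {0..} r) *\<^sub>R (\<lambda>\<mu>. e (\<mu> - c)) (r\<^sup>2) / 2"
      proof (cases "0 \<le> r")
        case True
        then show ?thesis unfolding f[OF True] by (simp add: scaleR_conv_of_real mult.assoc[symmetric])
      qed simp
    qed
    also have "\<dots> = (\<integral>\<mu>. indicator {0..} \<mu> *\<^sub>R e (\<mu> - c) \<partial>lborel) / 2"
      by (subst integral_divide_zero, subst integral_square) auto
    finally show ?thesis .
  qed
  have "contour_dplus ?f = (\<integral>r\<in>{0..}. ?f (of_real r) \<partial>lborel) + - \<i> * (\<integral>r\<in>{0..}. ?f (\<i> * of_real r) \<partial>lborel)"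
    by (simp only: contour_dplus_def diff_conv_add_uminus mult_minus_left)
  also have "\<dots> = ((\<integral>\<mu>. indicator {0..} \<mu> *\<^sub>R e (- \<mu> - c) \<partial>lborel) + (\<integral>\<mu>. indicator {0..} \<mu> *\<^sub>R e (\<mu> - c) \<partial>lborel)) / 2"
    unfolding 1 2 by (simp only: add_divide_distrib)
  also have "(\<integral>\<mu>. indicator {0..} \<mu> *\<^sub>R e (- \<mu> - c) \<partial>lborel) = (\<integral>\<mu>. indicator {..0} \<mu> *\<^sub>R e (\<mu> - c) \<partial>lborel)"
    using lborel_integral_real_affine[of "-1" "\<lambda>\<mu>. indicator {0..} \<mu> *\<^sub>R e (- \<mu> - c)" 0]
    by (simp add: indicator_def)
  \<comment> \<open>The two half-lines overlap only in the null set {0}.\<close>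
  also have "(\<integral>\<mu>. indicator {..0} \<mu> *\<^sub>R e (\<mu> - c) \<partial>lborel) + (\<integral>\<mu>. indicator {0..} \<mu> *\<^sub>R e (\<mu> - c) \<partial>lborel)
      = (\<integral>\<mu>. e (\<mu> - c) \<partial>lborel)"
  proof -
    have i: "integrable lborel (\<lambda>\<mu>. indicator {..0} \<mu> *\<^sub>R e (\<mu> - c))" "integrable lborel (\<lambda>\<mu>. indicator {0..} \<mu> *\<^sub>R e (\<mu> - c))"
      by (auto intro!: integrable_mult_indicator e')
    show ?thesis
      unfolding Bochner_Integration.integral_add[OF i, symmetric]
      by (intro integral_cong_AE) (use AE_lborel_singleton[of "0::real"] in \<open>auto simp: indicator_def elim!: eventually_mono\<close>)
  qed
  also have "(\<integral>\<mu>. e (\<mu> - c) \<partial>lborel) = (\<integral>\<tau>. e \<tau> \<partial>lborel)"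
    using integral_lborel_translate[of e "- c"] by simp
  finally show ?thesis by (simp only: e_def)
qed

text \<open>Every property of \<open>vsol\<close> except the initial condition is read off from this
  absolutely convergent form; the initial condition needs the contour itself.\<close>

lemma vsol_eq:
  fixes h :: "(real^'m) \<times> real \<Rightarrow> complex"
  assumes h: "test_fun_on A h" and xn: "0 \<le> xn"
  shows "vsol h x xn t = (\<integral>w. ft h w / (2 * pi) ^ (CARD('m) + 1) * exp (phase w x xn t) \<partial>lborel)"
proof -
  have [measurable]: "h \<in> borel_measurable borel" using h by (rule test_fun_measurable)
  have i: "integrable lborel (\<lambda>w. exp (phase w x xn t) * ft h w)"
    by (rule integrable_pointwise_bound[OF integrable_ft_0[OF h]])
       (use norm_exp_phase[OF xn] in \<open>auto simp: norm_mult intro!: mult_left_le_one_le simp del: norm_exp_eq_Re\<close>)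
  have "(\<integral>\<xi>. \<integral>\<tau>. exp (phase (\<xi>, \<tau>) x xn t) * ft h (\<xi>, \<tau>) \<partial>lborel \<partial>lborel)
      = (\<integral>w. exp (phase w x xn t) * ft h w \<partial>(lborel \<Otimes>\<^sub>M lborel))"
    using lborel_pair.integral_fst[of "\<lambda>\<xi> \<tau>. exp (phase (\<xi>, \<tau>) x xn t) * ft h (\<xi>, \<tau>)"] i
    by (simp add: lborel_prod case_prod_unfold)
  then have "vsol h x xn t = 2 / (2 * pi) ^ (CARD('m) + 1) * ((\<integral>w. exp (phase w x xn t) * ft h w \<partial>lborel) / 2)"
    unfolding vsol_def contour_dplus_eq[OF h xn] by (simp add: lborel_prod)
  also have "\<dots> = 1 / (2 * pi) ^ (CARD('m) + 1) * (\<integral>w. exp (phase w x xn t) * ft h w \<partial>lborel)"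
    by simp
  also have "\<dots> = (\<integral>w. ft h w / (2 * pi) ^ (CARD('m) + 1) * exp (phase w x xn t) \<partial>lborel)"
    unfolding integral_mult_right_zero[symmetric] by (simp add: mult_ac)
  finally show ?thesis .
qed

text \<open>Cauchy's theorem for the quadrant, via a primitive of the entire function \<open>f\<close>: the segment from \<open>n\<close> to \<open>\<i> n\<close>
  contributes \<open>O(1/n)\<close>.\<close>

lemma contour_dplus_eq_0:
  assumes holo: "f holomorphic_on UNIV"
    and bound: "\<And>\<zeta>. 0 \<le> Re \<zeta> \<Longrightarrow> 0 \<le> Im \<zeta> \<Longrightarrow> norm (f \<zeta>) * (1 + (norm \<zeta>)\<^sup>2) \<le> C"
  shows "contour_dplus f = 0"
proof -
  have pos: "0 < 1 + x\<^sup>2" for x :: real by (simp add: add_pos_nonneg)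
  have bound': "norm (f \<zeta>) \<le> C * (1 / (1 + (norm \<zeta>)\<^sup>2))" if "0 \<le> Re \<zeta>" "0 \<le> Im \<zeta>" for \<zeta>
    using bound[OF that] pos[of "norm \<zeta>"] by (simp add: pos_le_divide_eq)
  have "0 \<le> C" using order_trans[OF norm_ge_zero[of "f 0"], of C] bound[of 0] by simp
  have contf: "continuous_on S f" for S
    using holomorphic_on_imp_continuous_on[OF holo] continuous_on_subset by blast
  obtain F where F: "\<And>z. (F has_field_derivative f z) (at z)"
    using holomorphic_convex_primitive'[OF convex_UNIV open_UNIV holo] by auto
  have I: "(\<lambda>n. \<integral>r. indicator {0..real n} r *\<^sub>R f (d * of_real r) \<partial>lborel) \<longlonglongrightarrow> (\<integral>r\<in>{0..}. f (d * of_real r) \<partial>lborel)"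
    if d: "0 \<le> Re d" "0 \<le> Im d" "norm d = 1" for d
    unfolding set_lebesgue_integral_def
  proof (rule integral_dominated_convergence[where w = "\<lambda>r. C * (1 / (1 + r\<^sup>2))"])
    have "continuous_on UNIV (\<lambda>r::real. f (d * of_real r))"
      by (intro continuous_on_compose2[OF contf] continuous_intros) auto
    then have [measurable]: "(\<lambda>r::real. f (d * of_real r)) \<in> borel_measurable borel"
      by (rule borel_measurable_continuous_onI)
    show "(\<lambda>r. indicator {0..real n} r *\<^sub>R f (d * of_real r)) \<in> borel_measurable lborel" for n
      by measurable
    show "(\<lambda>r. indicator {0..} r *\<^sub>R f (d * of_real r)) \<in> borel_measurable lborel"
      by measurable
    show "integrable lborel (\<lambda>r. C * (1 / (1 + r\<^sup>2)))"
      by (intro integrable_mult_right integrable_inverse_1_plus_sq)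
    show "AE r in lborel. (\<lambda>n. indicator {0..real n} r *\<^sub>R f (d * of_real r)) \<longlonglongrightarrow> indicator {0..} r *\<^sub>R f (d * of_real r)"
    proof (rule AE_I2)
      fix r :: real
      obtain N where N: "r \<le> real N" using real_arch_simple by blast
      have "\<forall>\<^sub>F n in sequentially. (indicator {0..} r :: real) = indicator {0..real n} r"
        using eventually_ge_at_top[of N] by eventually_elim (use N in \<open>auto simp: indicator_def\<close>)
      then have "(\<lambda>n. indicator {0..real n} r :: real) \<longlonglongrightarrow> indicator {0..} r"
        by (rule Lim_transform_eventually[OF tendsto_const])
      then show "(\<lambda>n. indicator {0..real n} r *\<^sub>R f (d * of_real r)) \<longlonglongrightarrow> indicator {0..} r *\<^sub>R f (d * of_real r)"
        by (intro tendsto_intros)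
    qed
    show "AE r in lborel. norm (indicator {0..real n} r *\<^sub>R f (d * of_real r)) \<le> C * (1 / (1 + r\<^sup>2))" for n
    proof (rule AE_I2)
      fix r :: real
      show "norm (indicator {0..real n} r *\<^sub>R f (d * of_real r)) \<le> C * (1 / (1 + r\<^sup>2))"
        using bound'[of "d * of_real r"] d \<open>0 \<le> C\<close> by (auto simp: indicator_def norm_mult)
    qed
  qed
  have FTC: "d * (\<integral>r. indicator {0..real n} r *\<^sub>R f (d * of_real r) \<partial>lborel) = F (d * of_real n) - F 0" for d n
  proof -
    have "(\<integral>r. indicator {0..real n} r *\<^sub>R (d * f (d * of_real r)) \<partial>lborel) = F (d * of_real (real n)) - F (d * of_real 0)"
    proof (rule integral_FTC_Icc)
      fix r :: real
      have "((\<lambda>z. F (d * z)) has_field_derivative f (d * of_real r) * d) (at (of_real r))"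
        by (rule DERIV_chain2[OF F]) (auto intro!: derivative_eq_intros)
      from has_vector_derivative_real_field[OF this]
      show "((\<lambda>r. F (d * of_real r)) has_vector_derivative d * f (d * of_real r)) (at r within {0..real n})"
        by (simp add: mult.commute o_def)
    qed (auto intro!: continuous_intros continuous_on_compose2[OF contf])
    then show ?thesis by (simp add: mult_scaleR_right[symmetric] del: mult_scaleR_right)
  qed
  have lim: "(\<lambda>n. (\<integral>r. indicator {0..real n} r *\<^sub>R f (1 * of_real r) \<partial>lborel) - \<i> * (\<integral>r. indicator {0..real n} r *\<^sub>R f (\<i> * of_real r) \<partial>lborel))
     \<longlonglongrightarrow> (\<integral>r\<in>{0..}. f (1 * of_real r) \<partial>lborel) - \<i> * (\<integral>r\<in>{0..}. f (\<i> * of_real r) \<partial>lborel)"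
    by (intro tendsto_intros I) auto
  have q: "(\<integral>r. indicator {0..real n} r *\<^sub>R f (1 * of_real r) \<partial>lborel) - \<i> * (\<integral>r. indicator {0..real n} r *\<^sub>R f (\<i> * of_real r) \<partial>lborel)
      = F (of_real n) - F (\<i> * of_real n)" for n
    using FTC[of 1 n] FTC[of \<i> n] by simp
  have "(\<lambda>n. F (of_real n) - F (\<i> * of_real n)) \<longlonglongrightarrow> 0"
  proof (rule Lim_null_comparison)
    show "\<forall>\<^sub>F n in sequentially. norm (F (of_real n) - F (\<i> * of_real n)) \<le> C * (1 / (1 + (real n)\<^sup>2 / 2)) * (2 * real n)"
    proof (rule always_eventually, rule allI)
      fix n :: nat
      have "norm (F (of_real n) - F (\<i> * of_real n)) \<le> (C * (1 / (1 + (real n)\<^sup>2 / 2))) * norm (of_real n - \<i> * of_real n)"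
      proof (rule field_differentiable_bound[where S = "closed_segment (of_real n) (\<i> * of_real n)" and f' = f])
        show "(F has_field_derivative f z) (at z within closed_segment (of_real n) (\<i> * of_real n))" for z
          using F by (rule has_field_derivative_at_within)
        fix z assume "z \<in> closed_segment (complex_of_real (real n)) (\<i> * of_real n)"
        then obtain u where u: "0 \<le> u" "u \<le> 1" "z = (1 - u) *\<^sub>R complex_of_real (real n) + u *\<^sub>R (\<i> * of_real n)"
          by (auto simp: in_segment)
        have z: "Re z = (1 - u) * n" "Im z = u * n" by (simp_all add: u(3))
        \<comment> \<open>The segment stays at distance at least n / sqrt 2 from the origin, so
          \<open>f\<close> is O(1 / (n * n)) on it while its length is O(n).\<close>
        have "(1 - u)\<^sup>2 + u\<^sup>2 \<ge> 1 / 2"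
          using zero_le_power2[of "2 * u - 1"] by (simp add: power2_eq_square algebra_simps)
        then have "(real n)\<^sup>2 * ((1 - u)\<^sup>2 + u\<^sup>2) \<ge> (real n)\<^sup>2 * (1 / 2)" by (intro mult_left_mono) auto
        then have "(norm z)\<^sup>2 \<ge> (real n)\<^sup>2 / 2" by (simp add: cmod_power2 z power_mult_distrib distrib_left mult.commute)
        then have "C * (1 / (1 + (norm z)\<^sup>2)) \<le> C * (1 / (1 + (real n)\<^sup>2 / 2))"
          using \<open>0 \<le> C\<close> by (intro mult_left_mono divide_left_mono mult_pos_pos) (auto intro!: add_pos_nonneg)
        then show "norm (f z) \<le> C * (1 / (1 + (real n)\<^sup>2 / 2))"
          using bound'[of z] u(1,2) by (simp add: z)
      qed auto
      also have "\<dots> \<le> (C * (1 / (1 + (real n)\<^sup>2 / 2))) * (2 * real n)"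
        using norm_triangle_ineq4[of "of_real n" "\<i> * of_real n"] \<open>0 \<le> C\<close>
        by (intro mult_left_mono) (auto simp: norm_mult)
      finally show "norm (F (of_real n) - F (\<i> * of_real n)) \<le> C * (1 / (1 + (real n)\<^sup>2 / 2)) * (2 * real n)" .
    qed
    have "(\<lambda>n. 1 / (1 + (real n)\<^sup>2 / 2) * (2 * real n)) \<longlonglongrightarrow> 0" by real_asymp
    then have "(\<lambda>n. C * (1 / (1 + (real n)\<^sup>2 / 2) * (2 * real n))) \<longlonglongrightarrow> C * 0" by (intro tendsto_intros)
    then show "(\<lambda>n. C * (1 / (1 + (real n)\<^sup>2 / 2)) * (2 * real n)) \<longlonglongrightarrow> 0" by (simp only: mult.assoc mult_zero_right)
  qed
  from LIMSEQ_unique[OF lim[unfolded q] this] show ?thesis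
    by (simp only: contour_dplus_def mult_1)
qed

text \<open>The modulus of exp (- i \<tau> t) is exp (Im \<tau> * t), at most 1 because the support
  lies in t > 0. This is how causality enters the initial condition.\<close>

lemma norm_exp_linear_lower_half_plane:
  assumes f: "test_fun_on (UNIV \<times> {0<..<2}) f" and Im: "Im \<tau> \<le> 0"
  shows "norm (\<integral>z. exp (- \<i> * of_real (\<xi> \<bullet> fst z) - \<i> * \<tau> * of_real (snd z)) * f z \<partial>lborel) \<le> (\<integral>z. norm (f z) \<partial>lborel)"
proof (rule order_trans[OF integral_norm_bound], rule integral_mono')
  show "integrable lborel (\<lambda>z. norm (f z))" using integrable_test_fun[OF f] by simp
  fix z :: "'a \<times> real"
  show "norm (exp (- \<i> * of_real (\<xi> \<bullet> fst z) - \<i> * \<tau> * of_real (snd z)) * f z) \<le> norm (f z)"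
  proof (cases "z \<in> tsupport f")
    case True
    then have "0 < snd z" using f by (auto simp: test_fun_on_def)
    then have "Im \<tau> * snd z \<le> 0" using Im by (simp add: mult_nonpos_nonneg)
    then show ?thesis by (simp add: norm_mult mult_left_le_one_le)
  qed (simp add: not_in_tsupport)
qed simp

text \<open>Two integrations by parts in time produce the square of \<tau>, and the second time
  derivative has the same support property as \<open>h\<close>. The bound is uniform in
  \<xi>.\<close>

lemma hhat_decay_lower_half_plane:
  fixes h :: "(real^'m) \<times> real \<Rightarrow> complex"
  assumes h: "test_fun_on (UNIV \<times> {0<..<2}) h"
  obtains C where "\<And>\<xi> \<tau>. Im \<tau> \<le> 0 \<Longrightarrow> norm (hhat h \<xi> \<tau>) * (1 + (norm \<tau>)\<^sup>2) \<le> C" "0 \<le> C"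
proof -
  define e where "e = (0 :: real^'m, 1 :: real)"
  have e: "e \<in> Basis" by (auto simp: e_def Basis_prod_def)
  let ?L = "\<lambda>\<xi> \<tau> z. - \<i> * of_real (\<xi> \<bullet> fst z) - \<i> * \<tau> * of_real (snd z) :: complex"
  have L: "bounded_linear (?L \<xi> \<tau>)" for \<xi> :: "real^'m" and \<tau>
    by (intro bounded_linear_sub bounded_linear_const_mult bounded_linear_compose[OF bounded_linear_of_real]
        bounded_linear_compose[OF bounded_linear_inner_right] bounded_linear_fst bounded_linear_snd)
  note h1 = test_fun_dderiv[OF h e]
  note h2 = test_fun_dderiv[OF h1 e]
  have *: "norm (hhat h \<xi> \<tau>) * (norm \<tau>)\<^sup>2 = norm (\<integral>z. exp (?L \<xi> \<tau> z) * dderiv e (dderiv e h) z \<partial>lborel)" for \<xi> \<tau>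
    unfolding integral_exp_linear_dderiv[OF h1 e L] integral_exp_linear_dderiv[OF h e L] hhat_def
    by (simp add: e_def norm_mult power2_eq_square)
  show ?thesis
  proof (rule that)
    fix \<xi> :: "real^'m" and \<tau> assume "Im \<tau> \<le> 0"
    then show "norm (hhat h \<xi> \<tau>) * (1 + (norm \<tau>)\<^sup>2) \<le> (\<integral>z. norm (h z) \<partial>lborel) + (\<integral>z. norm (dderiv e (dderiv e h) z) \<partial>lborel)"
      using norm_exp_linear_lower_half_plane[OF h, of \<tau> \<xi>] norm_exp_linear_lower_half_plane[OF h2, of \<tau> \<xi>]
      unfolding distrib_left * by (simp add: hhat_def)
  qed simp
qed

lemma hhat_holomorphic:
  fixes h :: "(real^'m) \<times> real \<Rightarrow> complex"
  assumes h: "test_fun_on A h"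
  shows "hhat h \<xi> holomorphic_on UNIV"
proof -
  let ?L = "\<lambda>\<tau> z. - \<i> * of_real (\<xi> \<bullet> fst z) - \<i> * \<tau> * of_real (snd z) :: complex"
  have L: "bounded_linear (?L \<tau>)" for \<tau>
    by (intro bounded_linear_sub bounded_linear_const_mult bounded_linear_compose[OF bounded_linear_of_real]
        bounded_linear_compose[OF bounded_linear_inner_right] bounded_linear_fst bounded_linear_snd)
  have ch: "continuous_on S h" for S using test_fun_continuous[OF h] continuous_on_subset by blast
  \<comment> \<open>The integral is restricted to a box containing the support, the domain for which
    the Leibniz rule is stated.\<close>
  obtain a b where ab: "tsupport h \<subseteq> cbox a b"
    using h bounded_subset_cbox_symmetric compact_imp_bounded unfolding test_fun_on_def by metis
  have eq: "hhat h \<xi> \<tau> = integral (cbox a b) (\<lambda>z. exp (?L \<tau> z) * h z)" for \<tau>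
  proof -
    have "hhat h \<xi> \<tau> = integral UNIV (\<lambda>z. exp (?L \<tau> z) * h z)"
      unfolding hhat_def by (rule integral_lborel[symmetric, OF integrable_exp_linear_test_fun[OF h L]])
    also have "\<dots> = integral UNIV (\<lambda>z. if z \<in> cbox a b then exp (?L \<tau> z) * h z else 0)"
    proof (intro arg_cong[where f = "integral UNIV"] ext)
      fix z
      show "exp (?L \<tau> z) * h z = (if z \<in> cbox a b then exp (?L \<tau> z) * h z else 0)"
        using ab not_in_tsupport[of z h] by (cases "z \<in> cbox a b") auto
    qed
    also have "\<dots> = integral (cbox a b) (\<lambda>z. exp (?L \<tau> z) * h z)"
      by (rule integral_restrict_UNIV)
    finally show ?thesis .
  qed
  have "(\<lambda>\<tau>. integral (cbox a b) (\<lambda>z. exp (?L \<tau> z) * h z)) holomorphic_on UNIV"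
  proof (rule leibniz_rule_holomorphic[where fx = "\<lambda>\<tau> z. - \<i> * of_real (snd z) * (exp (?L \<tau> z) * h z)"])
    show "((\<lambda>\<tau>. exp (?L \<tau> z) * h z) has_field_derivative - \<i> * of_real (snd z) * (exp (?L \<tau> z) * h z)) (at \<tau> within UNIV)" for \<tau> z
      by (auto intro!: derivative_eq_intros simp: algebra_simps)
    show "(\<lambda>z. exp (?L \<tau> z) * h z) integrable_on cbox a b" for \<tau>
      by (intro integrable_continuous continuous_intros ch)
    show "continuous_on (UNIV \<times> cbox a b) (\<lambda>(\<tau>, z). - \<i> * of_real (snd z) * (exp (?L \<tau> z) * h z))"
      unfolding case_prod_unfold by (intro continuous_intros continuous_on_compose2[OF ch]) auto
  qed auto
  then show ?thesis by (simp add: eq[abs_def])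
qed

text \<open>For t > 0 the factor exp (- i \<zeta>^2 t) has modulus exp (2 Re \<zeta> Im \<zeta> t),
  which grows inside the quadrant. At t = 0 it is 1, the remaining exponential is bounded, and the
  contour can be closed for each \<xi> separately.\<close>

lemma vsol_initial:
  fixes h :: "(real^'m) \<times> real \<Rightarrow> complex"
  assumes h: "test_fun_on (UNIV \<times> {0<..<2}) h" and xn: "0 \<le> xn"
  shows "vsol h x xn 0 = 0"
proof -
  have "contour_dplus (\<lambda>\<zeta>. exp (\<i> * of_real (\<xi> \<bullet> x) + \<i> * \<zeta> * of_real xn - \<i> * (of_real ((norm \<xi>)\<^sup>2) + \<zeta>\<^sup>2) * of_real 0)
         * \<zeta> * hhat h \<xi> (- of_real ((norm \<xi>)\<^sup>2) - \<zeta>\<^sup>2)) = 0" for \<xi> :: "real^'m"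
  proof -
    define c where "c = (norm \<xi>)\<^sup>2"
    have c: "0 \<le> c" by (simp add: c_def)
    obtain C where C: "\<And>\<tau>. Im \<tau> \<le> 0 \<Longrightarrow> norm (hhat h \<xi> \<tau>) * (1 + (norm \<tau>)\<^sup>2) \<le> C" "0 \<le> C"
      using hhat_decay_lower_half_plane[OF h] by metis
    show ?thesis
    proof (rule contour_dplus_eq_0[where C = "2 * (1 + c)\<^sup>2 * C"])
      show "(\<lambda>\<zeta>. exp (\<i> * of_real (\<xi> \<bullet> x) + \<i> * \<zeta> * of_real xn - \<i> * (of_real ((norm \<xi>)\<^sup>2) + \<zeta>\<^sup>2) * of_real 0)
         * \<zeta> * hhat h \<xi> (- of_real ((norm \<xi>)\<^sup>2) - \<zeta>\<^sup>2)) holomorphic_on UNIV"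
        by (intro holomorphic_intros holomorphic_on_compose_gen[OF _ hhat_holomorphic[OF h], unfolded o_def]) auto
      fix \<zeta> :: complex assume \<zeta>: "0 \<le> Re \<zeta>" "0 \<le> Im \<zeta>"
      define \<tau> where "\<tau> = - of_real c - \<zeta>\<^sup>2"
      \<comment> \<open>The closed quadrant is mapped into the lower half-plane, where the decay of
        \<open>hhat\<close> is known.\<close>
      have "Im \<tau> = - 2 * Re \<zeta> * Im \<zeta>" by (simp add: \<tau>_def power2_eq_square)
      then have Im: "Im \<tau> \<le> 0" using \<zeta> by simp
      have e: "norm (exp (\<i> * of_real (\<xi> \<bullet> x) + \<i> * \<zeta> * of_real xn)) \<le> 1"
        using \<zeta> xn by simp
      have "\<zeta>\<^sup>2 = - (\<tau> + of_real c)" by (simp add: \<tau>_def)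
      then have "norm (\<zeta>\<^sup>2) = norm (\<tau> + of_real c)" by (simp only: norm_minus_cancel)
      then have "norm (\<zeta>\<^sup>2) \<le> norm \<tau> + c"
        using norm_triangle_ineq[of \<tau> "of_real c"] c by simp
      then have le: "1 + (norm \<zeta>)\<^sup>2 \<le> (1 + c) * (1 + norm \<tau>)"
      proof -
        have "0 \<le> c * norm \<tau>" using c by simp
        moreover have "(1 + c) * (1 + norm \<tau>) = 1 + c + norm \<tau> + c * norm \<tau>" by (simp add: algebra_simps)
        ultimately show ?thesis using \<open>norm (\<zeta>\<^sup>2) \<le> norm \<tau> + c\<close> unfolding norm_power by linarith
      qed
      \<comment> \<open>Quadratic decay in \<tau> is decay of order four in \<zeta>. It pays for the
        factor \<zeta> and for the weight 1 + |\<zeta>|^2 that closing the contour requires; the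
        constant depends on \<xi> through \<open>c\<close>, which is harmless since \<xi> is
        fixed.\<close>
      have "norm \<zeta> \<le> 1 + (norm \<zeta>)\<^sup>2"
        using zero_le_power2[of "norm \<zeta> - 1/2"] by (simp add: power2_eq_square algebra_simps)
      then have "norm \<zeta> * (1 + (norm \<zeta>)\<^sup>2) \<le> (1 + (norm \<zeta>)\<^sup>2) * (1 + (norm \<zeta>)\<^sup>2)"
        by (intro mult_right_mono) auto
      also have "\<dots> \<le> ((1 + c) * (1 + norm \<tau>)) * ((1 + c) * (1 + norm \<tau>))"
        using le c by (intro mult_mono) auto
      also have "\<dots> = (1 + c)\<^sup>2 * (1 + norm \<tau>)\<^sup>2"
        by (simp add: power2_eq_square)
      also have "\<dots> \<le> (1 + c)\<^sup>2 * (2 * (1 + (norm \<tau>)\<^sup>2))"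
      proof (rule mult_left_mono)
        show "(1 + norm \<tau>)\<^sup>2 \<le> 2 * (1 + (norm \<tau>)\<^sup>2)"
          using zero_le_power2[of "norm \<tau> - 1"] by (simp add: power2_eq_square algebra_simps)
      qed simp
      finally have p: "norm \<zeta> * (1 + (norm \<zeta>)\<^sup>2) \<le> 2 * (1 + c)\<^sup>2 * (1 + (norm \<tau>)\<^sup>2)"
        by (simp only: mult_ac)
      have "norm (exp (\<i> * of_real (\<xi> \<bullet> x) + \<i> * \<zeta> * of_real xn) * \<zeta> * hhat h \<xi> \<tau>) * (1 + (norm \<zeta>)\<^sup>2)
          = norm (exp (\<i> * of_real (\<xi> \<bullet> x) + \<i> * \<zeta> * of_real xn)) * (norm \<zeta> * (1 + (norm \<zeta>)\<^sup>2) * norm (hhat h \<xi> \<tau>))"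
        by (simp add: norm_mult mult_ac)
      also have "\<dots> \<le> 1 * (2 * (1 + c)\<^sup>2 * (1 + (norm \<tau>)\<^sup>2) * norm (hhat h \<xi> \<tau>))"
        by (rule mult_mono[OF e mult_right_mono[OF p]]) auto
      also have "\<dots> \<le> 2 * (1 + c)\<^sup>2 * C"
        using mult_left_mono[OF C(1)[OF Im], of "2 * (1 + c)\<^sup>2"] by (simp add: mult_ac)
      finally show "norm (exp (\<i> * of_real (\<xi> \<bullet> x) + \<i> * \<zeta> * of_real xn - \<i> * (of_real ((norm \<xi>)\<^sup>2) + \<zeta>\<^sup>2) * of_real 0)
         * \<zeta> * hhat h \<xi> (- of_real ((norm \<xi>)\<^sup>2) - \<zeta>\<^sup>2)) * (1 + (norm \<zeta>)\<^sup>2) \<le> 2 * (1 + c)\<^sup>2 * C"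
        by (simp add: \<tau>_def c_def)
    qed
  qed
  then show ?thesis by (simp only: vsol_def mult_zero_right Bochner_Integration.integral_zero)
qed

lemma vsol_boundary:
  fixes h :: "(real^'m) \<times> real \<Rightarrow> complex"
  assumes h: "test_fun_on A h"
  shows "vsol h x 0 t = h (x, t)"
proof -
  have "vsol h x 0 t = (\<integral>w. 1 / (2 * pi) ^ (CARD('m) + 1) * (cis (w \<bullet> (x, t)) * ft h w) \<partial>lborel)"
    unfolding vsol_eq[OF h order_refl]
    by (intro Bochner_Integration.integral_cong refl)
       (simp add: phase_def cis_conv_exp inner_prod_def algebra_simps)
  also have "\<dots> = 1 / (2 * pi) ^ (CARD('m) + 1) * (of_real ((2 * pi) ^ DIM((real^'m) \<times> real)) * h (x, t))"
    by (simp only: integral_mult_right_zero test_fun_inversion[OF h])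
  finally show ?thesis by simp
qed

lemma vsol_pde:
  fixes h :: "(real^'m) \<times> real \<Rightarrow> complex"
  assumes h: "test_fun_on A h" and xn: "0 < xn"
  shows "(\<lambda>s. vsol h x xn s) differentiable (at t)"
    and "twice_diff (\<lambda>r. vsol h x r t) xn"
    and "e \<in> Basis \<Longrightarrow> twice_diff (\<lambda>r. vsol h (x + r *\<^sub>R e) xn t) 0"
    and "\<i> * vector_derivative (\<lambda>s. vsol h x xn s) (at t)
          + (\<Sum>e\<in>Basis. d2 (\<lambda>r. vsol h (x + r *\<^sub>R e) xn t) 0)
          + d2 (\<lambda>r. vsol h x r t) xn = 0"
proof -
  have [measurable]: "h \<in> borel_measurable borel" using h by (rule test_fun_measurable)
  define c where "c w = ft h w / (2 * pi) ^ (CARD('m) + 1)" for w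
  have [measurable]: "c \<in> borel_measurable borel" unfolding c_def by measurable
  have eq: "vsol h y r s = (\<integral>w. c w * exp (phase w y r s) \<partial>lborel)" if "0 \<le> r" for y r s
    using vsol_eq[OF h that] by (simp add: c_def)
  have c: "norm (c w) \<le> norm (ft h w)" for w
  proof -
    have "1 \<le> (2 * pi) ^ (CARD('m) + 1)" using pi_gt3 by (intro one_le_power) auto
    then have "norm (ft h w) * 1 \<le> norm (ft h w) * (2 * pi) ^ (CARD('m) + 1)" by (intro mult_left_mono) auto
    then show ?thesis by (simp add: c_def norm_divide norm_mult norm_power field_simps)
  qed
  \<comment> \<open>Here \<open>l\<close> is the coefficient of the differentiation variable in the
    phase. Each derivative costs at most one factor 1 + |w|, absorbed by the decay of
    \<open>ft h\<close>.\<close>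
  have i: "integrable lborel c" "integrable lborel (\<lambda>w. c w * l w)" "integrable lborel (\<lambda>w. c w * l w * l w)"
    if [measurable]: "l \<in> borel_measurable borel" and l: "\<And>w. norm (l w) \<le> 1 + norm w" for l
  proof -
    show "integrable lborel c"
      by (rule integrable_pointwise_bound[OF integrable_ft_0[OF h]]) (use c in auto)
    have "norm (l w) * norm (c w) \<le> (1 + norm w) * norm (ft h w)" for w
      by (intro mult_mono l c) auto
    then show "integrable lborel (\<lambda>w. c w * l w)"
      by (intro integrable_pointwise_bound[OF integrable_ft[OF h, of 1]]) (auto simp: norm_mult mult.commute abs_mult)
    have "norm (l w) * norm (l w) * norm (c w) \<le> (1 + norm w) * (1 + norm w) * norm (ft h w)" for w
      by (intro mult_mono l c) auto
    then show "integrable lborel (\<lambda>w. c w * l w * l w)"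
      by (intro integrable_pointwise_bound[OF integrable_ft[OF h, of 2]])
         (auto simp: norm_mult mult_ac abs_mult power2_eq_square)
  qed
  have l1: "norm (\<i> * complex_of_real (snd w)) \<le> 1 + norm w" for w :: "(real^'m) \<times> real"
    using norm_snd_le[of "snd w" "fst w"] by (simp add: norm_mult)
  \<comment> \<open>The symbol grows quadratically, but \<open>kap\<close> is its square root, so a
    normal derivative also costs only one power of the frequency.\<close>
  have l2: "norm (- kap (symb w)) \<le> 1 + norm w" for w :: "(real^'m) \<times> real"
  proof -
    have "\<bar>symb w\<bar> \<le> norm w + (norm w)\<^sup>2"
    proof -
      have "(norm (fst w))\<^sup>2 \<le> (norm w)\<^sup>2"
        using norm_fst_le[of "fst w" "snd w"] by (intro power_mono) auto
      moreover have "\<bar>snd w\<bar> \<le> norm w" using norm_snd_le[of "snd w" "fst w"] by simp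
      ultimately show ?thesis using zero_le_power2[of "norm (fst w)"] by linarith
    qed
    also have "\<dots> \<le> (1 + norm w)\<^sup>2" by (simp add: power2_eq_square algebra_simps)
    finally have "sqrt \<bar>symb w\<bar> \<le> 1 + norm w" by (rule real_le_lsqrt[rotated -1]) auto
    then show ?thesis by (simp add: norm_kap)
  qed
  have l3: "norm (\<i> * complex_of_real (fst w \<bullet> e)) \<le> 1 + norm w" if "e \<in> Basis" for w :: "(real^'m) \<times> real" and e
    using norm_fst_le[of "fst w" "snd w"] Basis_le_norm[OF that, of "fst w"] by (simp add: norm_mult)
  have p1: "phase w x xn s = phase w x xn 0 + of_real s * (\<i> * of_real (snd w))" for w :: "(real^'m) \<times> real" and s
    by (simp add: phase_def)
  have p2: "phase w x r t = phase w x 0 t + of_real r * (- kap (symb w))" for w :: "(real^'m) \<times> real" and r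
    by (simp add: phase_def)
  have p3: "phase w (x + r *\<^sub>R e) xn t = phase w x xn t + of_real r * (\<i> * of_real (fst w \<bullet> e))" for w :: "(real^'m) \<times> real" and r e
    by (simp add: phase_def inner_add_right algebra_simps)
  have [measurable]: "(\<lambda>w::(real^'m) \<times> real. kap (symb w)) \<in> borel_measurable borel"
    "(\<lambda>w::(real^'m) \<times> real. complex_of_real (fst w \<bullet> e)) \<in> borel_measurable borel"
    "(\<lambda>w::(real^'m) \<times> real. complex_of_real (snd w)) \<in> borel_measurable borel" for e
    by measurable
  let ?E = "\<lambda>w. exp (phase w x xn t)"
  have dt: "((\<lambda>s. vsol h x xn s) has_vector_derivative (\<integral>w. c w * (\<i> * of_real (snd w)) * ?E w \<partial>lborel)) (at t)"
  proof -
    have "((\<lambda>s. \<integral>w. c w * exp (phase w x xn 0 + of_real s * (\<i> * of_real (snd w))) \<partial>lborel) has_vector_derivative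
      (\<integral>w. c w * (\<i> * of_real (snd w)) * exp (phase w x xn 0 + of_real t * (\<i> * of_real (snd w))) \<partial>lborel)) (at t)"
    proof (rule has_vector_derivative_integral_exp[where S = UNIV])
      show "Re (phase w x xn 0 + of_real s * (\<i> * of_real (snd w))) \<le> 0" for w :: "(real^'m) \<times> real" and s
        unfolding p1[symmetric] using xn by (intro Re_phase) auto
    qed (auto intro!: i l1 simp del: norm_mult)
    then show ?thesis unfolding p1[symmetric] eq[OF less_imp_le[OF xn], symmetric] .
  qed
  then show "(\<lambda>s. vsol h x xn s) differentiable (at t)" by (rule differentiableI_vector)
  \<comment> \<open>The phase is expanded from x_n = 0, but the derivative is taken on the open
    half-line, where the real part of the exponent is nonpositive.\<close>
  have xx: "twice_diff (\<lambda>r. vsol h x r t) xn" "d2 (\<lambda>r. vsol h x r t) xn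
     = (\<integral>w. c w * (- kap (symb w)) * (- kap (symb w)) * (exp (phase w x 0 t + of_real xn * (- kap (symb w)))) \<partial>lborel)"
  proof -
    have Re: "Re (phase w x 0 t + of_real s * (- kap (symb w))) \<le> 0" if "s \<in> {0<..}" for w :: "(real^'m) \<times> real" and s
      unfolding p2[symmetric] using that by (intro Re_phase) auto
    have g: "vsol h x s t = (\<integral>w. c w * exp (phase w x 0 t + of_real s * (- kap (symb w))) \<partial>lborel)" if "s \<in> {0<..}" for s
      unfolding p2[symmetric] using that by (intro eq) auto
    note * = twice_diff_integral_exp[where S = "{0<..}" and M = lborel, OF _ _ i(1)[OF _ l2] i(2)[OF _ l2] i(3)[OF _ l2] _ _ Re g]
    show "twice_diff (\<lambda>r. vsol h x r t) xn" by (rule *(1)) (use xn in auto)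
    show "d2 (\<lambda>r. vsol h x r t) xn
     = (\<integral>w. c w * (- kap (symb w)) * (- kap (symb w)) * (exp (phase w x 0 t + of_real xn * (- kap (symb w)))) \<partial>lborel)"
      by (rule *(2)) (use xn in auto)
  qed
  show "twice_diff (\<lambda>r. vsol h x r t) xn" by (rule xx)
  have ee: "twice_diff (\<lambda>r. vsol h (x + r *\<^sub>R e) xn t) 0" "d2 (\<lambda>r. vsol h (x + r *\<^sub>R e) xn t) 0
     = (\<integral>w. c w * (\<i> * of_real (fst w \<bullet> e)) * (\<i> * of_real (fst w \<bullet> e)) * exp (phase w x xn t + of_real 0 * (\<i> * of_real (fst w \<bullet> e))) \<partial>lborel)"
    if e: "e \<in> Basis" for e
  proof -
    have Re: "Re (phase w x xn t + of_real s * (\<i> * of_real (fst w \<bullet> e))) \<le> 0" for w :: "(real^'m) \<times> real" and s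
      unfolding p3[symmetric] using xn by (intro Re_phase) auto
    have g: "vsol h (x + s *\<^sub>R e) xn t = (\<integral>w. c w * exp (phase w x xn t + of_real s * (\<i> * of_real (fst w \<bullet> e))) \<partial>lborel)" for s
      unfolding p3[symmetric] using xn by (intro eq) auto
    note * = twice_diff_integral_exp[where S = UNIV and M = lborel, OF _ _ i(1)[OF _ l3[OF e]] i(2)[OF _ l3[OF e]] i(3)[OF _ l3[OF e]] _ _ Re g]
    show "twice_diff (\<lambda>r. vsol h (x + r *\<^sub>R e) xn t) 0" by (rule *(1)) auto
    show "d2 (\<lambda>r. vsol h (x + r *\<^sub>R e) xn t) 0
     = (\<integral>w. c w * (\<i> * of_real (fst w \<bullet> e)) * (\<i> * of_real (fst w \<bullet> e)) * exp (phase w x xn t + of_real 0 * (\<i> * of_real (fst w \<bullet> e))) \<partial>lborel)"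
      by (rule *(2)) auto
  qed
  show "e \<in> Basis \<Longrightarrow> twice_diff (\<lambda>r. vsol h (x + r *\<^sub>R e) xn t) 0" by (rule ee)
  have iE: "integrable lborel (\<lambda>w. f w * ?E w)" if "integrable lborel f" for f
    by (rule integrable_pointwise_bound[OF that])
       (use norm_exp_phase[OF less_imp_le[OF xn]] that in \<open>auto simp: norm_mult intro!: mult_right_le_one_le simp del: norm_exp_eq_Re\<close>)
  have int1: "integrable lborel (\<lambda>w. \<i> * (c w * (\<i> * of_real (snd w)) * ?E w))"
    by (intro integrable_mult_right iE i l1) auto
  have int2: "integrable lborel (\<lambda>w. \<Sum>e\<in>Basis. c w * (\<i> * of_real (fst w \<bullet> e)) * (\<i> * of_real (fst w \<bullet> e)) * ?E w)"
    by (intro Bochner_Integration.integrable_sum iE i l3) auto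
  have int3: "integrable lborel (\<lambda>w. c w * (- kap (symb w)) * (- kap (symb w)) * ?E w)"
    by (intro iE i l2) auto
  have "\<i> * vector_derivative (\<lambda>s. vsol h x xn s) (at t) = (\<integral>w. \<i> * (c w * (\<i> * of_real (snd w)) * ?E w) \<partial>lborel)"
    using dt by (simp add: vector_derivative_at)
  moreover have "(\<Sum>e\<in>Basis. d2 (\<lambda>r. vsol h (x + r *\<^sub>R e) xn t) 0)
      = (\<integral>w. (\<Sum>e\<in>Basis. c w * (\<i> * of_real (fst w \<bullet> e)) * (\<i> * of_real (fst w \<bullet> e)) * ?E w) \<partial>lborel)"
    by (subst Bochner_Integration.integral_sum) (auto simp: ee intro!: iE i l3 simp del: norm_mult)
  moreover have "d2 (\<lambda>r. vsol h x r t) xn = (\<integral>w. c w * (- kap (symb w)) * (- kap (symb w)) * ?E w \<partial>lborel)"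
    by (simp only: xx(2) p2[of _ xn])
  \<comment> \<open>The dispersion relation: i (i \<tau>) - |\<xi>|^2 + \<mu> = 0.\<close>
  moreover have "\<i> * (c w * (\<i> * of_real (snd w)) * ?E w)
      + (\<Sum>e\<in>Basis. c w * (\<i> * of_real (fst w \<bullet> e)) * (\<i> * of_real (fst w \<bullet> e)) * ?E w)
      + c w * (- kap (symb w)) * (- kap (symb w)) * ?E w = 0" for w
  proof -
    have "(\<Sum>e\<in>Basis. c w * (\<i> * of_real (fst w \<bullet> e)) * (\<i> * of_real (fst w \<bullet> e)) * ?E w)
      = c w * ?E w * (- of_real ((norm (fst w))\<^sup>2))"
      unfolding norm_sq_Basis of_real_sum sum_negf[symmetric] sum_distrib_left
      by (intro sum.cong refl) (simp add: power2_eq_square mult_ac)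
    moreover have "c w * (- kap (symb w)) * (- kap (symb w)) * ?E w = c w * ?E w * (kap (symb w))\<^sup>2"
      by (simp only: mult_minus_left mult_minus_right minus_minus power2_eq_square mult_ac)
    then have "c w * (- kap (symb w)) * (- kap (symb w)) * ?E w = c w * ?E w * of_real (symb w)"
      by (simp only: kap_square)
    ultimately show ?thesis by (simp add: algebra_simps)
  qed
  ultimately show "\<i> * vector_derivative (\<lambda>s. vsol h x xn s) (at t)
          + (\<Sum>e\<in>Basis. d2 (\<lambda>r. vsol h (x + r *\<^sub>R e) xn t) 0)
          + d2 (\<lambda>r. vsol h x r t) xn = 0"
    by (simp only: Bochner_Integration.integral_add[symmetric] int1 int2 int3
        Bochner_Integration.integrable_add Bochner_Integration.integral_zero)
qed

lemma solves_ibvp_vsol: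
  fixes h :: "(real^'m) \<times> real \<Rightarrow> complex"
  assumes h: "test_fun_on (UNIV \<times> {0<..<2}) h"
  shows "solves_ibvp (vsol h) h"
  unfolding solves_ibvp_def using vsol_pde[OF h] vsol_initial[OF h] vsol_boundary[OF h] by auto

section \<open>The extension\<close>

text \<open>Space-time groups the variables as ((x', x_n), t), whereas the decaying modes need ((x',
  t), x_n): the boundary frequency becomes one component and x_n can be treated as the single last
  variable.\<close>

definition swap23 :: "('a \<times> 'b) \<times> 'c \<Rightarrow> ('a \<times> 'c) \<times> 'b" where
  "swap23 z = ((fst (fst z), snd z), snd (fst z))"

lemma swap23_simp[simp]: "swap23 ((a, b), c) = ((a, c), b)"
  by (simp add: swap23_def)

lemma swap23_swap23[simp]: "swap23 (swap23 z) = z"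
  by (simp add: swap23_def)

lemma swap23_add: "swap23 (x + y) = swap23 x + swap23 y"
  by (simp add: swap23_def)

lemma swap23_scaleR: "swap23 (r *\<^sub>R x) = r *\<^sub>R swap23 x"
  by (simp add: swap23_def)

lemma swap23_Basis: "b \<in> Basis \<Longrightarrow> swap23 b \<in> Basis"
  unfolding Basis_prod_def image_Un image_image by (auto simp: swap23_def zero_prod_def)

lemma swap23_Basis_image:
  "swap23 ` (Basis :: (('a::euclidean_space \<times> 'b::euclidean_space) \<times> 'c::euclidean_space) set) = Basis"
proof
  show "(Basis :: (('a \<times> 'c) \<times> 'b) set) \<subseteq> swap23 ` Basis"
    by (metis swap23_Basis swap23_swap23 image_eqI subsetI)
  show "swap23 ` (Basis :: (('a \<times> 'b) \<times> 'c) set) \<subseteq> Basis"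
    by (rule image_subsetI) (rule swap23_Basis)
qed

lemma inner_swap23: "swap23 x \<bullet> y = x \<bullet> swap23 y"
  by (simp add: swap23_def inner_prod_def)

lemma continuous_swap23: "continuous_on S swap23"
  unfolding swap23_def by (intro continuous_intros)

lemma measurable_swap23[measurable]:
  "swap23 \<in> (borel :: (('a::euclidean_space \<times> 'b::euclidean_space) \<times> 'c::euclidean_space) measure) \<rightarrow>\<^sub>M borel"
  by (intro borel_measurable_continuous_onI continuous_swap23)

lemma inj_on_swap23: "inj_on swap23 A"
  by (metis inj_onI swap23_swap23)

text \<open>Lebesgue measure is determined by its values on boxes, and the swap permutes the basis
  vectors.\<close>

lemma distr_swap23:
  "distr lborel borel swap23 = (lborel :: (('a::euclidean_space \<times> 'c::euclidean_space) \<times> 'b::euclidean_space) measure)"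
proof (rule lborel_eqI[symmetric])
  fix l u :: "('a \<times> 'c) \<times> 'b"
  assume le: "\<And>b. b \<in> Basis \<Longrightarrow> l \<bullet> b \<le> u \<bullet> b"
  have "swap23 x \<in> box l u \<longleftrightarrow> x \<in> box (swap23 l) (swap23 u)" for x
  proof -
    have "swap23 x \<in> box l u \<longleftrightarrow> (\<forall>b\<in>swap23 ` Basis. l \<bullet> b < swap23 x \<bullet> b \<and> swap23 x \<bullet> b < u \<bullet> b)"
      by (simp only: mem_box swap23_Basis_image)
    then show ?thesis by (simp add: mem_box inner_swap23)
  qed
  then have "swap23 -` box l u = box (swap23 l) (swap23 u)" by auto
  then have "emeasure (distr lborel borel swap23) (box l u) = emeasure lborel (box (swap23 l) (swap23 u))"
    by (simp add: emeasure_distr)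
  also have "\<dots> = (\<Prod>b\<in>Basis. (swap23 u - swap23 l) \<bullet> b)"
    using le by (intro emeasure_lborel_box) (simp add: inner_swap23 swap23_Basis)
  also have "(\<Prod>b\<in>Basis. (swap23 u - swap23 l) \<bullet> b) = (\<Prod>b\<in>swap23 ` Basis. (u - l) \<bullet> b)"
    by (subst prod.reindex) (auto simp: inner_swap23 inner_diff_left inj_on_swap23)
  finally show "emeasure (distr lborel borel swap23) (box l u) = ennreal (\<Prod>b\<in>Basis. (u - l) \<bullet> b)"
    by (simp add: swap23_Basis_image prod_ennreal)
qed simp

lemma nn_integral_swap23:
  assumes [measurable]: "f \<in> borel_measurable borel"
  shows "(\<integral>\<^sup>+z. f (swap23 z) \<partial>lborel) = (\<integral>\<^sup>+z. f z \<partial>lborel)"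
  by (subst distr_swap23[symmetric]) (simp add: nn_integral_distr)

lemma
  fixes f :: "_ \<Rightarrow> 'b::{banach,second_countable_topology}"
  assumes [measurable]: "f \<in> borel_measurable borel"
  shows integral_swap23: "(\<integral>z. f (swap23 z) \<partial>lborel) = (\<integral>z. f z \<partial>lborel)"
    and integrable_swap23: "integrable lborel (\<lambda>z. f (swap23 z)) \<longleftrightarrow> integrable lborel f"
  using integral_distr[of swap23 lborel borel f] integrable_distr_eq[of swap23 lborel borel f]
  by (simp_all add: distr_swap23)

lemma pderivs_swap23: "pderivs es (\<lambda>z. f (swap23 z)) = (\<lambda>z. pderivs (map swap23 es) f (swap23 z))"
  by (induction es) (auto simp: dderiv_def swap23_add swap23_scaleR)

lemma test_fun_swap23:
  fixes f :: "('a::euclidean_space \<times> 'b::euclidean_space) \<times> 'c::euclidean_space \<Rightarrow> complex"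
  assumes f: "test_fun_on A f"
  shows "test_fun_on (swap23 ` A) (\<lambda>z. f (swap23 z))"
proof -
  have s: "set (map swap23 es) \<subseteq> Basis" if "set es \<subseteq> Basis" for es :: "(('a \<times> 'c) \<times> 'b) list"
    using that swap23_Basis by fastforce
  have "smooth_fun (\<lambda>z. f (swap23 z))"
    unfolding smooth_fun_def pderivs_swap23 swap23_add swap23_scaleR
  proof (intro allI impI conjI ballI)
    fix es :: "(('a \<times> 'c) \<times> 'b) list" assume es: "set es \<subseteq> Basis"
    have c: "continuous_on UNIV (pderivs (map swap23 es) f)"
      and d: "\<forall>e\<in>Basis. \<forall>x. (\<lambda>r::real. pderivs (map swap23 es) f (x + r *\<^sub>R e)) differentiable (at 0)"
      using f s[OF es] unfolding test_fun_on_def smooth_fun_def by blast+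
    show "continuous_on UNIV (\<lambda>z. pderivs (map swap23 es) f (swap23 z))"
      by (rule continuous_on_compose2[OF c continuous_swap23]) auto
    show "(\<lambda>r::real. pderivs (map swap23 es) f (swap23 x + r *\<^sub>R swap23 e)) differentiable (at 0)" if "e \<in> Basis" for e x
      using d swap23_Basis[OF that] by blast
  qed
  moreover have sub: "tsupport (\<lambda>z. f (swap23 z)) \<subseteq> swap23 ` tsupport f"
    unfolding tsupport_def[of "\<lambda>z. f (swap23 z)"]
  proof (rule closure_minimal)
    show "{z. f (swap23 z) \<noteq> 0} \<subseteq> swap23 ` tsupport f"
      using not_in_tsupport[of _ f] by (metis (mono_tags, lifting) image_eqI mem_Collect_eq subsetI swap23_swap23)
    show "closed (swap23 ` tsupport f)"
      using f by (intro compact_imp_closed compact_continuous_image continuous_swap23) (auto simp: test_fun_on_def)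
  qed
  moreover have "compact (tsupport (\<lambda>z. f (swap23 z)))"
  proof -
    have "compact (swap23 ` tsupport f \<inter> tsupport (\<lambda>z. f (swap23 z)))"
      using f by (intro compact_Int_closed compact_continuous_image continuous_swap23)
        (auto simp: test_fun_on_def tsupport_def[of "\<lambda>z. f (swap23 z)"])
    then show ?thesis using sub by (simp add: Int_absorb1)
  qed
  ultimately show ?thesis
    using f unfolding test_fun_on_def by (meson image_mono subset_trans)
qed

lemma ft_swap23:
  assumes [measurable]: "f \<in> borel_measurable borel"
  shows "ft (\<lambda>z. f (swap23 z)) \<zeta> = ft f (swap23 \<zeta>)"
proof -
  have "ft (\<lambda>z. f (swap23 z)) \<zeta> = (\<integral>z. cis (- (swap23 \<zeta> \<bullet> swap23 z)) * f (swap23 z) \<partial>lborel)"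
    by (simp add: ft_def inner_swap23)
  also have "\<dots> = ft f (swap23 \<zeta>)"
    unfolding ft_def by (rule integral_swap23[where f = "\<lambda>z. cis (- (swap23 \<zeta> \<bullet> z)) * f z"]) measurable
  finally show ?thesis .
qed

section \<open>Slicing product integrals and the parabolic change of variables\<close>

lemma nn_integral_lborel_pair:
  fixes f :: "'a::euclidean_space \<times> 'b::euclidean_space \<Rightarrow> ennreal"
  assumes "f \<in> borel_measurable borel"
  shows "(\<integral>\<^sup>+w. f w \<partial>lborel) = (\<integral>\<^sup>+x. \<integral>\<^sup>+y. f (x, y) \<partial>lborel \<partial>lborel)"
  using lborel.nn_integral_fst[of f lborel] assms by (simp add: lborel_prod)

lemma integral_lborel_pair:
  fixes f :: "'a::euclidean_space \<times> 'b::euclidean_space \<Rightarrow> 'c::{banach,second_countable_topology}"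
  assumes "integrable lborel f"
  shows "(\<integral>w. f w \<partial>lborel) = (\<integral>x. \<integral>y. f (x, y) \<partial>lborel \<partial>lborel)"
  using lborel_pair.integral_fst[of "\<lambda>x y. f (x, y)"] assms by (simp add: lborel_prod)

lemma integral_lborel_pair_snd:
  fixes f :: "'a::euclidean_space \<times> 'b::euclidean_space \<Rightarrow> 'c::{banach,second_countable_topology}"
  assumes "integrable lborel f"
  shows "(\<integral>w. f w \<partial>lborel) = (\<integral>y. \<integral>x. f (x, y) \<partial>lborel \<partial>lborel)"
  using lborel_pair.integral_snd[of "\<lambda>x y. f (x, y)"] assms by (simp add: lborel_prod)

text \<open>For fixed \<xi> this is the squaring substitution \<mu> = \<eta> * \<eta> followed by
  the affine reflection \<tau> = - |\<xi>|^2 - \<mu>. As an identity of measures it yields both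
  \<open>nn_integral_par\<close> and \<open>integral_par\<close>.\<close>

lemma distr_parabolic:
  "distr (density lborel (\<lambda>p. ennreal (2 * snd p) * indicator {0..} (snd p))) borel
      (\<lambda>p::(real^'m) \<times> real. (fst p, - (norm (fst p))\<^sup>2 - (snd p)\<^sup>2))
    = density lborel (\<lambda>w. indicator {..0} (symb w))" (is "distr ?D borel ?T = ?N")
proof (rule measure_eqI)
  have [measurable]: "?T \<in> borel \<rightarrow>\<^sub>M borel"
    by (auto intro!: borel_measurable_continuous_onI continuous_intros)
  have [measurable]: "(\<lambda>x. (\<xi>, x)) \<in> borel \<rightarrow>\<^sub>M borel" for \<xi> :: "real^'m"
    by (auto intro!: borel_measurable_continuous_onI continuous_intros)
  show "sets (distr ?D borel ?T) = sets ?N" by simp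
  fix A assume "A \<in> sets (distr ?D borel ?T)"
  then have [measurable]: "A \<in> sets borel" by simp
  have "emeasure (distr ?D borel ?T) A = (\<integral>\<^sup>+p. ennreal (2 * snd p) * indicator {0..} (snd p) * indicator A (?T p) \<partial>lborel)"
    by (subst nn_integral_indicator[symmetric], simp) (simp add: nn_integral_distr nn_integral_density del: nn_integral_indicator)
  also have "\<dots> = (\<integral>\<^sup>+\<xi>. \<integral>\<^sup>+\<eta>. ennreal (2 * \<eta>) * indicator {0..} \<eta> * indicator A (\<xi>, - (norm \<xi>)\<^sup>2 - \<eta>\<^sup>2) \<partial>lborel \<partial>lborel)"
    by (subst nn_integral_lborel_pair) simp_all
  also have "\<dots> = (\<integral>\<^sup>+\<xi>. \<integral>\<^sup>+\<tau>. indicator {..0} (\<tau> + (norm \<xi>)\<^sup>2) * indicator A (\<xi>, \<tau>) \<partial>lborel \<partial>lborel)"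
  proof (rule nn_integral_cong)
    fix \<xi> :: "real^'m"
    have "(\<integral>\<^sup>+\<eta>. ennreal (2 * \<eta>) * indicator {0..} \<eta> * indicator A (\<xi>, - (norm \<xi>)\<^sup>2 - \<eta>\<^sup>2) \<partial>lborel)
      = (\<integral>\<^sup>+\<mu>. indicator {0..} \<mu> * indicator A (\<xi>, - (norm \<xi>)\<^sup>2 - \<mu>) \<partial>lborel)"
      by (rule nn_integral_square[where f = "\<lambda>\<mu>. indicator A (\<xi>, - (norm \<xi>)\<^sup>2 - \<mu>)"]) measurable
    also have "\<dots> = (\<integral>\<^sup>+\<tau>. indicator {0..} (- (norm \<xi>)\<^sup>2 + -1 * \<tau>) * indicator A (\<xi>, - (norm \<xi>)\<^sup>2 - (- (norm \<xi>)\<^sup>2 + -1 * \<tau>)) \<partial>lborel)"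
      by (subst nn_integral_real_affine[where c = "-1" and t = "- (norm \<xi>)\<^sup>2"]) auto
    also have "\<dots> = (\<integral>\<^sup>+\<tau>. indicator {..0} (\<tau> + (norm \<xi>)\<^sup>2) * indicator A (\<xi>, \<tau>) \<partial>lborel)"
      by (intro nn_integral_cong) (auto simp: indicator_def)
    finally show "(\<integral>\<^sup>+\<eta>. ennreal (2 * \<eta>) * indicator {0..} \<eta> * indicator A (\<xi>, - (norm \<xi>)\<^sup>2 - \<eta>\<^sup>2) \<partial>lborel)
      = (\<integral>\<^sup>+\<tau>. indicator {..0} (\<tau> + (norm \<xi>)\<^sup>2) * indicator A (\<xi>, \<tau>) \<partial>lborel)" .
  qed
  also have "\<dots> = (\<integral>\<^sup>+w. indicator {..0} (symb w) * indicator A w \<partial>lborel)"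
    by (subst nn_integral_lborel_pair) simp_all
  also have "\<dots> = emeasure ?N A"
    by (simp add: emeasure_density)
  finally show "emeasure (distr ?D borel ?T) A = emeasure ?N A" .
qed

lemma ft_rescale:
  assumes r: "0 < r"
  shows "ft (\<lambda>x. g (r * x)) \<eta> = of_real (1 / r) * ft g (\<eta> / r)"
proof -
  have "ft g (\<eta> / r) = \<bar>r\<bar> *\<^sub>R (\<integral>x. cis (- (\<eta> / r * (0 + r * x))) * g (0 + r * x) \<partial>lborel)"
    unfolding ft_def inner_real_def by (rule lborel_integral_real_affine) (use r in auto)
  then show ?thesis using r by (simp add: ft_def scaleR_conv_of_real)
qed

lemma ft_modulate: "ft (\<lambda>t. g t * cis (\<tau> * t)) \<sigma> = ft g (\<sigma> - \<tau>)"
  unfolding ft_def inner_real_def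
  by (intro Bochner_Integration.integral_cong refl) (simp add: mult.left_commute[of _ "g _"] cis_mult left_diff_distrib)

lemma ft_st_eq_ft:
  fixes u :: "((real^'m) \<times> real) \<times> real \<Rightarrow> complex"
  shows "ft_st u = ft u"
proof
  fix \<zeta> :: "((real^'m) \<times> real) \<times> real"
  have "\<zeta> \<bullet> z = fst \<zeta> \<bullet> fst z + snd \<zeta> * snd z" for z
    unfolding inner_prod_def[of \<zeta> z] by simp
  then show "ft_st u \<zeta> = ft u \<zeta>"
    unfolding ft_st_def ft_conv_exp by (simp add: algebra_simps)
qed

text \<open>A free Schroedinger wave of spatial frequency \<open>p = (\<xi>, \<eta>)\<close> has boundary frequency \<open>par p\<close>.\<close>

definition par :: "(real^'m) \<times> real \<Rightarrow> (real^'m) \<times> real" where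
  "par p = (fst p, - (norm (fst p))\<^sup>2 - (snd p)\<^sup>2)"

lemma measurable_par[measurable]: "par \<in> borel \<rightarrow>\<^sub>M borel"
  unfolding par_def by (intro borel_measurable_continuous_onI continuous_intros)

lemma symb_par: "symb (par p) = - (snd p)\<^sup>2"
  by (simp add: par_def)

lemma fst_par: "fst (par p) = fst p"
  by (simp add: par_def)

lemma nn_integral_par:
  assumes [measurable]: "f \<in> borel_measurable borel"
  shows "(\<integral>\<^sup>+p. ennreal (2 * snd p * indicator {0..} (snd p)) * f (par p) \<partial>lborel) = (\<integral>\<^sup>+w. indicator {..0} (symb w) * f w \<partial>lborel)"
proof -
  have e: "ennreal (2 * r * indicator {0..} r) = ennreal (2 * r) * indicator {0..} r" for r :: real
    by (auto simp: indicator_def)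
  have "(\<integral>\<^sup>+w. f w \<partial>distr (density lborel (\<lambda>p. ennreal (2 * snd p) * indicator {0..} (snd p))) borel par)
     = (\<integral>\<^sup>+p. ennreal (2 * snd p * indicator {0..} (snd p)) * f (par p) \<partial>lborel)"
    by (simp add: nn_integral_distr nn_integral_density e)
  then show ?thesis
    unfolding par_def[abs_def] distr_parabolic by (simp add: nn_integral_density)
qed

lemma integral_par:
  fixes f :: "(real^'m) \<times> real \<Rightarrow> complex"
  assumes [measurable]: "f \<in> borel_measurable borel"
  shows "(\<integral>p. (2 * snd p * indicator {0..} (snd p)) *\<^sub>R f (par p) \<partial>lborel) = (\<integral>w. indicator {..0} (symb w) *\<^sub>R f w \<partial>lborel)"
proof -
  have e: "ennreal (2 * r) * indicator {0..} r = ennreal (2 * r * indicator {0..} r)" for r :: real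
    by (auto simp: indicator_def)
  have e': "(indicator {..0} (symb w) :: ennreal) = ennreal (indicator {..0} (symb w))" for w :: "(real^'m) \<times> real"
    by (auto simp: indicator_def)
  have "(\<integral>w. f w \<partial>distr (density lborel (\<lambda>p. ennreal (2 * snd p) * indicator {0..} (snd p))) borel par)
     = (\<integral>p. (2 * snd p * indicator {0..} (snd p)) *\<^sub>R f (par p) \<partial>lborel)"
    unfolding e by (subst integral_distr, simp, simp, subst integral_density) (auto simp: indicator_def)
  moreover have "(\<integral>w. f w \<partial>density lborel (\<lambda>w. indicator {..0} (symb w))) = (\<integral>w. indicator {..0} (symb w) *\<^sub>R f w \<partial>lborel)"
    unfolding e' by (subst integral_density) auto
  ultimately show ?thesis
    unfolding par_def[abs_def] distr_parabolic by simp
qed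

text \<open>The mode \<open>exp (- sqrt \<mu> x)\<close> with \<open>\<mu> > 0\<close> is continued to \<open>x \<le> 0\<close> as \<open>g (sqrt \<mu> x)\<close>, and the free waves with
  \<open>\<mu> \<le> 0\<close> are multiplied by \<open>\<psi> t\<close>; here \<open>g x = exp (- x)\<close> for \<open>x > 0\<close> and \<open>\<psi> = 1\<close> on \<open>(0, 2)\<close>.
  In \<open>ext_real\<close> the factor \<open>2 \<eta>\<close> is the Jacobian of \<open>\<mu> = - \<eta>\<^sup>2\<close>.\<close>

definition ext_imag_kernel :: "(real \<Rightarrow> complex) \<Rightarrow> ((real^'m) \<times> real \<Rightarrow> complex) \<Rightarrow> ((real^'m) \<times> real) \<times> real \<Rightarrow> complex" where
  "ext_imag_kernel g h z = (if 0 < symb (fst z)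
     then ft h (fst z) * (of_real (1 / sqrt (symb (fst z))) * ft g (snd z / sqrt (symb (fst z)))) else 0)"

definition ext_imag :: "(real \<Rightarrow> complex) \<Rightarrow> ((real^'m) \<times> real \<Rightarrow> complex) \<Rightarrow> ((real^'m) \<times> real) \<times> real \<Rightarrow> complex" where
  "ext_imag g h \<zeta> = ext_imag_kernel g h (swap23 \<zeta>)"

definition ext_real :: "(real \<Rightarrow> complex) \<Rightarrow> ((real^'m) \<times> real \<Rightarrow> complex) \<Rightarrow> ((real^'m) \<times> real) \<times> real \<Rightarrow> complex" where
  "ext_real \<psi> h \<zeta> = (2 * snd (fst \<zeta>) * indicator {0..} (snd (fst \<zeta>))) *\<^sub>R
     (ft h (par (fst \<zeta>)) * ft \<psi> (snd \<zeta> - snd (par (fst \<zeta>))))"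

lemma measurable_ext_imag_kernel[measurable]:
  assumes [measurable]: "g \<in> borel_measurable borel" "h \<in> borel_measurable borel"
  shows "ext_imag_kernel g h \<in> borel_measurable borel"
  unfolding ext_imag_kernel_def[abs_def] by measurable

lemma measurable_ext_imag[measurable]:
  assumes [measurable]: "g \<in> borel_measurable borel" "h \<in> borel_measurable borel"
  shows "ext_imag g h \<in> borel_measurable borel"
  unfolding ext_imag_def[abs_def] by measurable

lemma measurable_ext_real[measurable]:
  assumes [measurable]: "\<psi> \<in> borel_measurable borel" "h \<in> borel_measurable borel"
  shows "ext_real \<psi> h \<in> borel_measurable borel"
  unfolding ext_real_def[abs_def] by measurable

section \<open>Modes as functionals on test functions\<close>

definition phase_st :: "(real^'m) \<times> real \<Rightarrow> ((real^'m) \<times> real) \<times> real \<Rightarrow> complex" where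
  "phase_st w z = phase w (fst (fst z)) (snd (fst z)) (snd z)"

text \<open>The single mode \<open>w\<close> tested against \<phi>. Both \<open>vsol\<close> and its
  extension reduce to integrals of this against \<open>ft h\<close>, which is how they are
  compared.\<close>

definition pairing :: "(((real^'m) \<times> real) \<times> real \<Rightarrow> complex) \<Rightarrow> (real^'m) \<times> real \<Rightarrow> complex" where
  "pairing \<phi> w = (\<integral>z. exp (phase_st w z) * \<phi> z \<partial>lborel)"

lemma measurable_phase_st[measurable]:
  "(\<lambda>p. phase_st (fst p) (snd p)) \<in> borel_measurable borel"
  unfolding phase_st_def phase_def by measurable

lemma measurable_phase_st'[measurable]: "phase_st w \<in> borel_measurable borel"
  unfolding phase_st_def phase_def by measurable

lemma test_fun_Omega_support:
  "test_fun_on Omega \<phi> \<Longrightarrow> \<phi> z \<noteq> 0 \<Longrightarrow> 0 < snd (fst z) \<and> 0 < snd z \<and> snd z < 2"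
  using not_in_tsupport[of z \<phi>] by (auto simp: test_fun_on_def Omega_def)

text \<open>Decaying modes blow up as x_n tends to minus infinity; the support of \<phi> excludes
  that side.\<close>

lemma norm_exp_phase_st_mult:
  assumes "test_fun_on Omega \<phi>"
  shows "norm (exp (phase_st w z) * \<phi> z) \<le> norm (\<phi> z)"
proof (cases "\<phi> z = 0")
  case False
  then have "0 \<le> snd (fst z)" using test_fun_Omega_support[OF assms, of z] by simp
  then have "norm (exp (phase_st w z)) \<le> 1" unfolding phase_st_def by (rule norm_exp_phase)
  then show ?thesis by (simp add: norm_mult mult_left_le_one_le del: norm_exp_eq_Re)
qed simp

text \<open>On the support of \<phi> one has x_n > 0, so exp (- r x_n) may be replaced by g (r x_n),
  whatever \<open>g\<close> is on the other side. Integrating out the plane wave in (x', t) leaves a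
  one-dimensional integral, and Parseval in x_n moves it to frequency.\<close>

lemma pairing_imag:
  fixes \<phi> :: "((real^'m) \<times> real) \<times> real \<Rightarrow> complex"
  assumes \<phi>: "test_fun_on Omega \<phi>" and g: "integrable lborel g" "\<And>x. 0 < x \<Longrightarrow> g x = of_real (exp (- x))"
    and w: "0 < symb w"
  shows "2 * pi * pairing \<phi> w = (\<integral>\<eta>. of_real (1 / sqrt (symb w)) * ft g (\<eta> / sqrt (symb w)) * ft \<phi> (- ((fst w, \<eta>), snd w)) \<partial>lborel)"
proof -
  have [measurable]: "\<phi> \<in> borel_measurable borel" using \<phi> by (rule test_fun_measurable)
  define r where "r = sqrt (symb w)"
  have r: "0 < r" using w by (simp add: r_def)
  define \<phi>' where "\<phi>' z = \<phi> (swap23 z)" for z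
  have \<phi>': "test_fun_on (swap23 ` Omega) \<phi>'" unfolding \<phi>'_def by (rule test_fun_swap23[OF \<phi>])
  have [measurable]: "\<phi>' \<in> borel_measurable borel" using \<phi>' by (rule test_fun_measurable)
  have [measurable]: "g \<in> borel_measurable borel" using g(1) by auto
  have gr: "integrable lborel (\<lambda>x. g (r * x))"
    using lborel_integrable_real_affine[OF g(1), of r 0] r by simp
  have i: "integrable lborel (\<lambda>z. exp (phase_st w (swap23 z)) * \<phi>' z)"
    by (rule integrable_pointwise_bound[OF integrable_test_fun[OF \<phi>']])
       (use norm_exp_phase_st_mult[OF \<phi>] in \<open>auto simp: \<phi>'_def\<close>)
  have "pairing \<phi> w = (\<integral>z. exp (phase_st w (swap23 z)) * \<phi>' z \<partial>lborel)"
    unfolding pairing_def \<phi>'_def by (rule integral_swap23[symmetric]) measurable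
  also have "\<dots> = (\<integral>x. \<integral>y. exp (phase_st w (swap23 (y, x))) * \<phi>' (y, x) \<partial>lborel \<partial>lborel)"
    by (rule integral_lborel_pair_snd[OF i])
  also have "\<dots> = (\<integral>x. g (r * x) * partial_ft \<phi>' (- w) x \<partial>lborel)"
  proof (intro Bochner_Integration.integral_cong refl)
    fix x :: real
    show "(\<integral>y. exp (phase_st w (swap23 (y, x))) * \<phi>' (y, x) \<partial>lborel) = g (r * x) * partial_ft \<phi>' (- w) x"
    proof (cases "0 < x")
      case True
      have "exp (phase_st w (swap23 (y, x))) = g (r * x) * cis (w \<bullet> y)" for y
      proof -
        have "kap (symb w) = of_real r" using w by (simp add: kap_def r_def)
        then have "phase_st w (swap23 (y, x)) = of_real (- (r * x)) + \<i> * of_real (w \<bullet> y)"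
          by (cases y) (simp add: phase_st_def phase_def inner_prod_def algebra_simps)
        moreover have "g (r * x) = exp (of_real (- (r * x)))"
          unfolding exp_of_real by (rule g(2)) (use True r in simp)
        ultimately show ?thesis by (simp only: exp_add cis_conv_exp)
      qed
      then show ?thesis by (simp add: partial_ft_def mult.assoc)
    next
      case False
      then have "\<phi>' (y, x) = 0" for y
        using test_fun_Omega_support[OF \<phi>, of "swap23 (y, x)"] by (cases y) (auto simp: \<phi>'_def)
      then show ?thesis by (simp add: partial_ft_def)
    qed
  qed
  finally have "2 * pi * pairing \<phi> w = 2 * pi * (\<integral>x. g (r * x) * partial_ft \<phi>' (- w) x \<partial>lborel)"
    by simp
  also have "\<dots> = (\<integral>\<eta>. ft (\<lambda>x. g (r * x)) \<eta> * ft \<phi>' (- w, - \<eta>) \<partial>lborel)"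
    by (rule parseval_partial_ft[OF \<phi>' gr, symmetric])
  finally have *: "2 * pi * pairing \<phi> w = (\<integral>\<eta>. ft (\<lambda>x. g (r * x)) \<eta> * ft \<phi>' (- w, - \<eta>) \<partial>lborel)" .
  have "ft \<phi>' (- w, - \<eta>) = ft \<phi> (- ((fst w, \<eta>), snd w))" for \<eta>
    unfolding \<phi>'_def by (subst ft_swap23) (auto simp: swap23_def)
  then show ?thesis
    unfolding * r_def[symmetric] by (simp only: ft_rescale[OF r])
qed

text \<open>On the support of \<phi> the factor \<psi> t is 1 and can be inserted freely. The plane
  wave in space becomes a partial transform of \<phi>, and Parseval in time concentrates the result
  around \<tau> = \<open>snd w\<close>.\<close>

lemma pairing_real:
  fixes \<phi> :: "((real^'m) \<times> real) \<times> real \<Rightarrow> complex"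
  assumes \<phi>: "test_fun_on Omega \<phi>" and \<psi>: "integrable lborel \<psi>" "\<And>t. 0 < t \<Longrightarrow> t < 2 \<Longrightarrow> \<psi> t = 1"
    and w: "symb w \<le> 0"
  shows "2 * pi * pairing \<phi> w = (\<integral>\<tau>. ft \<psi> (\<tau> - snd w) * ft \<phi> (- ((fst w, sqrt (- symb w)), \<tau>)) \<partial>lborel)"
proof -
  have [measurable]: "\<phi> \<in> borel_measurable borel" using \<phi> by (rule test_fun_measurable)
  define r where "r = sqrt (- symb w)"
  let ?\<psi> = "\<lambda>t. \<psi> t * cis (snd w * t)"
  have \<psi>': "integrable lborel ?\<psi>"
    by (subst mult.commute, rule integrable_cis_mult[OF \<psi>(1)]) auto
  have i: "integrable lborel (\<lambda>z. exp (phase_st w z) * \<phi> z)"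
    by (rule integrable_pointwise_bound[OF integrable_test_fun[OF \<phi>]])
       (use norm_exp_phase_st_mult[OF \<phi>] in auto)
  have k: "kap (symb w) = - \<i> * of_real r"
    using w by (cases "symb w = 0") (auto simp: kap_def r_def)
  have "pairing \<phi> w = (\<integral>t. \<integral>y. exp (phase_st w (y, t)) * \<phi> (y, t) \<partial>lborel \<partial>lborel)"
    unfolding pairing_def by (rule integral_lborel_pair_snd[OF i])
  also have "\<dots> = (\<integral>t. ?\<psi> t * partial_ft \<phi> (- (fst w, r)) t \<partial>lborel)"
  proof (intro Bochner_Integration.integral_cong refl)
    fix t :: real
    have "exp (phase_st w (y, t)) * \<phi> (y, t) = ?\<psi> t * (cis (- (- (fst w, r) \<bullet> y)) * \<phi> (y, t))" for y
    proof (cases "\<phi> (y, t) = 0")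
      case False
      then have "\<psi> t = 1" using test_fun_Omega_support[OF \<phi>, of "(y, t)"] \<psi>(2) by auto
      moreover have "phase_st w (y, t) = \<i> * of_real (snd w * t) + \<i> * of_real (- (- (fst w, r) \<bullet> y))"
        by (cases y) (simp add: phase_st_def phase_def k inner_prod_def algebra_simps)
      ultimately show ?thesis by (simp only: exp_add cis_conv_exp mult_1 mult.assoc)
    qed simp
    then show "(\<integral>y. exp (phase_st w (y, t)) * \<phi> (y, t) \<partial>lborel) = ?\<psi> t * partial_ft \<phi> (- (fst w, r)) t"
      unfolding partial_ft_def by (simp only: integral_mult_right_zero)
  qed
  finally have "2 * pi * pairing \<phi> w = 2 * pi * (\<integral>t. ?\<psi> t * partial_ft \<phi> (- (fst w, r)) t \<partial>lborel)"
    by simp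
  also have "\<dots> = (\<integral>\<tau>. ft ?\<psi> \<tau> * ft \<phi> (- (fst w, r), - \<tau>) \<partial>lborel)"
    by (rule parseval_partial_ft[OF \<phi> \<psi>', symmetric])
  finally show ?thesis
    by (simp add: ft_modulate r_def)
qed

lemma integrableI_nn_le:
  fixes f :: "'a \<Rightarrow> 'b::{banach,second_countable_topology}"
  assumes "f \<in> borel_measurable M" "(\<integral>\<^sup>+x. ennreal (norm (f x)) \<partial>M) \<le> C" "C < \<infinity>"
  shows "integrable M f"
  using assms by (intro integrableI_bounded) (auto intro: le_less_trans)

text \<open>The L1 norm in \<eta> of (1 / r) ft g (\<eta> / r) does not depend on r, so absolute
  convergence holds uniformly up to \<mu> = 0 and Fubini applies.\<close>

lemma ext_imag_pairing:
  fixes \<phi> :: "((real^'m) \<times> real) \<times> real \<Rightarrow> complex"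
  assumes h: "test_fun_on A h" and \<phi>: "test_fun_on Omega \<phi>"
    and g: "integrable lborel g" "\<And>x. 0 < x \<Longrightarrow> g x = of_real (exp (- x))" "integrable lborel (ft g)"
  shows "integrable lborel (\<lambda>\<zeta>. ext_imag g h \<zeta> * ft \<phi> (- \<zeta>))"
    and "(\<integral>\<zeta>. ext_imag g h \<zeta> * ft \<phi> (- \<zeta>) \<partial>lborel) = (\<integral>w. indicator {0<..} (symb w) *\<^sub>R (ft h w * (2 * pi * pairing \<phi> w)) \<partial>lborel)"
proof -
  have [measurable]: "\<phi> \<in> borel_measurable borel" using \<phi> by (rule test_fun_measurable)
  have [measurable]: "h \<in> borel_measurable borel" using h by (rule test_fun_measurable)
  have [measurable]: "g \<in> borel_measurable borel" using g(1) by auto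
  define B where "B = (\<integral>z. norm (\<phi> z) \<partial>lborel)"
  have B: "norm (ft \<phi> \<zeta>) \<le> B" for \<zeta> unfolding B_def by (rule norm_ft_le)
  have B0: "0 \<le> B" by (simp add: B_def)
  define J where "J = (\<integral>\<^sup>+y. ennreal (norm (ft g y)) \<partial>lborel)"
  have J: "J < \<infinity>" using g(3) unfolding J_def integrable_iff_bounded by simp
  let ?G = "\<lambda>z. ext_imag_kernel g h z * ft \<phi> (- swap23 z)"
  have "(\<integral>\<^sup>+z. ennreal (norm (?G z)) \<partial>lborel) = (\<integral>\<^sup>+w. \<integral>\<^sup>+\<eta>. ennreal (norm (?G (w, \<eta>))) \<partial>lborel \<partial>lborel)"
    by (rule nn_integral_lborel_pair) measurable
  also have "\<dots> \<le> (\<integral>\<^sup>+w. ennreal (norm (ft h w)) * (ennreal B * J) \<partial>lborel)"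
  proof (rule nn_integral_mono)
    fix w :: "(real^'m) \<times> real"
    show "(\<integral>\<^sup>+\<eta>. ennreal (norm (?G (w, \<eta>))) \<partial>lborel) \<le> ennreal (norm (ft h w)) * (ennreal B * J)"
    proof (cases "0 < symb w")
      case True
      define r where "r = sqrt (symb w)"
      have r: "0 < r" using True by (simp add: r_def)
      have "(\<integral>\<^sup>+\<eta>. ennreal (norm (?G (w, \<eta>))) \<partial>lborel)
        \<le> (\<integral>\<^sup>+\<eta>. ennreal (norm (ft h w)) * (ennreal B * (ennreal (1 / r) * ennreal (norm (ft g (\<eta> / r))))) \<partial>lborel)"
      proof (rule nn_integral_mono)
        fix \<eta> :: real
        have "norm (?G (w, \<eta>)) = norm (ft h w) * (norm (ft \<phi> (- swap23 (w, \<eta>))) * ((1 / r) * norm (ft g (\<eta> / r))))"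
          using True r by (simp add: ext_imag_kernel_def norm_mult norm_divide r_def)
        also have "\<dots> \<le> norm (ft h w) * (B * ((1 / r) * norm (ft g (\<eta> / r))))"
          using r by (intro mult_left_mono mult_right_mono B) auto
        finally show "ennreal (norm (?G (w, \<eta>))) \<le> ennreal (norm (ft h w)) * (ennreal B * (ennreal (1 / r) * ennreal (norm (ft g (\<eta> / r)))))"
          using r B0 by (simp add: ennreal_mult[symmetric] ennreal_leI)
      qed
      also have "\<dots> = ennreal (norm (ft h w)) * (ennreal B * (ennreal (1 / r) * (\<integral>\<^sup>+\<eta>. ennreal (norm (ft g (\<eta> / r))) \<partial>lborel)))"
        by (simp add: nn_integral_cmult)
      also have "ennreal (1 / r) * (\<integral>\<^sup>+\<eta>. ennreal (norm (ft g (\<eta> / r))) \<partial>lborel) = J"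
        unfolding J_def using r
        by (subst nn_integral_real_affine[where c = "1 / r" and t = 0]) auto
      finally show ?thesis .
    qed (simp add: ext_imag_kernel_def)
  qed
  also have "\<dots> = (\<integral>\<^sup>+w. ennreal (norm (ft h w)) \<partial>lborel) * (ennreal B * J)"
    by (rule nn_integral_multc) measurable
  finally have iG: "integrable lborel ?G"
    by (rule integrableI_nn_le[rotated])
       (use J integrable_ft_0[OF h] in \<open>auto simp: ennreal_mult_less_top integrable_iff_bounded\<close>)
  have eq: "ext_imag g h \<zeta> * ft \<phi> (- \<zeta>) = ?G (swap23 \<zeta>)" for \<zeta>
    by (simp add: ext_imag_def)
  show "integrable lborel (\<lambda>\<zeta>. ext_imag g h \<zeta> * ft \<phi> (- \<zeta>))"
    unfolding eq using iG by (subst integrable_swap23) auto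
  have "(\<integral>\<zeta>. ext_imag g h \<zeta> * ft \<phi> (- \<zeta>) \<partial>lborel) = (\<integral>z. ?G z \<partial>lborel)"
    unfolding eq by (rule integral_swap23) measurable
  also have "\<dots> = (\<integral>w. \<integral>\<eta>. ?G (w, \<eta>) \<partial>lborel \<partial>lborel)"
    by (rule integral_lborel_pair[OF iG])
  also have "\<dots> = (\<integral>w. indicator {0<..} (symb w) *\<^sub>R (ft h w * (2 * pi * pairing \<phi> w)) \<partial>lborel)"
  proof (intro Bochner_Integration.integral_cong refl)
    fix w :: "(real^'m) \<times> real"
    show "(\<integral>\<eta>. ?G (w, \<eta>) \<partial>lborel) = indicator {0<..} (symb w) *\<^sub>R (ft h w * (2 * pi * pairing \<phi> w))"
    proof (cases "0 < symb w")
      case True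
      have "(\<integral>\<eta>. ?G (w, \<eta>) \<partial>lborel)
        = (\<integral>\<eta>. ft h w * (of_real (1 / sqrt (symb w)) * ft g (\<eta> / sqrt (symb w)) * ft \<phi> (- ((fst w, \<eta>), snd w))) \<partial>lborel)"
        using True by (intro Bochner_Integration.integral_cong refl) (simp add: ext_imag_kernel_def swap23_def)
      also have "\<dots> = ft h w * (2 * pi * pairing \<phi> w)"
        by (simp only: integral_mult_right_zero pairing_imag[OF \<phi> g(1,2) True])
      finally show ?thesis using True by simp
    qed (simp add: ext_imag_kernel_def)
  qed
  finally show "(\<integral>\<zeta>. ext_imag g h \<zeta> * ft \<phi> (- \<zeta>) \<partial>lborel) = (\<integral>w. indicator {0<..} (symb w) *\<^sub>R (ft h w * (2 * pi * pairing \<phi> w)) \<partial>lborel)" .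
qed

lemma measurable_pairing[measurable]:
  assumes [measurable]: "\<phi> \<in> borel_measurable borel"
  shows "pairing \<phi> \<in> borel_measurable borel"
proof -
  have "(\<lambda>p. exp (phase_st (fst p) (snd p)) * \<phi> (snd p)) \<in> borel_measurable borel"
    by measurable
  then have "(\<lambda>(w, z). exp (phase_st w z) * \<phi> z) \<in> borel_measurable (lborel \<Otimes>\<^sub>M lborel)"
    by (simp add: lborel_prod case_prod_unfold)
  from lborel.borel_measurable_lebesgue_integral[OF this] show ?thesis
    unfolding pairing_def[abs_def] by simp
qed

text \<open>Translation in \<tau> replaces the rescaling: the L1 norm of \<open>ft \<psi>\<close> is
  the same around every point of the paraboloid, and the Jacobian \<open>q\<close> turns integrals
  over p into integrals over boundary frequencies.\<close>

lemma ext_real_pairing: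
  fixes \<phi> :: "((real^'m) \<times> real) \<times> real \<Rightarrow> complex"
  assumes h: "test_fun_on A h" and \<phi>: "test_fun_on Omega \<phi>"
    and \<psi>: "integrable lborel \<psi>" "\<And>t. 0 < t \<Longrightarrow> t < 2 \<Longrightarrow> \<psi> t = 1" "integrable lborel (ft \<psi>)"
  shows "integrable lborel (\<lambda>\<zeta>. ext_real \<psi> h \<zeta> * ft \<phi> (- \<zeta>))"
    and "(\<integral>\<zeta>. ext_real \<psi> h \<zeta> * ft \<phi> (- \<zeta>) \<partial>lborel) = (\<integral>w. indicator {..0} (symb w) *\<^sub>R (ft h w * (2 * pi * pairing \<phi> w)) \<partial>lborel)"
proof -
  have [measurable]: "\<phi> \<in> borel_measurable borel" using \<phi> by (rule test_fun_measurable)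
  have [measurable]: "h \<in> borel_measurable borel" using h by (rule test_fun_measurable)
  have [measurable]: "\<psi> \<in> borel_measurable borel" using \<psi>(1) by auto
  define B where "B = (\<integral>z. norm (\<phi> z) \<partial>lborel)"
  have B: "norm (ft \<phi> \<zeta>) \<le> B" for \<zeta> unfolding B_def by (rule norm_ft_le)
  have B0: "0 \<le> B" by (simp add: B_def)
  define J where "J = (\<integral>\<^sup>+y. ennreal (norm (ft \<psi> y)) \<partial>lborel)"
  have J: "J < \<infinity>" using \<psi>(3) unfolding J_def integrable_iff_bounded by simp
  define q where "q p = 2 * snd p * indicator {0..} (snd p)" for p :: "(real^'m) \<times> real"
  have q0: "0 \<le> q p" for p by (auto simp: q_def indicator_def)
  have [measurable]: "q \<in> borel_measurable borel" unfolding q_def[abs_def] by measurable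
  let ?G = "\<lambda>z. ext_real \<psi> h z * ft \<phi> (- z)"
  have "(\<integral>\<^sup>+z. ennreal (norm (?G z)) \<partial>lborel) = (\<integral>\<^sup>+p. \<integral>\<^sup>+\<tau>. ennreal (norm (?G (p, \<tau>))) \<partial>lborel \<partial>lborel)"
    by (rule nn_integral_lborel_pair) measurable
  also have "\<dots> \<le> (\<integral>\<^sup>+p. ennreal (q p) * ennreal (norm (ft h (par p))) * (ennreal B * J) \<partial>lborel)"
  proof (rule nn_integral_mono)
    fix p :: "(real^'m) \<times> real"
    have "(\<integral>\<^sup>+\<tau>. ennreal (norm (?G (p, \<tau>))) \<partial>lborel)
        \<le> (\<integral>\<^sup>+\<tau>. ennreal (q p) * ennreal (norm (ft h (par p))) * (ennreal B * ennreal (norm (ft \<psi> (- snd (par p) + 1 * \<tau>)))) \<partial>lborel)"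
    proof (rule nn_integral_mono)
      fix \<tau> :: real
      have "norm (?G (p, \<tau>)) = q p * norm (ft h (par p)) * (norm (ft \<phi> (- (p, \<tau>))) * norm (ft \<psi> (- snd (par p) + 1 * \<tau>)))"
        using q0[of p] by (simp add: ext_real_def norm_mult q_def)
      also have "\<dots> \<le> q p * norm (ft h (par p)) * (B * norm (ft \<psi> (- snd (par p) + 1 * \<tau>)))"
        using q0[of p] by (intro mult_left_mono mult_right_mono B) auto
      finally show "ennreal (norm (?G (p, \<tau>))) \<le> ennreal (q p) * ennreal (norm (ft h (par p))) * (ennreal B * ennreal (norm (ft \<psi> (- snd (par p) + 1 * \<tau>))))"
        using q0[of p] B0 by (simp add: ennreal_mult[symmetric] ennreal_leI)
    qed
    also have "\<dots> = ennreal (q p) * ennreal (norm (ft h (par p))) * (ennreal B * (\<integral>\<^sup>+\<tau>. ennreal (norm (ft \<psi> (- snd (par p) + 1 * \<tau>))) \<partial>lborel))"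
      by (simp add: nn_integral_cmult)
    also have "(\<integral>\<^sup>+\<tau>. ennreal (norm (ft \<psi> (- snd (par p) + 1 * \<tau>))) \<partial>lborel) = J"
      unfolding J_def by (subst (2) nn_integral_real_affine[where c = 1 and t = "- snd (par p)"]) auto
    finally show "(\<integral>\<^sup>+\<tau>. ennreal (norm (?G (p, \<tau>))) \<partial>lborel) \<le> ennreal (q p) * ennreal (norm (ft h (par p))) * (ennreal B * J)" .
  qed
  also have "\<dots> = (\<integral>\<^sup>+p. ennreal (q p) * ennreal (norm (ft h (par p))) \<partial>lborel) * (ennreal B * J)"
    by (rule nn_integral_multc) measurable
  also have "(\<integral>\<^sup>+p. ennreal (q p) * ennreal (norm (ft h (par p))) \<partial>lborel) = (\<integral>\<^sup>+w. indicator {..0} (symb w) * ennreal (norm (ft h w)) \<partial>lborel)"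
    unfolding q_def by (rule nn_integral_par) measurable
  also have "\<dots> \<le> (\<integral>\<^sup>+w. ennreal (norm (ft h w)) \<partial>lborel)"
    by (rule nn_integral_mono) (auto simp: indicator_def)
  finally have "(\<integral>\<^sup>+z. ennreal (norm (?G z)) \<partial>lborel) \<le> (\<integral>\<^sup>+w. ennreal (norm (ft h w)) \<partial>lborel) * (ennreal B * J)"
    by (simp add: mult_right_mono)
  then show iG: "integrable lborel ?G"
    by (rule integrableI_nn_le[rotated])
       (use J integrable_ft_0[OF h] in \<open>auto simp: ennreal_mult_less_top integrable_iff_bounded\<close>)
  have "(\<integral>z. ?G z \<partial>lborel) = (\<integral>p. \<integral>\<tau>. ?G (p, \<tau>) \<partial>lborel \<partial>lborel)"
    by (rule integral_lborel_pair[OF iG])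
  also have "\<dots> = (\<integral>p. q p *\<^sub>R (ft h (par p) * (2 * pi * pairing \<phi> (par p))) \<partial>lborel)"
  proof (intro Bochner_Integration.integral_cong refl)
    fix p :: "(real^'m) \<times> real"
    show "(\<integral>\<tau>. ?G (p, \<tau>) \<partial>lborel) = q p *\<^sub>R (ft h (par p) * (2 * pi * pairing \<phi> (par p)))"
    proof (cases "0 \<le> snd p")
      case True
      \<comment> \<open>\<open>par\<close> forgets the sign of \<eta>; on the half-space that
        carries \<open>ext_real\<close> it is injective, so the spatial frequency in
        \<open>pairing_real\<close> is \<open>p\<close> again.\<close>
      then have p: "(fst (par p), sqrt (- symb (par p))) = p"
        by (simp only: symb_par) (simp add: fst_par prod_eq_iff)
      have le: "symb (par p) \<le> 0" unfolding symb_par by simp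
      have "(\<integral>\<tau>. ?G (p, \<tau>) \<partial>lborel) = (\<integral>\<tau>. (q p *\<^sub>R ft h (par p)) * (ft \<psi> (\<tau> - snd (par p)) * ft \<phi> (- (p, \<tau>))) \<partial>lborel)"
        by (intro Bochner_Integration.integral_cong refl) (simp add: ext_real_def q_def)
      also have "\<dots> = (q p *\<^sub>R ft h (par p)) * (2 * pi * pairing \<phi> (par p))"
        by (simp only: integral_mult_right_zero pairing_real[OF \<phi> \<psi>(1,2) le] p)
      finally show ?thesis by simp
    qed (simp add: ext_real_def q_def)
  qed
  also have "\<dots> = (\<integral>w. indicator {..0} (symb w) *\<^sub>R (ft h w * (2 * pi * pairing \<phi> w)) \<partial>lborel)"
    unfolding q_def by (rule integral_par) measurable
  finally show "(\<integral>\<zeta>. ?G \<zeta> \<partial>lborel) = (\<integral>w. indicator {..0} (symb w) *\<^sub>R (ft h w * (2 * pi * pairing \<phi> w)) \<partial>lborel)" .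
qed

lemma vsol_pairing:
  fixes \<phi> :: "((real^'m) \<times> real) \<times> real \<Rightarrow> complex"
  assumes h: "test_fun_on A h" and \<phi>: "test_fun_on Omega \<phi>"
  shows "(\<integral>z. vsol_st h z * \<phi> z \<partial>lborel) = (\<integral>w. ft h w * pairing \<phi> w \<partial>lborel) / (2 * pi) ^ (CARD('m) + 1)"
    and "integrable lborel (\<lambda>w. ft h w * pairing \<phi> w)"
proof -
  have [measurable]: "\<phi> \<in> borel_measurable borel" using \<phi> by (rule test_fun_measurable)
  have [measurable]: "h \<in> borel_measurable borel" using h by (rule test_fun_measurable)
  let ?c = "(2 * complex_of_real pi) ^ (CARD('m) + 1)"
  have i: "integrable (lborel \<Otimes>\<^sub>M lborel) (\<lambda>(w, z). ft h w * (exp (phase_st w z) * \<phi> z))"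
  proof (rule integrable_pointwise_bound)
    show "integrable (lborel \<Otimes>\<^sub>M lborel) (\<lambda>(w, z). ft h w * \<phi> z)"
      by (rule integrable_lborel_pair_mult[OF integrable_ft_0[OF h] integrable_test_fun[OF \<phi>]])
    have "(\<lambda>p. ft h (fst p) * (exp (phase_st (fst p) (snd p)) * \<phi> (snd p))) \<in> borel_measurable borel"
      by measurable
    then show "(\<lambda>(w, z). ft h w * (exp (phase_st w z) * \<phi> z)) \<in> borel_measurable (lborel \<Otimes>\<^sub>M lborel)"
      by (simp add: lborel_prod case_prod_unfold)
    show "norm (case p of (w, z) \<Rightarrow> ft h w * (exp (phase_st w z) * \<phi> z)) \<le> norm (case p of (w, z) \<Rightarrow> ft h w * \<phi> z)" for p
      using mult_left_mono[OF norm_exp_phase_st_mult[OF \<phi>, of "fst p" "snd p"], of "norm (ft h (fst p))"]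
      by (simp add: case_prod_unfold norm_mult)
  qed
  show "integrable lborel (\<lambda>w. ft h w * pairing \<phi> w)"
    using lborel_pair.integrable_fst[OF i] by (simp add: pairing_def)
  have "(\<integral>z. vsol_st h z * \<phi> z \<partial>lborel) = (\<integral>z. (\<integral>w. ft h w * (exp (phase_st w z) * \<phi> z) \<partial>lborel) / ?c \<partial>lborel)"
  proof (intro Bochner_Integration.integral_cong refl)
    fix z :: "((real^'m) \<times> real) \<times> real"
    show "vsol_st h z * \<phi> z = (\<integral>w. ft h w * (exp (phase_st w z) * \<phi> z) \<partial>lborel) / ?c"
    proof (cases "\<phi> z = 0")
      case False
      then have "0 \<le> snd (fst z)" using test_fun_Omega_support[OF \<phi>, of z] by simp
      then have "vsol_st h z * \<phi> z = (\<integral>w. ft h w / ?c * exp (phase_st w z) * \<phi> z \<partial>lborel)"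
        unfolding vsol_st_def by (subst vsol_eq[OF h]) (auto simp: phase_st_def)
      also have "\<dots> = (\<integral>w. ft h w * (exp (phase_st w z) * \<phi> z) / ?c \<partial>lborel)"
        by (simp add: field_simps)
      finally show ?thesis by (simp only: integral_divide_zero)
    qed simp
  qed
  also have "\<dots> = (\<integral>z. \<integral>w. ft h w * (exp (phase_st w z) * \<phi> z) \<partial>lborel \<partial>lborel) / ?c"
    by (rule integral_divide_zero)
  also have "(\<integral>z. \<integral>w. ft h w * (exp (phase_st w z) * \<phi> z) \<partial>lborel \<partial>lborel) = (\<integral>w. \<integral>z. ft h w * (exp (phase_st w z) * \<phi> z) \<partial>lborel \<partial>lborel)"
    by (rule lborel_pair.Fubini_integral[OF i])
  also have "\<dots> = (\<integral>w. ft h w * pairing \<phi> w \<partial>lborel)"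
    by (simp add: pairing_def)
  finally show "(\<integral>z. vsol_st h z * \<phi> z \<partial>lborel) = (\<integral>w. ft h w * pairing \<phi> w \<partial>lborel) / (2 * pi) ^ (CARD('m) + 1)"
    by simp
qed

text \<open>The regions \<mu> > 0 and \<mu> \<le> 0 together cover all boundary frequencies. The
  factor 2 pi of the one-dimensional Parseval identity makes up the difference between the
  normalisations on the boundary and in space-time.\<close>

lemma ft_extends_vsol:
  fixes h :: "(real^'m) \<times> real \<Rightarrow> complex"
  assumes h: "test_fun_on A h"
    and g: "integrable lborel g" "\<And>x. 0 < x \<Longrightarrow> g x = of_real (exp (- x))" "integrable lborel (ft g)"
    and \<psi>: "integrable lborel \<psi>" "\<And>t. 0 < t \<Longrightarrow> t < 2 \<Longrightarrow> \<psi> t = 1" "integrable lborel (ft \<psi>)"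
  shows "ft_extends (\<lambda>\<zeta>. ext_imag g h \<zeta> + ext_real \<psi> h \<zeta>) (vsol_st h)"
  unfolding ft_extends_def ft_st_eq_ft
proof (intro conjI allI impI)
  have [measurable]: "h \<in> borel_measurable borel" using h by (rule test_fun_measurable)
  have [measurable]: "g \<in> borel_measurable borel" "\<psi> \<in> borel_measurable borel" using g(1) \<psi>(1) by auto
  show "(\<lambda>\<zeta>. ext_imag g h \<zeta> + ext_real \<psi> h \<zeta>) \<in> borel_measurable lborel" by measurable
  fix \<phi> :: "((real^'m) \<times> real) \<times> real \<Rightarrow> complex" assume \<phi>: "test_fun_on Omega \<phi>"
  have [measurable]: "\<phi> \<in> borel_measurable borel" using \<phi> by (rule test_fun_measurable)
  note I = ext_imag_pairing[OF h \<phi> g]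
  note R = ext_real_pairing[OF h \<phi> \<psi>]
  let ?P = "\<lambda>w. ft h w * (2 * pi * pairing \<phi> w)"
  have P: "integrable lborel ?P"
    using integrable_mult_right[OF vsol_pairing(2)[OF h \<phi>], of "2 * pi"] by (simp add: mult_ac)
  have "(\<integral>\<zeta>. (ext_imag g h \<zeta> + ext_real \<psi> h \<zeta>) * ft \<phi> (- \<zeta>) \<partial>lborel)
     = (\<integral>w. indicator {0<..} (symb w) *\<^sub>R ?P w \<partial>lborel) + (\<integral>w. indicator {..0} (symb w) *\<^sub>R ?P w \<partial>lborel)"
    by (simp only: distrib_right Bochner_Integration.integral_add[OF I(1) R(1)] I(2) R(2))
  also have "\<dots> = (\<integral>w. indicator {0<..} (symb w) *\<^sub>R ?P w + indicator {..0} (symb w) *\<^sub>R ?P w \<partial>lborel)"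
    by (intro Bochner_Integration.integral_add[symmetric] integrable_pointwise_bound[OF P])
       (auto simp: indicator_def)
  also have "\<dots> = (\<integral>w. ?P w \<partial>lborel)"
    by (intro Bochner_Integration.integral_cong refl) (auto simp: indicator_def)
  also have "\<dots> = 2 * pi * (\<integral>w. ft h w * pairing \<phi> w \<partial>lborel)"
    unfolding integral_mult_right_zero[symmetric] by (simp only: mult_ac)
  finally show "(\<integral>\<zeta>. (ext_imag g h \<zeta> + ext_real \<psi> h \<zeta>) * ft \<phi> (- \<zeta>) \<partial>lborel) / (2 * pi) ^ (CARD('m) + 2)
      = (\<integral>z. vsol_st h z * \<phi> z \<partial>lborel)"
    unfolding vsol_pairing(1)[OF h \<phi>] by simp
qed

section \<open>Norm estimates\<close>

lemma nn_integral_powr_unit: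
  assumes "-1 < (e::real)"
  shows "(\<integral>\<^sup>+x. ennreal (indicator {0..1} x * x powr e) \<partial>lborel) = ennreal (1 / (e + 1))"
  using nn_integral_has_integral_lebesgue[OF _ has_integral_powr_from_0[OF assms, of 1]] by simp

lemma nn_integral_inverse_1_plus_sq: "(\<integral>\<^sup>+x. ennreal (1 / (1 + x\<^sup>2)) \<partial>(lborel :: real measure)) < \<infinity>"
proof -
  have "norm (1 / (1 + x\<^sup>2)) = 1 / (1 + x\<^sup>2)" for x :: real
    by (simp add: add_nonneg_nonneg)
  then show ?thesis
    using integrable_inverse_1_plus_sq unfolding integrable_iff_bounded by simp
qed

text \<open>The condition on \<open>e\<close> is integrability at 0. It is applied with
  \<open>e = 2 - a\<close>, where it reads a < 3.\<close>

lemma nn_integral_min_powr: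
  assumes e: "-1 < e"
  shows "(\<integral>\<^sup>+y. ennreal ((min 1 \<bar>y\<bar>) powr e / (1 + y\<^sup>2)) \<partial>lborel) < \<infinity>"
proof -
  have p: "0 < 1 + y\<^sup>2" for y :: real by (simp add: add_pos_nonneg)
  have "(min 1 \<bar>y\<bar>) powr e / (1 + y\<^sup>2) \<le> indicator {0..1} y * y powr e + indicator {0..1} (- y) * (- y) powr e + 1 / (1 + y\<^sup>2)" for y :: real
  proof (cases "\<bar>y\<bar> \<le> 1")
    case True
    have "\<bar>y\<bar> powr e / (1 + y\<^sup>2) \<le> \<bar>y\<bar> powr e"
      using p[of y] by (simp add: divide_le_eq mult_left_le add_nonneg_nonneg algebra_simps)
    moreover have "0 \<le> 1 / (1 + y\<^sup>2)" using p[of y] by simp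
    ultimately have "\<bar>y\<bar> powr e / (1 + y\<^sup>2) \<le> \<bar>y\<bar> powr e + 1 / (1 + y\<^sup>2)" by linarith
    then show ?thesis using True by (auto simp: indicator_def min_def abs_if split: if_splits)
  qed (auto simp: indicator_def)
  then have "(\<integral>\<^sup>+y. ennreal ((min 1 \<bar>y\<bar>) powr e / (1 + y\<^sup>2)) \<partial>lborel)
      \<le> (\<integral>\<^sup>+y. ennreal (indicator {0..1} y * y powr e) + ennreal (indicator {0..1} (- y) * (- y) powr e) + ennreal (1 / (1 + y\<^sup>2)) \<partial>lborel)"
    using p by (intro nn_integral_mono) (simp add: ennreal_plus[symmetric] ennreal_leI add_nonneg_nonneg less_imp_le del: ennreal_plus)
  also have "\<dots> = (\<integral>\<^sup>+y. ennreal (indicator {0..1} y * y powr e) \<partial>lborel) + (\<integral>\<^sup>+y. ennreal (indicator {0..1} (- y) * (- y) powr e) \<partial>lborel)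
      + (\<integral>\<^sup>+y. ennreal (1 / (1 + y\<^sup>2)) \<partial>lborel)"
    by (simp add: nn_integral_add)
  also have "(\<integral>\<^sup>+y. ennreal (indicator {0..1} (- y) * (- y) powr e) \<partial>lborel) = (\<integral>\<^sup>+y. ennreal (indicator {0..1} y * y powr e) \<partial>lborel)"
    by (subst (2) nn_integral_real_affine[where c = "-1" and t = 0]) auto
  finally show ?thesis
    using nn_integral_inverse_1_plus_sq by (auto simp: nn_integral_powr_unit[OF e] intro: le_less_trans)
qed

section \<open>Boundary norm and oscillating modes\<close>

definition B_weight :: "real \<Rightarrow> (real^'m) \<times> real \<Rightarrow> real" where
  "B_weight s w = (1 + (norm (fst w))\<^sup>2 + \<bar>symb w\<bar>) powr s * (1 + \<bar>symb w\<bar>) powr (1/2)"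

lemma B_weight_nonneg: "0 \<le> B_weight s w"
  by (simp add: B_weight_def)

lemma measurable_B_weight[measurable]: "B_weight s \<in> borel_measurable borel"
  unfolding B_weight_def[abs_def] by measurable

lemma Bnorm_sq_eq: "Bnorm_sq s h = (\<integral>\<^sup>+w. ennreal (B_weight s w * (norm (ft h w))\<^sup>2) \<partial>lborel)"
  unfolding Bnorm_sq_def B_weight_def hhat_eq_ft by simp

text \<open>In \<tau> the extension is a copy of \<open>ft \<psi>\<close> centred on the paraboloid,
  so polynomial growth of the weight in the distance \<tau> - \<open>snd (par p)\<close> is
  integrated out. One factor \<open>q\<close> of the square serves as Jacobian; the other becomes 2
  sqrt |\<mu>|, within the boundary weight.\<close>

lemma ext_real_bound:
  fixes wt :: "((real^'m) \<times> real) \<times> real \<Rightarrow> real"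
  assumes [measurable]: "wt \<in> borel_measurable borel"
    and [measurable]: "\<psi> \<in> borel_measurable borel"
    and C2: "0 \<le> C2" and wt: "\<And>p \<tau>. 0 \<le> snd p \<Longrightarrow>
      wt (p, \<tau>) \<le> C2 * (1 + (norm (fst p))\<^sup>2 + (snd p)\<^sup>2) powr s * (1 + \<bar>\<tau> - snd (par p)\<bar>) ^ M"
    and \<psi>: "\<And>y. norm (ft \<psi> y) * (1 + \<bar>y\<bar>) ^ (M + 1) \<le> C\<psi>"
  shows "\<exists>K<\<infinity>. \<forall>h :: (real^'m) \<times> real \<Rightarrow> complex. h \<in> borel_measurable borel \<longrightarrow>
     (\<integral>\<^sup>+z. ennreal (wt z * (norm (ext_real \<psi> h z))\<^sup>2) \<partial>lborel) \<le> K * Bnorm_sq s h"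
proof -
  define I where "I = (\<integral>\<^sup>+x. ennreal (1 / (1 + x\<^sup>2)) \<partial>(lborel :: real measure))"
  have I: "I < \<infinity>" unfolding I_def by (rule nn_integral_inverse_1_plus_sq)
  have pos: "0 < 1 + x\<^sup>2" for x :: real by (simp add: add_pos_nonneg)
  \<comment> \<open>Squaring the decay of order M + 1 gives 2 M + 2 powers: M for the weight, two
    for integrability, and M to spare.\<close>
  have tail: "(1 + \<bar>y\<bar>) ^ M * (norm (ft \<psi> y))\<^sup>2 \<le> C\<psi>\<^sup>2 * (1 / (1 + y\<^sup>2))" for y
  proof -
    have "(norm (ft \<psi> y) * (1 + \<bar>y\<bar>) ^ (M + 1))\<^sup>2 \<le> C\<psi>\<^sup>2"
      by (intro power_mono \<psi>) auto
    moreover have "(1 + \<bar>y\<bar>) ^ M * (norm (ft \<psi> y))\<^sup>2 * (1 + y\<^sup>2) \<le> (norm (ft \<psi> y) * (1 + \<bar>y\<bar>) ^ (M + 1))\<^sup>2"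
    proof -
      have "1 + y\<^sup>2 \<le> (1 + \<bar>y\<bar>)\<^sup>2" by (simp add: power2_eq_square algebra_simps)
      also have "\<dots> \<le> (1 + \<bar>y\<bar>) ^ (M + 2)" by (intro power_increasing) auto
      finally have "(1 + \<bar>y\<bar>) ^ M * (norm (ft \<psi> y))\<^sup>2 * (1 + y\<^sup>2) \<le> (1 + \<bar>y\<bar>) ^ M * (norm (ft \<psi> y))\<^sup>2 * (1 + \<bar>y\<bar>) ^ (M + 2)"
        by (intro mult_left_mono) auto
      also have "\<dots> = (norm (ft \<psi> y))\<^sup>2 * (1 + \<bar>y\<bar>) ^ (M + (M + 2))"
        by (simp only: power_add mult_ac)
      also have "\<dots> = (norm (ft \<psi> y) * (1 + \<bar>y\<bar>) ^ (M + 1))\<^sup>2"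
      proof -
        have "M + (M + 2) = (M + 1) * 2" by simp
        then show ?thesis by (simp only: power_mult_distrib power_mult[symmetric])
      qed
      finally show ?thesis .
    qed
    ultimately show ?thesis using pos[of y] by (simp add: pos_le_divide_eq)
  qed
  show ?thesis
  proof (intro exI conjI allI impI)
    show "ennreal (2 * C2 * C\<psi>\<^sup>2) * I < \<infinity>" using I by (simp add: ennreal_mult_less_top)
    fix h :: "(real^'m) \<times> real \<Rightarrow> complex" assume [measurable]: "h \<in> borel_measurable borel"
    define q where "q p = 2 * snd p * indicator {0..} (snd p)" for p :: "(real^'m) \<times> real"
    have q0: "0 \<le> q p" for p by (auto simp: q_def indicator_def)
    have [measurable]: "q \<in> borel_measurable borel" unfolding q_def[abs_def] by measurable
    define f where "f w = 2 * sqrt \<bar>symb w\<bar> * (C2 * (1 + (norm (fst w))\<^sup>2 + \<bar>symb w\<bar>) powr s) * (norm (ft h w))\<^sup>2" for w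
    have f0: "0 \<le> f w" for w using C2 by (simp add: f_def)
    have [measurable]: "f \<in> borel_measurable borel" unfolding f_def[abs_def] by measurable
    have "(\<integral>\<^sup>+z. ennreal (wt z * (norm (ext_real \<psi> h z))\<^sup>2) \<partial>lborel)
        = (\<integral>\<^sup>+p. \<integral>\<^sup>+\<tau>. ennreal (wt (p, \<tau>) * (norm (ext_real \<psi> h (p, \<tau>)))\<^sup>2) \<partial>lborel \<partial>lborel)"
      by (rule nn_integral_lborel_pair) measurable
    also have "\<dots> \<le> (\<integral>\<^sup>+p. ennreal (q p) * ennreal (f (par p)) * (ennreal (C\<psi>\<^sup>2) * I) \<partial>lborel)"
    proof (rule nn_integral_mono)
      fix p :: "(real^'m) \<times> real"
      have "(\<integral>\<^sup>+\<tau>. ennreal (wt (p, \<tau>) * (norm (ext_real \<psi> h (p, \<tau>)))\<^sup>2) \<partial>lborel)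
         \<le> (\<integral>\<^sup>+\<tau>. ennreal (q p) * ennreal (f (par p)) * (ennreal (C\<psi>\<^sup>2) * ennreal (1 / (1 + (- snd (par p) + 1 * \<tau>)\<^sup>2))) \<partial>lborel)"
      proof (rule nn_integral_mono)
        fix \<tau> :: real
        define y where "y = \<tau> - snd (par p)"
        have "wt (p, \<tau>) * (norm (ext_real \<psi> h (p, \<tau>)))\<^sup>2 \<le> q p * f (par p) * (C\<psi>\<^sup>2 * (1 / (1 + y\<^sup>2)))"
        proof (cases "0 \<le> snd p")
          case True
          have fp: "f (par p) = q p * (C2 * (1 + (norm (fst p))\<^sup>2 + (snd p)\<^sup>2) powr s) * (norm (ft h (par p)))\<^sup>2"
            unfolding f_def symb_par using True by (simp add: fst_par q_def)
          have e: "(norm (ext_real \<psi> h (p, \<tau>)))\<^sup>2 = (q p)\<^sup>2 * (norm (ft h (par p)))\<^sup>2 * (norm (ft \<psi> y))\<^sup>2"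
            by (simp add: ext_real_def q_def y_def norm_mult power_mult_distrib)
          have "wt (p, \<tau>) * (norm (ext_real \<psi> h (p, \<tau>)))\<^sup>2
             \<le> (C2 * (1 + (norm (fst p))\<^sup>2 + (snd p)\<^sup>2) powr s * (1 + \<bar>y\<bar>) ^ M) * ((q p)\<^sup>2 * (norm (ft h (par p)))\<^sup>2 * (norm (ft \<psi> y))\<^sup>2)"
            unfolding e y_def by (intro mult_right_mono wt True) auto
          also have "\<dots> = q p * f (par p) * ((1 + \<bar>y\<bar>) ^ M * (norm (ft \<psi> y))\<^sup>2)"
            unfolding fp by (simp add: power2_eq_square mult_ac)
          also have "\<dots> \<le> q p * f (par p) * (C\<psi>\<^sup>2 * (1 / (1 + y\<^sup>2)))"
            by (intro mult_left_mono tail) (use q0[of p] f0 in auto)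
          finally show ?thesis .
        qed (simp add: ext_real_def q_def)
        then show "ennreal (wt (p, \<tau>) * (norm (ext_real \<psi> h (p, \<tau>)))\<^sup>2)
           \<le> ennreal (q p) * ennreal (f (par p)) * (ennreal (C\<psi>\<^sup>2) * ennreal (1 / (1 + (- snd (par p) + 1 * \<tau>)\<^sup>2)))"
          using q0[of p] f0[of "par p"] pos[of y]
          by (simp add: ennreal_mult[symmetric] y_def ennreal_leI less_imp_le)
      qed
      also have "\<dots> = ennreal (q p) * ennreal (f (par p)) * (ennreal (C\<psi>\<^sup>2) * (\<integral>\<^sup>+\<tau>. ennreal (1 / (1 + (- snd (par p) + 1 * \<tau>)\<^sup>2)) \<partial>lborel))"
        by (simp add: nn_integral_cmult)
      also have "(\<integral>\<^sup>+\<tau>. ennreal (1 / (1 + (- snd (par p) + 1 * \<tau>)\<^sup>2)) \<partial>lborel) = I"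
        unfolding I_def by (subst (2) nn_integral_real_affine[where c = 1 and t = "- snd (par p)"]) auto
      finally show "(\<integral>\<^sup>+\<tau>. ennreal (wt (p, \<tau>) * (norm (ext_real \<psi> h (p, \<tau>)))\<^sup>2) \<partial>lborel)
         \<le> ennreal (q p) * ennreal (f (par p)) * (ennreal (C\<psi>\<^sup>2) * I)" .
    qed
    also have "\<dots> = (\<integral>\<^sup>+p. ennreal (q p) * ennreal (f (par p)) \<partial>lborel) * (ennreal (C\<psi>\<^sup>2) * I)"
      by (rule nn_integral_multc) measurable
    also have "(\<integral>\<^sup>+p. ennreal (q p) * ennreal (f (par p)) \<partial>lborel) = (\<integral>\<^sup>+w. indicator {..0} (symb w) * ennreal (f w) \<partial>lborel)"
      unfolding q_def by (rule nn_integral_par) measurable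
    also have "\<dots> \<le> (\<integral>\<^sup>+w. ennreal (2 * C2) * ennreal (B_weight s w * (norm (ft h w))\<^sup>2) \<partial>lborel)"
    proof (rule nn_integral_mono)
      fix w :: "(real^'m) \<times> real"
      have "sqrt \<bar>symb w\<bar> \<le> (1 + \<bar>symb w\<bar>) powr (1/2)"
        by (simp add: powr_half_sqrt)
      then have "(2 * C2 * (1 + (norm (fst w))\<^sup>2 + \<bar>symb w\<bar>) powr s * (norm (ft h w))\<^sup>2) * sqrt \<bar>symb w\<bar>
          \<le> (2 * C2 * (1 + (norm (fst w))\<^sup>2 + \<bar>symb w\<bar>) powr s * (norm (ft h w))\<^sup>2) * (1 + \<bar>symb w\<bar>) powr (1/2)"
        using C2 by (intro mult_left_mono) auto
      then have "f w \<le> 2 * C2 * (B_weight s w * (norm (ft h w))\<^sup>2)"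
        unfolding f_def B_weight_def by (simp only: mult_ac)
      then show "indicator {..0} (symb w) * ennreal (f w) \<le> ennreal (2 * C2) * ennreal (B_weight s w * (norm (ft h w))\<^sup>2)"
        using C2 by (auto simp: indicator_def ennreal_mult[symmetric] B_weight_nonneg ennreal_leI)
    qed
    also have "\<dots> = ennreal (2 * C2) * Bnorm_sq s h"
      unfolding Bnorm_sq_eq by (rule nn_integral_cmult) measurable
    finally show "(\<integral>\<^sup>+z. ennreal (wt z * (norm (ext_real \<psi> h z))\<^sup>2) \<partial>lborel) \<le> ennreal (2 * C2 * C\<psi>\<^sup>2) * I * Bnorm_sq s h"
      using C2 by (simp add: mult_right_mono ennreal_mult mult_ac)
  qed
qed

text \<open>Compact support in time makes \<open>ft h\<close> equal to its convolution with \<open>ft \<psi>\<close>. This compensates the factor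
  \<open>\<mu> powr (-1/2)\<close>, unbounded at \<open>\<mu> = 0\<close>, by which the squared norms of the decaying modes exceed the boundary weight.\<close>

lemma ft_local_average:
  "\<exists>K<\<infinity>. \<forall>(h :: (real^'m) \<times> real \<Rightarrow> complex) \<xi> \<tau>. test_fun_on (UNIV \<times> {0<..<2}) h \<longrightarrow> \<bar>symb (\<xi>, \<tau>)\<bar> \<le> 1 \<longrightarrow>
     ennreal ((norm (ft h (\<xi>, \<tau>)))\<^sup>2) \<le> K * (\<integral>\<^sup>+\<sigma>. ennreal ((norm (ft h (\<xi>, \<sigma>)))\<^sup>2 / (1 + \<bar>symb (\<xi>, \<sigma>)\<bar>)) \<partial>lborel)"
proof -
  obtain \<psi> C where \<psi>: "integrable lborel \<psi>" "\<And>t. 0 < t \<Longrightarrow> t < 2 \<Longrightarrow> \<psi> t = 1" "\<And>y. norm (ft \<psi> y) * (1 + \<bar>y\<bar>) ^ 2 \<le> C"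
    using exists_time_cutoff[of 2 2] by auto
  have [measurable]: "\<psi> \<in> borel_measurable borel" using \<psi>(1) by auto
  define I where "I = (\<integral>\<^sup>+x. ennreal (1 / (1 + x\<^sup>2)) \<partial>(lborel :: real measure))"
  have I: "I < \<infinity>" unfolding I_def by (rule nn_integral_inverse_1_plus_sq)
  have pos: "0 < 1 + x\<^sup>2" for x :: real by (simp add: add_pos_nonneg)
  have tail: "(norm (ft \<psi> y))\<^sup>2 * (1 + \<bar>y\<bar>) \<le> C\<^sup>2 * (1 / (1 + y\<^sup>2))" for y
  proof -
    have "(norm (ft \<psi> y))\<^sup>2 * (1 + \<bar>y\<bar>) * (1 + y\<^sup>2) \<le> (norm (ft \<psi> y))\<^sup>2 * ((1 + \<bar>y\<bar>)\<^sup>2 * (1 + \<bar>y\<bar>)\<^sup>2)"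
      unfolding mult.assoc
      by (intro mult_left_mono mult_mono) (auto simp: power2_eq_square algebra_simps)
    also have "\<dots> = (norm (ft \<psi> y) * (1 + \<bar>y\<bar>)\<^sup>2)\<^sup>2"
      by (simp add: power2_eq_square mult_ac)
    also have "\<dots> \<le> C\<^sup>2" by (intro power_mono \<psi>) auto
    finally show ?thesis using pos[of y] by (simp add: pos_le_divide_eq)
  qed
  show ?thesis
  proof (intro exI conjI allI impI)
    show "ennreal (2 * C\<^sup>2) * I < \<infinity>" using I by (simp add: ennreal_mult_less_top)
    fix h :: "(real^'m) \<times> real \<Rightarrow> complex" and \<xi> :: "real^'m" and \<tau> :: real
    assume h: "test_fun_on (UNIV \<times> {0<..<2}) h" and symb: "\<bar>symb (\<xi>, \<tau>)\<bar> \<le> 1"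
    have hm[measurable]: "h \<in> borel_measurable borel" using h by (rule test_fun_measurable)
    define c where "c = (norm \<xi>)\<^sup>2"
    let ?\<psi> = "\<lambda>t. \<psi> t * cis (- \<tau> * t)"
    have \<psi>': "integrable lborel ?\<psi>"
      by (subst mult.commute, rule integrable_cis_mult[OF \<psi>(1)]) auto
    have "2 * pi * ft h (\<xi>, \<tau>) = 2 * pi * ft (partial_ft h \<xi>) \<tau>"
      by (simp add: ft_partial_ft[OF h])
    \<comment> \<open>\<open>partial_ft h \<xi>\<close> vanishes for t outside (0, 2), so
      multiplying by \<psi> changes nothing.\<close>
    also have "ft (partial_ft h \<xi>) \<tau> = (\<integral>t. ?\<psi> t * partial_ft h \<xi> t \<partial>lborel)"
      unfolding ft_def
    proof (intro Bochner_Integration.integral_cong refl)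
      fix t :: real
      show "cis (- (\<tau> \<bullet> t)) * partial_ft h \<xi> t = ?\<psi> t * partial_ft h \<xi> t"
      proof (cases "0 < t \<and> t < 2")
        case False
        then have "(x, t) \<notin> tsupport h" for x
          using h by (auto simp: test_fun_on_def)
        then have "h (x, t) = 0" for x by (rule not_in_tsupport)
        then show ?thesis by (simp add: partial_ft_def)
      qed (simp add: \<psi>(2))
    qed
    also have "2 * pi * (\<integral>t. ?\<psi> t * partial_ft h \<xi> t \<partial>lborel) = (\<integral>\<sigma>. ft ?\<psi> \<sigma> * ft h (\<xi>, - \<sigma>) \<partial>lborel)"
      by (rule parseval_partial_ft[OF h \<psi>', symmetric])
    also have "\<dots> = (\<integral>\<sigma>. ft \<psi> (\<sigma> + \<tau>) * ft h (\<xi>, - \<sigma>) \<partial>lborel)"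
      by (simp only: ft_modulate) simp
    finally have eq: "2 * pi * ft h (\<xi>, \<tau>) = (\<integral>\<sigma>. ft \<psi> (\<sigma> + \<tau>) * ft h (\<xi>, - \<sigma>) \<partial>lborel)" .
    have "(\<lambda>\<sigma>::real. (\<xi>, - \<sigma>)) \<in> borel \<rightarrow>\<^sub>M borel"
      by (intro borel_measurable_continuous_onI continuous_intros)
    then have mh[measurable]: "(\<lambda>\<sigma>. ft h (\<xi>, - \<sigma>)) \<in> borel_measurable borel"
      by (rule measurable_compose) measurable
    have "(\<lambda>\<sigma>::real. (\<xi>, \<sigma>)) \<in> borel \<rightarrow>\<^sub>M borel"
      by (intro borel_measurable_continuous_onI continuous_intros)
    then have mh'[measurable]: "(\<lambda>\<sigma>. ft h (\<xi>, \<sigma>)) \<in> borel_measurable borel"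
      by (rule measurable_compose) measurable
    \<comment> \<open>For Cauchy-Schwarz the square root of 1 + |symb (\<xi>, - \<sigma>)|, where
      |symb (\<xi>, - \<sigma>)| = |c - \<sigma>|, is moved from \<open>ft h\<close> to the rapidly
      decaying \<open>ft \<psi>\<close>.\<close>
    define u where "u \<sigma> = norm (ft \<psi> (\<sigma> + \<tau>)) * sqrt (1 + \<bar>c - \<sigma>\<bar>)" for \<sigma>
    define v where "v \<sigma> = norm (ft h (\<xi>, - \<sigma>)) / sqrt (1 + \<bar>c - \<sigma>\<bar>)" for \<sigma>
    have [measurable]: "u \<in> borel_measurable borel" "v \<in> borel_measurable borel"
      unfolding u_def[abs_def] v_def[abs_def] by measurable
    have u0: "0 \<le> u \<sigma>" and v0: "0 \<le> v \<sigma>" for \<sigma> by (auto simp: u_def v_def)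
    have sq: "0 < sqrt (1 + \<bar>c - \<sigma>\<bar>)" for \<sigma> by simp
    have "norm (ft h (\<xi>, \<tau>)) \<le> 2 * pi * norm (ft h (\<xi>, \<tau>))"
      using pi_gt3 by (simp add: mult_le_cancel_right1)
    also have "\<dots> = norm (\<integral>\<sigma>. ft \<psi> (\<sigma> + \<tau>) * ft h (\<xi>, - \<sigma>) \<partial>lborel)"
      unfolding eq[symmetric] by (simp add: norm_mult)
    finally have "ennreal (norm (ft h (\<xi>, \<tau>))) \<le> ennreal (norm (\<integral>\<sigma>. ft \<psi> (\<sigma> + \<tau>) * ft h (\<xi>, - \<sigma>) \<partial>lborel))"
      by (rule ennreal_leI)
    \<comment> \<open>Without integrability the Bochner integral is 0 and the bound is
      trivial.\<close>
    also have "\<dots> \<le> (\<integral>\<^sup>+\<sigma>. ennreal (norm (ft \<psi> (\<sigma> + \<tau>) * ft h (\<xi>, - \<sigma>))) \<partial>lborel)"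
      by (cases "integrable lborel (\<lambda>\<sigma>. ft \<psi> (\<sigma> + \<tau>) * ft h (\<xi>, - \<sigma>))")
         (auto intro: integral_norm_bound_ennreal simp: not_integrable_integral_eq simp del: norm_mult)
    also have "\<dots> = (\<integral>\<^sup>+\<sigma>. ennreal (u \<sigma>) * ennreal (v \<sigma>) \<partial>lborel)"
    proof (intro nn_integral_cong)
      fix \<sigma>
      have "norm (ft \<psi> (\<sigma> + \<tau>) * ft h (\<xi>, - \<sigma>)) = u \<sigma> * v \<sigma>"
        using sq[of \<sigma>] by (simp add: u_def v_def norm_mult)
      then show "ennreal (norm (ft \<psi> (\<sigma> + \<tau>) * ft h (\<xi>, - \<sigma>))) = ennreal (u \<sigma>) * ennreal (v \<sigma>)"
        by (simp add: ennreal_mult u0 v0)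
    qed
    finally have "(ennreal (norm (ft h (\<xi>, \<tau>))))\<^sup>2 \<le> (\<integral>\<^sup>+\<sigma>. ennreal (u \<sigma>) * ennreal (v \<sigma>) \<partial>lborel)\<^sup>2"
      by (rule power_mono) simp
    also have "\<dots> \<le> (\<integral>\<^sup>+\<sigma>. (ennreal (u \<sigma>))\<^sup>2 \<partial>lborel) * (\<integral>\<^sup>+\<sigma>. (ennreal (v \<sigma>))\<^sup>2 \<partial>lborel)"
      by (rule Cauchy_Schwarz_nn_integral) measurable
    also have "\<dots> \<le> (ennreal (2 * C\<^sup>2) * I) * (\<integral>\<^sup>+\<sigma>. ennreal ((norm (ft h (\<xi>, \<sigma>)))\<^sup>2 / (1 + \<bar>symb (\<xi>, \<sigma>)\<bar>)) \<partial>lborel)"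
    proof (rule mult_mono)
      have "(\<integral>\<^sup>+\<sigma>. (ennreal (u \<sigma>))\<^sup>2 \<partial>lborel) \<le> (\<integral>\<^sup>+\<sigma>. ennreal (2 * C\<^sup>2) * ennreal (1 / (1 + (\<tau> + 1 * \<sigma>)\<^sup>2)) \<partial>lborel)"
      proof (rule nn_integral_mono)
        fix \<sigma> :: real
        \<comment> \<open>At low frequency \<tau> lies within 1 of - c, so the distance of \<sigma>
          from c is controlled by the argument \<sigma> + \<tau> of
          \<open>ft \<psi>\<close>.\<close>
        have "1 + \<bar>c - \<sigma>\<bar> \<le> 2 * (1 + \<bar>\<sigma> + \<tau>\<bar>)"
        proof -
          have "\<bar>\<tau> + c\<bar> \<le> 1" using symb by (simp add: c_def)
          moreover have "\<bar>c - \<sigma>\<bar> \<le> \<bar>\<tau> + c\<bar> + \<bar>\<sigma> + \<tau>\<bar>"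
            using abs_triangle_ineq4[of "\<tau> + c" "\<sigma> + \<tau>"] by simp
          ultimately show ?thesis using abs_ge_zero[of "\<sigma> + \<tau>"] by argo
        qed
        then have le: "(norm (ft \<psi> (\<sigma> + \<tau>)))\<^sup>2 * (1 + \<bar>c - \<sigma>\<bar>) \<le> (norm (ft \<psi> (\<sigma> + \<tau>)))\<^sup>2 * (2 * (1 + \<bar>\<sigma> + \<tau>\<bar>))"
          by (intro mult_left_mono) auto
        have "(u \<sigma>)\<^sup>2 = (norm (ft \<psi> (\<sigma> + \<tau>)))\<^sup>2 * (1 + \<bar>c - \<sigma>\<bar>)"
          by (simp add: u_def power_mult_distrib)
        also note le
        also have "(norm (ft \<psi> (\<sigma> + \<tau>)))\<^sup>2 * (2 * (1 + \<bar>\<sigma> + \<tau>\<bar>)) = 2 * ((norm (ft \<psi> (\<sigma> + \<tau>)))\<^sup>2 * (1 + \<bar>\<sigma> + \<tau>\<bar>))"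
          by (simp only: mult_ac)
        also have "\<dots> \<le> 2 * (C\<^sup>2 * (1 / (1 + (\<sigma> + \<tau>)\<^sup>2)))" by (intro mult_left_mono tail) auto
        finally show "(ennreal (u \<sigma>))\<^sup>2 \<le> ennreal (2 * C\<^sup>2) * ennreal (1 / (1 + (\<tau> + 1 * \<sigma>)\<^sup>2))"
          using pos[of "\<sigma> + \<tau>"] u0[of \<sigma>]
          by (simp add: ennreal_power ennreal_mult[symmetric] ennreal_leI less_imp_le add.commute)
      qed
      also have "\<dots> = ennreal (2 * C\<^sup>2) * (\<integral>\<^sup>+\<sigma>. ennreal (1 / (1 + (\<tau> + 1 * \<sigma>)\<^sup>2)) \<partial>lborel)"
        by (rule nn_integral_cmult) measurable
      also have "(\<integral>\<^sup>+\<sigma>. ennreal (1 / (1 + (\<tau> + 1 * \<sigma>)\<^sup>2)) \<partial>lborel) = I"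
        unfolding I_def by (subst (2) nn_integral_real_affine[where c = 1 and t = \<tau>]) auto
      finally show "(\<integral>\<^sup>+\<sigma>. (ennreal (u \<sigma>))\<^sup>2 \<partial>lborel) \<le> ennreal (2 * C\<^sup>2) * I" .
      have "(\<integral>\<^sup>+\<sigma>. ennreal ((norm (ft h (\<xi>, \<sigma>)))\<^sup>2 / (1 + \<bar>symb (\<xi>, \<sigma>)\<bar>)) \<partial>lborel)
        = (\<integral>\<^sup>+\<sigma>. ennreal ((norm (ft h (\<xi>, 0 + -1 * \<sigma>)))\<^sup>2 / (1 + \<bar>0 + -1 * \<sigma> + c\<bar>)) \<partial>lborel)"
        by (subst nn_integral_real_affine[where c = "-1" and t = 0]) (auto simp: c_def)
      also have "\<dots> = (\<integral>\<^sup>+\<sigma>. (ennreal (v \<sigma>))\<^sup>2 \<partial>lborel)"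
        by (intro nn_integral_cong) (simp add: ennreal_power v0 v_def power_divide add.commute)
      finally show "(\<integral>\<^sup>+\<sigma>. (ennreal (v \<sigma>))\<^sup>2 \<partial>lborel)
          \<le> (\<integral>\<^sup>+\<sigma>. ennreal ((norm (ft h (\<xi>, \<sigma>)))\<^sup>2 / (1 + \<bar>symb (\<xi>, \<sigma>)\<bar>)) \<partial>lborel)"
        by simp
    qed auto
    finally show "ennreal ((norm (ft h (\<xi>, \<tau>)))\<^sup>2)
       \<le> ennreal (2 * C\<^sup>2) * I * (\<integral>\<^sup>+\<sigma>. ennreal ((norm (ft h (\<xi>, \<sigma>)))\<^sup>2 / (1 + \<bar>symb (\<xi>, \<sigma>)\<bar>)) \<partial>lborel)"
      by (simp add: ennreal_power)
  qed
qed

text \<open>For negative s, \<open>a + m \<le> a * (1 + m)\<close> bounds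
  \<open>(a + m) powr s\<close> below by \<open>a powr s * (1 + m) powr s\<close>; what remains is
  the comparison -1 \<le> s + 1/2, which is the threshold -3/2. For s \<ge> 0 monotonicity
  suffices.\<close>

lemma low_frequency_weight:
  fixes a m s :: real
  assumes s: "-3/2 \<le> s" and a: "1 \<le> a" and m: "0 \<le> m"
  shows "a powr s / (1 + m) \<le> (a + m) powr s * (1 + m) powr (1/2)"
proof (cases "0 \<le> s")
  case True
  have "a powr s / (1 + m) \<le> a powr s" using m by (simp add: divide_le_eq mult_le_cancel_left1)
  also have "\<dots> \<le> (a + m) powr s" using True a m by (intro powr_mono2) auto
  also have "\<dots> \<le> (a + m) powr s * (1 + m) powr (1/2)"
    using ge_one_powr_ge_zero[of "1 + m" "1/2"] m by (simp add: mult_le_cancel_left1)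
  finally show ?thesis .
next
  case False
  have "a powr s / (1 + m) = a powr s * (1 + m) powr (-1)"
    using m by (simp add: powr_minus_divide)
  also have "\<dots> \<le> a powr s * (1 + m) powr (s + 1/2)"
    using s m by (intro mult_left_mono powr_mono) auto
  also have "\<dots> = (a * (1 + m)) powr s * (1 + m) powr (1/2)"
    using a m by (simp add: powr_mult powr_add)
  also have "\<dots> \<le> (a + m) powr s * (1 + m) powr (1/2)"
  proof (rule mult_right_mono)
    have "m \<le> a * m" using a m by (simp add: mult_le_cancel_right1)
    then have "a + m \<le> a * (1 + m)" by (simp add: distrib_left)
    then show "(a * (1 + m)) powr s \<le> (a + m) powr s"
      using False a m by (intro powr_mono2') auto
  qed simp
  finally show ?thesis .
qed

text \<open>The local average bounds \<open>ft h\<close> on the whole slice 0 < \<mu> < 1 by a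
  quantity depending on \<xi> alone. The singular power of \<mu> is then integrated by itself, and
  the average is read back as an integral over all boundary frequencies.\<close>

lemma low_frequency_bound:
  assumes s: "-3/2 \<le> s"
  shows "\<exists>K<\<infinity>. \<forall>h :: (real^'m) \<times> real \<Rightarrow> complex. test_fun_on (UNIV \<times> {0<..<2}) h \<longrightarrow>
    (\<integral>\<^sup>+w. ennreal (indicator {0<..<1} (symb w) * ((1 + (norm (fst w))\<^sup>2) powr s * (symb w) powr (-1/2) * (norm (ft h w))\<^sup>2)) \<partial>lborel)
      \<le> K * Bnorm_sq s h"
proof -
  obtain K where K: "K < \<infinity>" and avg: "\<And>(h :: (real^'m) \<times> real \<Rightarrow> complex) \<xi> \<tau>. test_fun_on (UNIV \<times> {0<..<2}) h \<Longrightarrow> \<bar>symb (\<xi>, \<tau>)\<bar> \<le> 1 \<Longrightarrow>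
     ennreal ((norm (ft h (\<xi>, \<tau>)))\<^sup>2) \<le> K * (\<integral>\<^sup>+\<sigma>. ennreal ((norm (ft h (\<xi>, \<sigma>)))\<^sup>2 / (1 + \<bar>symb (\<xi>, \<sigma>)\<bar>)) \<partial>lborel)"
    using ft_local_average[where 'm = 'm] by blast
  define I where "I = (\<integral>\<^sup>+x. ennreal (indicator {0..1} x * x powr (-1/2)) \<partial>(lborel :: real measure))"
  have I: "I < \<infinity>" unfolding I_def by (subst nn_integral_powr_unit) auto
  show ?thesis
  proof (intro exI conjI allI impI)
    show "K * I < \<infinity>" using K I by (simp add: ennreal_mult_less_top)
    fix h :: "(real^'m) \<times> real \<Rightarrow> complex" assume h: "test_fun_on (UNIV \<times> {0<..<2}) h"
    have [measurable]: "h \<in> borel_measurable borel" using h by (rule test_fun_measurable)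
    have pair: "(\<lambda>\<sigma>::real. (\<xi>, \<sigma>)) \<in> borel \<rightarrow>\<^sub>M borel" for \<xi> :: "real^'m"
      by (intro borel_measurable_continuous_onI continuous_intros)
    have [measurable]: "(\<lambda>\<sigma>. ft h (\<xi>, \<sigma>)) \<in> borel_measurable borel" for \<xi>
      by (rule measurable_compose[OF pair]) measurable
    define V where "V \<xi> = (\<integral>\<^sup>+\<sigma>. ennreal ((norm (ft h (\<xi>, \<sigma>)))\<^sup>2 / (1 + \<bar>symb (\<xi>, \<sigma>)\<bar>)) \<partial>lborel)" for \<xi>
    let ?a = "\<lambda>\<xi>. (1 + (norm \<xi>)\<^sup>2) powr s"
    have "(\<integral>\<^sup>+w. ennreal (indicator {0<..<1} (symb w) * ((1 + (norm (fst w))\<^sup>2) powr s * (symb w) powr (-1/2) * (norm (ft h w))\<^sup>2)) \<partial>lborel)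
      = (\<integral>\<^sup>+\<xi>. \<integral>\<^sup>+\<tau>. ennreal (indicator {0<..<1} (symb (\<xi>, \<tau>)) * (?a (fst (\<xi>, \<tau>)) * (symb (\<xi>, \<tau>)) powr (-1/2) * (norm (ft h (\<xi>, \<tau>)))\<^sup>2)) \<partial>lborel \<partial>lborel)"
      by (rule nn_integral_lborel_pair) measurable
    also have "\<dots> = (\<integral>\<^sup>+\<xi>. \<integral>\<^sup>+\<tau>. ennreal (indicator {0<..<1} (symb (\<xi>, \<tau>)) * (?a \<xi> * (symb (\<xi>, \<tau>)) powr (-1/2) * (norm (ft h (\<xi>, \<tau>)))\<^sup>2)) \<partial>lborel \<partial>lborel)"
      by (simp only: fst_conv)
    also have "\<dots> \<le> (\<integral>\<^sup>+\<xi>. (K * I) * (\<integral>\<^sup>+\<sigma>. ennreal (?a \<xi> * ((norm (ft h (\<xi>, \<sigma>)))\<^sup>2 / (1 + \<bar>symb (\<xi>, \<sigma>)\<bar>))) \<partial>lborel) \<partial>lborel)"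
    proof (rule nn_integral_mono)
      fix \<xi> :: "real^'m"
      define c where "c = (norm \<xi>)\<^sup>2"
      have "(\<integral>\<^sup>+\<tau>. ennreal (indicator {0<..<1} (symb (\<xi>, \<tau>)) * (?a \<xi> * (symb (\<xi>, \<tau>)) powr (-1/2) * (norm (ft h (\<xi>, \<tau>)))\<^sup>2)) \<partial>lborel)
        \<le> (\<integral>\<^sup>+\<tau>. ennreal (indicator {0..1} (c + 1 * \<tau>) * (c + 1 * \<tau>) powr (-1/2)) * (ennreal (?a \<xi>) * (K * V \<xi>)) \<partial>lborel)"
      proof (rule nn_integral_mono)
        fix \<tau> :: real
        show "ennreal (indicator {0<..<1} (symb (\<xi>, \<tau>)) * (?a \<xi> * (symb (\<xi>, \<tau>)) powr (-1/2) * (norm (ft h (\<xi>, \<tau>)))\<^sup>2))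
          \<le> ennreal (indicator {0..1} (c + 1 * \<tau>) * (c + 1 * \<tau>) powr (-1/2)) * (ennreal (?a \<xi>) * (K * V \<xi>))"
        proof (cases "symb (\<xi>, \<tau>) \<in> {0<..<1}")
          case True
          then have le: "ennreal ((norm (ft h (\<xi>, \<tau>)))\<^sup>2) \<le> K * V \<xi>"
            unfolding V_def by (intro avg h) auto
          have "ennreal (indicator {0<..<1} (symb (\<xi>, \<tau>)) * (?a \<xi> * (symb (\<xi>, \<tau>)) powr (-1/2) * (norm (ft h (\<xi>, \<tau>)))\<^sup>2))
             = ennreal (indicator {0..1} (c + 1 * \<tau>) * (c + 1 * \<tau>) powr (-1/2)) * (ennreal (?a \<xi>) * ennreal ((norm (ft h (\<xi>, \<tau>)))\<^sup>2))"
            using True by (simp add: c_def ennreal_mult[symmetric] add.commute mult_ac)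
          also have "\<dots> \<le> ennreal (indicator {0..1} (c + 1 * \<tau>) * (c + 1 * \<tau>) powr (-1/2)) * (ennreal (?a \<xi>) * (K * V \<xi>))"
            by (intro mult_left_mono le) auto
          finally show ?thesis .
        qed simp
      qed
      also have "\<dots> = (\<integral>\<^sup>+\<tau>. ennreal (indicator {0..1} (c + 1 * \<tau>) * (c + 1 * \<tau>) powr (-1/2)) \<partial>lborel) * (ennreal (?a \<xi>) * (K * V \<xi>))"
        by (rule nn_integral_multc) measurable
      also have "(\<integral>\<^sup>+\<tau>. ennreal (indicator {0..1} (c + 1 * \<tau>) * (c + 1 * \<tau>) powr (-1/2)) \<partial>lborel) = I"
        unfolding I_def by (subst (2) nn_integral_real_affine[where c = 1 and t = c]) auto
      also have "I * (ennreal (?a \<xi>) * (K * V \<xi>)) = (K * I) * (ennreal (?a \<xi>) * V \<xi>)"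
        by (simp only: mult_ac)
      also have "ennreal (?a \<xi>) * V \<xi> = (\<integral>\<^sup>+\<sigma>. ennreal (?a \<xi> * ((norm (ft h (\<xi>, \<sigma>)))\<^sup>2 / (1 + \<bar>symb (\<xi>, \<sigma>)\<bar>))) \<partial>lborel)"
        unfolding V_def by (subst nn_integral_cmult[symmetric]) (auto simp: ennreal_mult[symmetric])
      finally show "(\<integral>\<^sup>+\<tau>. ennreal (indicator {0<..<1} (symb (\<xi>, \<tau>)) * (?a \<xi> * (symb (\<xi>, \<tau>)) powr (-1/2) * (norm (ft h (\<xi>, \<tau>)))\<^sup>2)) \<partial>lborel)
        \<le> (K * I) * (\<integral>\<^sup>+\<sigma>. ennreal (?a \<xi> * ((norm (ft h (\<xi>, \<sigma>)))\<^sup>2 / (1 + \<bar>symb (\<xi>, \<sigma>)\<bar>))) \<partial>lborel)" .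
    qed
    also have "\<dots> = (K * I) * (\<integral>\<^sup>+\<xi>. \<integral>\<^sup>+\<sigma>. ennreal (?a \<xi> * ((norm (ft h (\<xi>, \<sigma>)))\<^sup>2 / (1 + \<bar>symb (\<xi>, \<sigma>)\<bar>))) \<partial>lborel \<partial>lborel)"
    proof (rule nn_integral_cmult)
      have "(\<lambda>w. ennreal (?a (fst w) * ((norm (ft h w))\<^sup>2 / (1 + \<bar>symb w\<bar>)))) \<in> borel_measurable borel"
        by measurable
      then have "(\<lambda>(\<xi>, \<sigma>). ennreal (?a \<xi> * ((norm (ft h (\<xi>, \<sigma>)))\<^sup>2 / (1 + \<bar>symb (\<xi>, \<sigma>)\<bar>)))) \<in> borel_measurable (lborel \<Otimes>\<^sub>M lborel)"
        by (simp add: lborel_prod case_prod_unfold)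
      from lborel.borel_measurable_nn_integral[OF this]
      show "(\<lambda>\<xi>. \<integral>\<^sup>+\<sigma>. ennreal (?a \<xi> * ((norm (ft h (\<xi>, \<sigma>)))\<^sup>2 / (1 + \<bar>symb (\<xi>, \<sigma>)\<bar>))) \<partial>lborel) \<in> borel_measurable lborel"
        by simp
    qed
    also have "(\<integral>\<^sup>+\<xi>. \<integral>\<^sup>+\<sigma>. ennreal (?a \<xi> * ((norm (ft h (\<xi>, \<sigma>)))\<^sup>2 / (1 + \<bar>symb (\<xi>, \<sigma>)\<bar>))) \<partial>lborel \<partial>lborel)
       = (\<integral>\<^sup>+\<xi>. \<integral>\<^sup>+\<sigma>. ennreal (?a (fst (\<xi>, \<sigma>)) * ((norm (ft h (\<xi>, \<sigma>)))\<^sup>2 / (1 + \<bar>symb (\<xi>, \<sigma>)\<bar>))) \<partial>lborel \<partial>lborel)"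
      by (simp only: fst_conv)
    also have "\<dots> = (\<integral>\<^sup>+w. ennreal (?a (fst w) * ((norm (ft h w))\<^sup>2 / (1 + \<bar>symb w\<bar>))) \<partial>lborel)"
      by (rule nn_integral_lborel_pair[symmetric]) measurable
    also have "\<dots> \<le> Bnorm_sq s h"
      unfolding Bnorm_sq_eq
    proof (intro nn_integral_mono ennreal_leI)
      fix w :: "(real^'m) \<times> real"
      have "?a (fst w) / (1 + \<bar>symb w\<bar>) \<le> B_weight s w"
        unfolding B_weight_def by (rule low_frequency_weight[OF s]) auto
      from mult_right_mono[OF this, of "(norm (ft h w))\<^sup>2"]
      show "?a (fst w) * ((norm (ft h w))\<^sup>2 / (1 + \<bar>symb w\<bar>)) \<le> B_weight s w * (norm (ft h w))\<^sup>2" by simp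
    qed
    finally show "(\<integral>\<^sup>+w. ennreal (indicator {0<..<1} (symb w) * ((1 + (norm (fst w))\<^sup>2) powr s * (symb w) powr (-1/2) * (norm (ft h w))\<^sup>2)) \<partial>lborel)
      \<le> K * I * Bnorm_sq s h"
      by (simp add: mult_left_mono)
  qed
qed

section \<open>Decaying modes\<close>

lemma powr_le_two_powr:
  fixes a m s :: real
  assumes "0 < a" "a \<le> m" "m \<le> 2 * a"
  shows "m powr s \<le> 2 powr \<bar>s\<bar> * a powr s"
proof (cases "0 \<le> s")
  case True
  then have "m powr s \<le> (2 * a) powr s" using assms by (intro powr_mono2) auto
  then show ?thesis using True assms by (simp add: powr_mult)
next
  case False
  then have "m powr s \<le> a powr s" using assms by (intro powr_mono2') auto
  also have "\<dots> \<le> 2 powr \<bar>s\<bar> * a powr s"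
    using ge_one_powr_ge_zero[of 2 "\<bar>s\<bar>"] by (simp add: mult_le_cancel_right1)
  finally show ?thesis .
qed

text \<open>The integral is split at \<mu> = 1. Above, (1 + \<mu>) / sqrt \<mu> is at most 2 sqrt (1
  + \<mu>), which the boundary weight contains. Below, \<open>a + m\<close> is comparable to
  \<open>a\<close> and the low frequency bound applies.\<close>

lemma imag_frequency_bound:
  assumes s: "-3/2 \<le> s"
  shows "\<exists>K<\<infinity>. \<forall>h :: (real^'m) \<times> real \<Rightarrow> complex. test_fun_on (UNIV \<times> {0<..<2}) h \<longrightarrow>
    (\<integral>\<^sup>+w. ennreal (indicator {0<..} (symb w) * ((1 + (norm (fst w))\<^sup>2 + symb w) powr s * (1 + symb w) / sqrt (symb w) * (norm (ft h w))\<^sup>2)) \<partial>lborel)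
      \<le> K * Bnorm_sq s h"
proof -
  obtain K where K: "K < \<infinity>" and low: "\<And>h :: (real^'m) \<times> real \<Rightarrow> complex. test_fun_on (UNIV \<times> {0<..<2}) h \<Longrightarrow>
    (\<integral>\<^sup>+w. ennreal (indicator {0<..<1} (symb w) * ((1 + (norm (fst w))\<^sup>2) powr s * (symb w) powr (-1/2) * (norm (ft h w))\<^sup>2)) \<partial>lborel)
      \<le> K * Bnorm_sq s h"
    using low_frequency_bound[OF s, where 'm = 'm] by blast
  \<comment> \<open>The first 2 bounds 1 + m for m < 1; the power of 2 compares the powers of
    \<open>a + m\<close> and \<open>a\<close>.\<close>
  let ?d = "2 * 2 powr \<bar>s\<bar> :: real"
  show ?thesis
  proof (intro exI conjI allI impI)
    show "2 + ennreal ?d * K < \<infinity>" using K by (simp add: ennreal_mult_less_top)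
    fix h :: "(real^'m) \<times> real \<Rightarrow> complex" assume h: "test_fun_on (UNIV \<times> {0<..<2}) h"
    have [measurable]: "h \<in> borel_measurable borel" using h by (rule test_fun_measurable)
    let ?L = "\<lambda>w. indicator {0<..<1} (symb w) * ((1 + (norm (fst w))\<^sup>2) powr s * (symb w) powr (-1/2) * (norm (ft h w))\<^sup>2)"
    have "(\<integral>\<^sup>+w. ennreal (indicator {0<..} (symb w) * ((1 + (norm (fst w))\<^sup>2 + symb w) powr s * (1 + symb w) / sqrt (symb w) * (norm (ft h w))\<^sup>2)) \<partial>lborel)
      \<le> (\<integral>\<^sup>+w. 2 * ennreal (B_weight s w * (norm (ft h w))\<^sup>2) + ennreal ?d * ennreal (?L w) \<partial>lborel)"
    proof (rule nn_integral_mono)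
      fix w :: "(real^'m) \<times> real"
      define a where "a = 1 + (norm (fst w))\<^sup>2"
      have a: "1 \<le> a" by (simp add: a_def)
      define m where "m = symb w"
      have L0: "0 \<le> ?L w" by (simp add: indicator_def)
      have B0: "0 \<le> B_weight s w * (norm (ft h w))\<^sup>2" by (simp add: B_weight_nonneg)
      have "indicator {0<..} m * ((a + m) powr s * (1 + m) / sqrt m * (norm (ft h w))\<^sup>2)
         \<le> 2 * (B_weight s w * (norm (ft h w))\<^sup>2) + ?d * ?L w"
      proof -
        consider "m \<le> 0" | "0 < m" "m < 1" | "1 \<le> m" by linarith
        then show ?thesis
        proof cases
          case 1
          then show ?thesis using L0 B0 by simp
        next
          case 2
          have "(a + m) powr s * (1 + m) / sqrt m \<le> (2 powr \<bar>s\<bar> * a powr s) * 2 / sqrt m"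
            using 2 a by (intro divide_right_mono mult_mono powr_le_two_powr) auto
          also have "\<dots> = ?d * (a powr s * m powr (-1/2))"
            using 2 by (simp add: powr_minus_divide powr_half_sqrt)
          finally have le: "(a + m) powr s * (1 + m) / sqrt m * (norm (ft h w))\<^sup>2 \<le> ?d * (a powr s * m powr (-1/2)) * (norm (ft h w))\<^sup>2"
            by (rule mult_right_mono) auto
          have L: "?L w = a powr s * m powr (-1/2) * (norm (ft h w))\<^sup>2"
            using 2 unfolding m_def[symmetric] a_def[symmetric] by simp
          show ?thesis unfolding L using le B0 2 by (simp add: mult.assoc)
        next
          case 3
          have "1 + m \<le> 2 * (sqrt m * sqrt (1 + m))"
          proof -
            have "sqrt (1 + m) \<le> sqrt (4 * m)" using 3 by (intro real_sqrt_le_mono) auto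
            then have "sqrt (1 + m) \<le> 2 * sqrt m" by (simp add: real_sqrt_mult)
            then have "sqrt (1 + m) * sqrt (1 + m) \<le> (2 * sqrt m) * sqrt (1 + m)" using 3 by (intro mult_right_mono) auto
            then show ?thesis using 3 by simp
          qed
          then have "(1 + m) / sqrt m \<le> 2 * sqrt (1 + m)" using 3 by (simp add: divide_le_eq mult_ac)
          then have "(a + m) powr s * ((1 + m) / sqrt m) * (norm (ft h w))\<^sup>2 \<le> (a + m) powr s * (2 * sqrt (1 + m)) * (norm (ft h w))\<^sup>2"
            by (intro mult_right_mono mult_left_mono) auto
          moreover have "B_weight s w = (a + m) powr s * sqrt (1 + m)"
            using 3 unfolding B_weight_def m_def[symmetric] a_def[symmetric] by (simp add: powr_half_sqrt)
          moreover have L: "?L w = 0" using 3 by (simp add: m_def)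
          ultimately show ?thesis unfolding L using 3 by (simp add: mult_ac)
        qed
      qed
      then have "ennreal (indicator {0<..} m * ((a + m) powr s * (1 + m) / sqrt m * (norm (ft h w))\<^sup>2))
         \<le> ennreal (2 * (B_weight s w * (norm (ft h w))\<^sup>2) + ?d * ?L w)"
        by (rule ennreal_leI)
      also have "\<dots> = 2 * ennreal (B_weight s w * (norm (ft h w))\<^sup>2) + ennreal ?d * ennreal (?L w)"
        using L0 B0 by (simp only: ennreal_plus ennreal_mult ennreal_numeral zero_le_mult_iff zero_le_numeral powr_ge_zero mult_nonneg_nonneg simp_thms)
      finally show "ennreal (indicator {0<..} (symb w) * ((1 + (norm (fst w))\<^sup>2 + symb w) powr s * (1 + symb w) / sqrt (symb w) * (norm (ft h w))\<^sup>2))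
         \<le> 2 * ennreal (B_weight s w * (norm (ft h w))\<^sup>2) + ennreal ?d * ennreal (?L w)"
        unfolding m_def a_def .
    qed
    also have "\<dots> = 2 * Bnorm_sq s h + ennreal ?d * (\<integral>\<^sup>+w. ennreal (?L w) \<partial>lborel)"
      unfolding Bnorm_sq_eq by (subst nn_integral_add) (measurable, simp add: nn_integral_cmult)
    also have "\<dots> \<le> 2 * Bnorm_sq s h + ennreal ?d * (K * Bnorm_sq s h)"
      by (intro add_left_mono mult_left_mono low[OF h]) auto
    also have "\<dots> = (2 + ennreal ?d * K) * Bnorm_sq s h"
      by (simp only: distrib_right mult.assoc)
    finally show "(\<integral>\<^sup>+w. ennreal (indicator {0<..} (symb w) * ((1 + (norm (fst w))\<^sup>2 + symb w) powr s * (1 + symb w) / sqrt (symb w) * (norm (ft h w))\<^sup>2)) \<partial>lborel)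
      \<le> (2 + ennreal ?d * K) * Bnorm_sq s h" .
  qed
qed

text \<open>The hypothesis on \<open>wt\<close> separates the variables at \<eta> = sqrt \<mu> * y.
  The y integral is a constant, and the factor r of the substitution against 1 / (r * r) from the
  kernel leaves the 1 / sqrt \<mu> of \<open>imag_frequency_bound\<close>.\<close>

lemma ext_imag_bound:
  fixes wt :: "((real^'m) \<times> real) \<times> real \<Rightarrow> real"
  assumes [measurable]: "wt \<in> borel_measurable borel"
    and [measurable]: "g \<in> borel_measurable borel" and s: "-3/2 \<le> s"
    and C1: "0 \<le> C1" and a: "a < 3" and wt: "\<And>w y. 0 < symb w \<Longrightarrow> y \<noteq> 0 \<Longrightarrow>
      wt ((fst w, sqrt (symb w) * y), snd w) \<le> C1 * ((1 + (norm (fst w))\<^sup>2 + symb w) powr s * (1 + symb w)) * ((1 + y\<^sup>2) ^ k * (min 1 \<bar>y\<bar>) powr (- a))"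
    and g: "\<And>y. norm (ft g y) * (1 + \<bar>y\<bar>) ^ (k + 1) \<le> Cg * min 1 \<bar>y\<bar>"
  shows "\<exists>K<\<infinity>. \<forall>h :: (real^'m) \<times> real \<Rightarrow> complex. test_fun_on (UNIV \<times> {0<..<2}) h \<longrightarrow>
     (\<integral>\<^sup>+z. ennreal (wt z * (norm (ext_imag g h z))\<^sup>2) \<partial>lborel) \<le> K * Bnorm_sq s h"
proof -
  \<comment> \<open>The exponent 2 - a combines the singularity - a of the weight with the square of
    the first order zero of \<open>ft g\<close>; a < 3 keeps it above -1.\<close>
  define Q where "Q = (\<integral>\<^sup>+y. ennreal ((min 1 \<bar>y\<bar>) powr (2 - a) / (1 + y\<^sup>2)) \<partial>lborel)"
  have Q: "Q < \<infinity>" unfolding Q_def using a by (intro nn_integral_min_powr) auto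
  have pos: "0 < 1 + x\<^sup>2" for x :: real by (simp add: add_pos_nonneg)
  have ft0: "ft g 0 = 0" using g[of 0] by simp
  have tail: "(1 + y\<^sup>2) ^ k * (min 1 \<bar>y\<bar>) powr (- a) * (norm (ft g y))\<^sup>2 \<le> Cg\<^sup>2 * ((min 1 \<bar>y\<bar>) powr (2 - a) / (1 + y\<^sup>2))"
    if y: "y \<noteq> 0" for y
  proof -
    define m where "m = min 1 \<bar>y\<bar>"
    have m: "0 < m" using y by (simp add: m_def)
    have "1 + y\<^sup>2 \<le> (1 + \<bar>y\<bar>)\<^sup>2" by (simp add: power2_eq_square algebra_simps)
    then have "(1 + y\<^sup>2) ^ (k + 1) \<le> ((1 + \<bar>y\<bar>)\<^sup>2) ^ (k + 1)" using pos[of y] by (intro power_mono) auto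
    then have "(1 + y\<^sup>2) ^ (k + 1) * (norm (ft g y))\<^sup>2 \<le> ((1 + \<bar>y\<bar>)\<^sup>2) ^ (k + 1) * (norm (ft g y))\<^sup>2"
      by (intro mult_right_mono) auto
    also have "\<dots> = (norm (ft g y) * (1 + \<bar>y\<bar>) ^ (k + 1))\<^sup>2"
      by (simp only: power_mult_distrib power_mult[symmetric] mult_ac)
    also have "\<dots> \<le> (Cg * m)\<^sup>2" unfolding m_def by (intro power_mono g) auto
    finally have "(1 + y\<^sup>2) ^ (k + 1) * (norm (ft g y))\<^sup>2 * m powr (- a) \<le> (Cg * m)\<^sup>2 * m powr (- a)"
      by (rule mult_right_mono) auto
    also have "\<dots> = Cg\<^sup>2 * m powr (2 - a)"
    proof -
      have "m powr (2 - a) = m powr 2 * m powr (- a)" by (simp add: powr_add[symmetric])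
      then show ?thesis using m by (simp add: power_mult_distrib)
    qed
    finally show ?thesis unfolding m_def[symmetric] using pos[of y] by (simp add: pos_le_divide_eq mult_ac)
  qed
  obtain K where K: "K < \<infinity>" and high: "\<And>h :: (real^'m) \<times> real \<Rightarrow> complex. test_fun_on (UNIV \<times> {0<..<2}) h \<Longrightarrow>
    (\<integral>\<^sup>+w. ennreal (indicator {0<..} (symb w) * ((1 + (norm (fst w))\<^sup>2 + symb w) powr s * (1 + symb w) / sqrt (symb w) * (norm (ft h w))\<^sup>2)) \<partial>lborel)
      \<le> K * Bnorm_sq s h"
    using imag_frequency_bound[OF s, where 'm = 'm] by blast
  show ?thesis
  proof (intro exI conjI allI impI)
    show "ennreal (C1 * Cg\<^sup>2) * Q * K < \<infinity>" using K Q by (simp add: ennreal_mult_less_top)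
    fix h :: "(real^'m) \<times> real \<Rightarrow> complex" assume h: "test_fun_on (UNIV \<times> {0<..<2}) h"
    have [measurable]: "h \<in> borel_measurable borel" using h by (rule test_fun_measurable)
    let ?H = "\<lambda>w. indicator {0<..} (symb w) * ((1 + (norm (fst w))\<^sup>2 + symb w) powr s * (1 + symb w) / sqrt (symb w) * (norm (ft h w))\<^sup>2)"
    have H0: "0 \<le> ?H w" for w :: "(real^'m) \<times> real" by (auto simp: indicator_def)
    let ?G = "\<lambda>z. ennreal (wt (swap23 z) * (norm (ext_imag_kernel g h z))\<^sup>2)"
    have "(\<integral>\<^sup>+z. ennreal (wt z * (norm (ext_imag g h z))\<^sup>2) \<partial>lborel) = (\<integral>\<^sup>+z. ?G (swap23 z) \<partial>lborel)"
      by (simp add: ext_imag_def)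
    also have "\<dots> = (\<integral>\<^sup>+z. ?G z \<partial>lborel)"
      by (rule nn_integral_swap23) measurable
    also have "\<dots> = (\<integral>\<^sup>+w. \<integral>\<^sup>+\<eta>. ?G (w, \<eta>) \<partial>lborel \<partial>lborel)"
      by (rule nn_integral_lborel_pair) measurable
    also have "\<dots> \<le> (\<integral>\<^sup>+w. ennreal (?H w) * (ennreal (C1 * Cg\<^sup>2) * Q) \<partial>lborel)"
    proof (rule nn_integral_mono)
      fix w :: "(real^'m) \<times> real"
      show "(\<integral>\<^sup>+\<eta>. ?G (w, \<eta>) \<partial>lborel) \<le> ennreal (?H w) * (ennreal (C1 * Cg\<^sup>2) * Q)"
      proof (cases "0 < symb w")
        case True
        define r where "r = sqrt (symb w)"
        have r: "0 < r" using True by (simp add: r_def)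
        define W where "W = (1 + (norm (fst w))\<^sup>2 + symb w) powr s * (1 + symb w)"
        have W0: "0 \<le> W" using True by (simp add: W_def)
        have [measurable]: "(\<lambda>\<eta>::real. (w, \<eta>)) \<in> borel \<rightarrow>\<^sub>M borel"
          by (intro borel_measurable_continuous_onI continuous_intros)
        have Gm: "(\<lambda>\<eta>. ?G (w, \<eta>)) \<in> borel_measurable borel"
          by (rule measurable_compose[of "\<lambda>\<eta>. (w, \<eta>)" borel borel ?G]) measurable
        have eq: "(\<integral>\<^sup>+\<eta>. ?G (w, \<eta>) \<partial>lborel) = ennreal r * (\<integral>\<^sup>+y. ?G (w, 0 + r * y) \<partial>lborel)"
          using nn_integral_real_affine[OF Gm, of r 0] r by simp
        have "(\<integral>\<^sup>+y. ?G (w, 0 + r * y) \<partial>lborel)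
           \<le> (\<integral>\<^sup>+y. ennreal (C1 * Cg\<^sup>2 * (W * (norm (ft h w))\<^sup>2 / r\<^sup>2)) * ennreal ((min 1 \<bar>y\<bar>) powr (2 - a) / (1 + y\<^sup>2)) \<partial>lborel)"
        proof (rule nn_integral_mono)
          fix y :: real
          have e: "(norm (ext_imag_kernel g h (w, r * y)))\<^sup>2 = (norm (ft h w))\<^sup>2 / r\<^sup>2 * (norm (ft g y))\<^sup>2"
            using True r unfolding ext_imag_kernel_def
            by (simp add: r_def[symmetric] norm_mult norm_divide power_mult_distrib power_divide)
          have "wt (swap23 (w, r * y)) * (norm (ext_imag_kernel g h (w, r * y)))\<^sup>2
             \<le> C1 * Cg\<^sup>2 * (W * (norm (ft h w))\<^sup>2 / r\<^sup>2) * ((min 1 \<bar>y\<bar>) powr (2 - a) / (1 + y\<^sup>2))"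
          \<comment> \<open>The weight bound is assumed only away from y = 0; at 0 the left side
            vanishes with \<open>ft g 0\<close>.\<close>
          proof (cases "y = 0")
            case False
            have w1: "wt (swap23 (w, r * y)) \<le> C1 * W * ((1 + y\<^sup>2) ^ k * (min 1 \<bar>y\<bar>) powr (- a))"
              using wt[OF True False] by (simp add: W_def r_def swap23_def)
            have "wt (swap23 (w, r * y)) * (norm (ext_imag_kernel g h (w, r * y)))\<^sup>2
               \<le> (C1 * W * ((1 + y\<^sup>2) ^ k * (min 1 \<bar>y\<bar>) powr (- a))) * ((norm (ft h w))\<^sup>2 / r\<^sup>2 * (norm (ft g y))\<^sup>2)"
              unfolding e by (rule mult_right_mono[OF w1]) auto
            also have "\<dots> = C1 * (W * (norm (ft h w))\<^sup>2 / r\<^sup>2) * ((1 + y\<^sup>2) ^ k * (min 1 \<bar>y\<bar>) powr (- a) * (norm (ft g y))\<^sup>2)"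
              by (simp add: mult_ac)
            also have "\<dots> \<le> C1 * (W * (norm (ft h w))\<^sup>2 / r\<^sup>2) * (Cg\<^sup>2 * ((min 1 \<bar>y\<bar>) powr (2 - a) / (1 + y\<^sup>2)))"
              using C1 W0 by (intro mult_left_mono tail[OF False]) auto
            finally show ?thesis by (simp only: mult_ac)
          qed (use e ft0 in simp)
          then show "?G (w, 0 + r * y) \<le> ennreal (C1 * Cg\<^sup>2 * (W * (norm (ft h w))\<^sup>2 / r\<^sup>2)) * ennreal ((min 1 \<bar>y\<bar>) powr (2 - a) / (1 + y\<^sup>2))"
            using C1 W0 pos[of y] by (simp add: ennreal_mult[symmetric] ennreal_leI less_imp_le)
        qed
        also have "\<dots> = ennreal (C1 * Cg\<^sup>2 * (W * (norm (ft h w))\<^sup>2 / r\<^sup>2)) * Q"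
          unfolding Q_def by (rule nn_integral_cmult) measurable
        finally have "(\<integral>\<^sup>+\<eta>. ?G (w, \<eta>) \<partial>lborel) \<le> ennreal r * (ennreal (C1 * Cg\<^sup>2 * (W * (norm (ft h w))\<^sup>2 / r\<^sup>2)) * Q)"
          unfolding eq by (rule mult_left_mono) simp
        also have "\<dots> = ennreal (r * (C1 * Cg\<^sup>2 * (W * (norm (ft h w))\<^sup>2 / r\<^sup>2))) * Q"
        proof -
          have z: "0 \<le> C1 * Cg\<^sup>2 * (W * (norm (ft h w))\<^sup>2 / r\<^sup>2)" using C1 W0 by simp
          have "ennreal r * (ennreal Z * Q) = ennreal (r * Z) * Q" if "0 \<le> Z" for Z
            using that r by (simp add: ennreal_mult mult.assoc)
          from this[OF z] show ?thesis .
        qed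
        also have "r * (C1 * Cg\<^sup>2 * (W * (norm (ft h w))\<^sup>2 / r\<^sup>2)) = ?H w * (C1 * Cg\<^sup>2)"
          using True r unfolding W_def r_def[symmetric] by (simp add: power2_eq_square)
        also have "ennreal (?H w * (C1 * Cg\<^sup>2)) * Q = ennreal (?H w) * (ennreal (C1 * Cg\<^sup>2) * Q)"
          using C1 H0[of w] by (subst ennreal_mult) (auto simp: mult.assoc)
        finally show ?thesis .
      qed (simp add: ext_imag_kernel_def)
    qed
    also have "\<dots> = (\<integral>\<^sup>+w. ennreal (?H w) \<partial>lborel) * (ennreal (C1 * Cg\<^sup>2) * Q)"
      by (rule nn_integral_multc) measurable
    also have "\<dots> \<le> (K * Bnorm_sq s h) * (ennreal (C1 * Cg\<^sup>2) * Q)"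
      by (intro mult_right_mono high h) auto
    finally show "(\<integral>\<^sup>+z. ennreal (wt z * (norm (ext_imag g h z))\<^sup>2) \<partial>lborel) \<le> ennreal (C1 * Cg\<^sup>2) * Q * K * Bnorm_sq s h"
      by (simp only: mult_ac)
  qed
qed

section \<open>Assembling the restriction norm\<close>

lemma integrable_of_decay:
  fixes f :: "real \<Rightarrow> complex"
  assumes "f \<in> borel_measurable borel" "\<And>y. norm (f y) * (1 + \<bar>y\<bar>) ^ (n + 2) \<le> C"
  shows "integrable lborel f"
proof (rule integrable_pointwise_bound)
  show "integrable lborel (\<lambda>y::real. C * (1 / (1 + y\<^sup>2)))"
    by (intro integrable_mult_right integrable_inverse_1_plus_sq)
  show "f \<in> borel_measurable lborel" using assms by simp
  fix y :: real
  have pos: "0 < 1 + y\<^sup>2" by (simp add: add_pos_nonneg)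
  have "1 + y\<^sup>2 \<le> (1 + \<bar>y\<bar>)\<^sup>2" by (simp add: power2_eq_square algebra_simps)
  also have "\<dots> \<le> (1 + \<bar>y\<bar>) ^ (n + 2)" by (intro power_increasing) auto
  finally have "norm (f y) * (1 + y\<^sup>2) \<le> norm (f y) * (1 + \<bar>y\<bar>) ^ (n + 2)" by (intro mult_left_mono) auto
  also have "\<dots> \<le> C" by (rule assms)
  finally have "norm (f y) \<le> C * (1 / (1 + y\<^sup>2))" using pos by (simp add: pos_le_divide_eq)
  then show "norm (f y) \<le> norm (C * (1 / (1 + y\<^sup>2)))"
    unfolding real_norm_def by (rule order_trans[OF _ abs_ge_self])
qed

text \<open>Both families of spaces enter only through two pointwise bounds on their weight, one
  along rescaled decaying modes and one near the paraboloid. The cutoffs depend on the exponents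
  \<open>k\<close> and \<open>M\<close> and are fixed before \<open>h\<close>, so the constant is
  uniform.\<close>

lemma restr_norm_bound:
  fixes wt :: "((real^'m) \<times> real) \<times> real \<Rightarrow> real"
  assumes wtm[measurable]: "wt \<in> borel_measurable borel" and wt0: "\<And>z. 0 \<le> wt z" and s: "-3/2 \<le> s"
    and C1: "0 \<le> C1" and a: "a < 3" and wt1: "\<And>w y. 0 < symb w \<Longrightarrow> y \<noteq> 0 \<Longrightarrow>
      wt ((fst w, sqrt (symb w) * y), snd w) \<le> C1 * ((1 + (norm (fst w))\<^sup>2 + symb w) powr s * (1 + symb w)) * ((1 + y\<^sup>2) ^ k * (min 1 \<bar>y\<bar>) powr (- a))"
    and C2: "0 \<le> C2" and wt2: "\<And>p \<tau>. 0 \<le> snd p \<Longrightarrow>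
      wt (p, \<tau>) \<le> C2 * (1 + (norm (fst p))\<^sup>2 + (snd p)\<^sup>2) powr s * (1 + \<bar>\<tau> - snd (par p)\<bar>) ^ M"
  shows "\<exists>c\<ge>0. \<forall>h :: (real^'m) \<times> real \<Rightarrow> complex. test_fun_on (UNIV \<times> {0<..<2}) h \<longrightarrow>
     restr_norm_sq wt (vsol_st h) \<le> ennreal (c\<^sup>2) * Bnorm_sq s h"
proof -
  \<comment> \<open>The estimate uses decay of order k + 1; with k + 2 the transform
    \<open>ft g\<close> is also integrable when k = 0. The same holds for \<psi> and M
    below.\<close>
  obtain g Cg where g: "integrable lborel g" "\<And>x. 0 < x \<Longrightarrow> g x = of_real (exp (- x))"
    and gd: "\<And>y. norm (ft g y) * (1 + \<bar>y\<bar>) ^ (k + 2) \<le> Cg * min 1 \<bar>y\<bar>"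
    using exists_exp_extension[of "k + 2"] by blast
  obtain \<psi> C\<psi> where \<psi>: "integrable lborel \<psi>" "\<And>t. 0 < t \<Longrightarrow> t < 2 \<Longrightarrow> \<psi> t = 1"
    and \<psi>d: "\<And>y. norm (ft \<psi> y) * (1 + \<bar>y\<bar>) ^ (M + 2) \<le> C\<psi>"
    using exists_time_cutoff[of 2 "M + 2"] by blast
  have [measurable]: "g \<in> borel_measurable borel" "\<psi> \<in> borel_measurable borel"
    using g(1) \<psi>(1) by auto
  have lower: "norm (ft f y) * (1 + \<bar>y\<bar>) ^ (n + 1) \<le> norm (ft f y) * (1 + \<bar>y\<bar>) ^ (n + 2)" for f and y :: real and n
    by (intro mult_left_mono power_increasing) auto
  have "0 \<le> Cg" using order_trans[OF _ gd[of 1], of 0] by simp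
  then have gC: "norm (ft g y) * (1 + \<bar>y\<bar>) ^ (k + 2) \<le> Cg" for y
    using order_trans[OF gd[of y], of Cg] by (simp add: mult_left_le)
  have ig: "integrable lborel (ft g)" by (rule integrable_of_decay[OF _ gC]) measurable
  have i\<psi>: "integrable lborel (ft \<psi>)" by (rule integrable_of_decay[OF _ \<psi>d]) measurable
  obtain K1 where K1: "K1 < \<infinity>" and I: "\<And>h :: (real^'m) \<times> real \<Rightarrow> complex. test_fun_on (UNIV \<times> {0<..<2}) h \<Longrightarrow>
     (\<integral>\<^sup>+z. ennreal (wt z * (norm (ext_imag g h z))\<^sup>2) \<partial>lborel) \<le> K1 * Bnorm_sq s h"
    using ext_imag_bound[OF wtm _ s C1 a wt1 order_trans[OF lower gd]] by auto
  obtain K2 where K2: "K2 < \<infinity>" and R: "\<And>h :: (real^'m) \<times> real \<Rightarrow> complex. h \<in> borel_measurable borel \<Longrightarrow>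
     (\<integral>\<^sup>+z. ennreal (wt z * (norm (ext_real \<psi> h z))\<^sup>2) \<partial>lborel) \<le> K2 * Bnorm_sq s h"
    using ext_real_bound[OF wtm _ C2 wt2 order_trans[OF lower \<psi>d]] by auto
  define K where "K = 2 * K1 + 2 * K2"
  have K: "K < \<infinity>" using K1 K2 by (simp add: K_def ennreal_mult_less_top)
  show ?thesis
  proof (intro exI conjI allI impI)
    show "0 \<le> sqrt (enn2real K)" by simp
    fix h :: "(real^'m) \<times> real \<Rightarrow> complex" assume h: "test_fun_on (UNIV \<times> {0<..<2}) h"
    have [measurable]: "h \<in> borel_measurable borel" using h by (rule test_fun_measurable)
    let ?F = "\<lambda>\<zeta>. ext_imag g h \<zeta> + ext_real \<psi> h \<zeta>"
    have "restr_norm_sq wt (vsol_st h) \<le> (\<integral>\<^sup>+z. ennreal (wt z * (norm (?F z))\<^sup>2) \<partial>lborel)"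
      unfolding restr_norm_sq_def
      by (rule INF_lower) (use ft_extends_vsol[OF h g ig \<psi> i\<psi>] in simp)
    also have "\<dots> \<le> (\<integral>\<^sup>+z. 2 * ennreal (wt z * (norm (ext_imag g h z))\<^sup>2) + 2 * ennreal (wt z * (norm (ext_real \<psi> h z))\<^sup>2) \<partial>lborel)"
    proof (rule nn_integral_mono)
      fix z :: "((real^'m) \<times> real) \<times> real"
      define x where "x = ext_imag g h z"
      define y where "y = ext_real \<psi> h z"
      have "(norm (x + y))\<^sup>2 \<le> (norm x + norm y)\<^sup>2" by (intro power_mono norm_triangle_ineq) auto
      also have "\<dots> \<le> 2 * (norm x)\<^sup>2 + 2 * (norm y)\<^sup>2"
        using zero_le_power2[of "norm x - norm y"] by (simp add: power2_eq_square algebra_simps)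
      finally have "wt z * (norm (x + y))\<^sup>2 \<le> wt z * (2 * (norm x)\<^sup>2 + 2 * (norm y)\<^sup>2)" by (intro mult_left_mono wt0)
      then have "ennreal (wt z * (norm (x + y))\<^sup>2) \<le> ennreal (2 * (wt z * (norm x)\<^sup>2) + 2 * (wt z * (norm y)\<^sup>2))"
        by (intro ennreal_leI) (simp add: algebra_simps)
      also have "\<dots> = 2 * ennreal (wt z * (norm x)\<^sup>2) + 2 * ennreal (wt z * (norm y)\<^sup>2)"
        using wt0[of z] by (simp add: ennreal_mult)
      finally show "ennreal (wt z * (norm (?F z))\<^sup>2)
         \<le> 2 * ennreal (wt z * (norm (ext_imag g h z))\<^sup>2) + 2 * ennreal (wt z * (norm (ext_real \<psi> h z))\<^sup>2)"
        unfolding x_def y_def .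
    qed
    also have "\<dots> = 2 * (\<integral>\<^sup>+z. ennreal (wt z * (norm (ext_imag g h z))\<^sup>2) \<partial>lborel) + 2 * (\<integral>\<^sup>+z. ennreal (wt z * (norm (ext_real \<psi> h z))\<^sup>2) \<partial>lborel)"
      by (simp add: nn_integral_add nn_integral_cmult)
    also have "\<dots> \<le> 2 * (K1 * Bnorm_sq s h) + 2 * (K2 * Bnorm_sq s h)"
      by (intro add_mono mult_left_mono I[OF h] R) auto
    also have "\<dots> = K * Bnorm_sq s h"
      by (simp only: K_def distrib_right mult.assoc)
    also have "K = ennreal ((sqrt (enn2real K))\<^sup>2)"
      using K by (simp add: less_top)
    finally show "restr_norm_sq wt (vsol_st h) \<le> ennreal ((sqrt (enn2real K))\<^sup>2) * Bnorm_sq s h" .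
  qed
qed

section \<open>The weights of the X and Y norms\<close>

lemma norm_pair_square: "(norm p)\<^sup>2 = (norm (fst p))\<^sup>2 + (snd (p :: 'a::real_normed_vector \<times> real))\<^sup>2"
  by (simp add: norm_prod_def)

lemma snd_par_eq: "\<tau> - snd (par p) = \<tau> + (norm p)\<^sup>2"
  by (simp add: par_def norm_pair_square[of p])

lemma powr_two_mult_le:
  fixes n s :: real
  assumes n: "0 \<le> n"
  shows "(1 + n) powr (2 * s) \<le> 2 powr \<bar>s\<bar> * (1 + n\<^sup>2) powr s"
proof -
  have "(1 + n) powr (2 * s) = ((1 + n) powr 2) powr s" by (simp only: powr_powr)
  also have "(1 + n) powr 2 = (1 + n)\<^sup>2" using n by simp
  also have "((1 + n)\<^sup>2) powr s \<le> 2 powr \<bar>s\<bar> * (1 + n\<^sup>2) powr s"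
  proof (rule powr_le_two_powr)
    show "(1 + n)\<^sup>2 \<le> 2 * (1 + n\<^sup>2)" using zero_le_power2[of "n - 1"] by (simp add: power2_eq_square algebra_simps)
    show "1 + n\<^sup>2 \<le> (1 + n)\<^sup>2" using n by (simp add: power2_eq_square algebra_simps)
    show "0 < 1 + n\<^sup>2" by (simp add: add_pos_nonneg)
  qed
  finally show ?thesis .
qed

text \<open>For s \<ge> 0 large y may increase the weight, which costs powers of 1 + y * y. For s <
  0 small y does, since a + m y^2 can be as small as (a + m) times the square of
  \<open>min 1 \<bar>y\<bar>\<close>; this costs \<open>min 1 \<bar>y\<bar>\<close> to the power 2 s
  and is paid for by the zero of \<open>ft g\<close>.\<close>

lemma scaled_frequency_powr:
  fixes a m y s :: real
  assumes a: "1 \<le> a" and m: "0 \<le> m" and y: "y \<noteq> 0"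
  shows "(a + m * y\<^sup>2) powr s \<le> (a + m) powr s * ((1 + y\<^sup>2) ^ nat \<lceil>\<bar>s\<bar>\<rceil> * (min 1 \<bar>y\<bar>) powr (- max 0 (- 2 * s)))"
proof (cases "0 \<le> s")
  case True
  have "a + m * y\<^sup>2 \<le> (a + m) * (1 + y\<^sup>2)"
    using a m mult_nonneg_nonneg[of a "y\<^sup>2"] by (simp add: algebra_simps)
  then have "(a + m * y\<^sup>2) powr s \<le> ((a + m) * (1 + y\<^sup>2)) powr s"
    using a m True by (intro powr_mono2) (auto intro: add_nonneg_nonneg)
  also have "\<dots> = (a + m) powr s * (1 + y\<^sup>2) powr s"
    using a m by (intro powr_mult) 
  also have "(1 + y\<^sup>2) powr s \<le> (1 + y\<^sup>2) powr (real (nat \<lceil>\<bar>s\<bar>\<rceil>))"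
    using True by (intro powr_mono) (auto intro: real_nat_ceiling_ge)
  also have "\<dots> = (1 + y\<^sup>2) ^ nat \<lceil>\<bar>s\<bar>\<rceil>"
    by (intro powr_realpow) (simp add: add_pos_nonneg)
  also have "\<dots> = (1 + y\<^sup>2) ^ nat \<lceil>\<bar>s\<bar>\<rceil> * (min 1 \<bar>y\<bar>) powr (- max 0 (- 2 * s))"
    using True y by (simp add: max_def)
  finally show ?thesis by (simp add: mult_left_mono)
next
  case False
  define q where "q = min 1 \<bar>y\<bar>"
  have q: "0 < q" "q \<le> 1" "q \<le> \<bar>y\<bar>" using y by (auto simp: q_def)
  have q2: "q\<^sup>2 \<le> 1" "q\<^sup>2 \<le> y\<^sup>2"
    using q power_mono[of q 1 2] power_mono[of q "\<bar>y\<bar>" 2] by auto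
  have "(a + m) * q\<^sup>2 \<le> a + m * y\<^sup>2"
  proof -
    have "a * q\<^sup>2 \<le> a * 1" using a q2 by (intro mult_left_mono) auto
    moreover have "m * q\<^sup>2 \<le> m * y\<^sup>2" using m q2 by (intro mult_left_mono) auto
    ultimately show ?thesis by (simp add: distrib_right)
  qed
  then have "(a + m * y\<^sup>2) powr s \<le> ((a + m) * q\<^sup>2) powr s"
    using a m False q by (intro powr_mono2') auto
  also have "\<dots> = (a + m) powr s * (q powr 2) powr s"
    using a m q by (simp add: powr_mult)
  also have "(q powr 2) powr s = 1 * q powr (- max 0 (- 2 * s))"
    using False by (simp only: powr_powr) (simp add: max_def)
  also have "(a + m) powr s * (1 * q powr (- max 0 (- 2 * s))) \<le> (a + m) powr s * ((1 + y\<^sup>2) ^ nat \<lceil>\<bar>s\<bar>\<rceil> * q powr (- max 0 (- 2 * s)))"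
    by (intro mult_left_mono mult_right_mono one_le_power) auto
  finally show ?thesis unfolding q_def .
qed

text \<open>At \<eta> = sqrt m * y the modulation \<tau> + |\<xi>'|^2 + \<eta>^2 equals m (1 + y^2).
  Since 2 b < 1, its weight is at most the single power of 1 + m that \<open>ext_imag_bound\<close>
  admits.\<close>

lemma modulation_weight_bound:
  fixes m y b :: real
  assumes m: "0 \<le> m" and b: "b < 1/2"
  shows "(1 + \<bar>m * (1 + y\<^sup>2)\<bar>) powr (2 * b) \<le> (1 + m) * (1 + y\<^sup>2)"
proof -
  have n: "0 \<le> m * (1 + y\<^sup>2)" using m by simp
  have "(1 + \<bar>m * (1 + y\<^sup>2)\<bar>) powr (2 * b) \<le> (1 + \<bar>m * (1 + y\<^sup>2)\<bar>) powr 1"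
    using b by (intro powr_mono) auto
  also have "\<dots> = 1 + m * (1 + y\<^sup>2)" using n by simp
  also have "\<dots> \<le> (1 + m) * (1 + y\<^sup>2)" by (simp add: distrib_right)
  finally show ?thesis .
qed

lemma X_bound:
  assumes s: "-3/2 < s" and b: "b < 1/2"
  shows "\<exists>c\<ge>0. \<forall>h :: (real^'m) \<times> real \<Rightarrow> complex. test_fun_on (UNIV \<times> {0<..<2}) h \<longrightarrow>
     restr_norm_sq (X_weight s b) (vsol_st h) \<le> ennreal (c\<^sup>2) * Bnorm_sq s h"
\<comment> \<open>The requirement a < 3 is exactly s > -3/2. The extra 1 in \<open>k\<close> and the
  value M = 1 both absorb the modulation weight; 2 powr |s| compares (1 + n)^2 with 1 + n^2.\<close>
proof (rule restr_norm_bound[where ?C1.0 = "2 powr \<bar>s\<bar>" and ?C2.0 = "2 powr \<bar>s\<bar>" and a = "max 0 (- 2 * s)" and M = 1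
      and k = "nat \<lceil>\<bar>s\<bar>\<rceil> + 1"])
  show "X_weight s b \<in> borel_measurable (borel :: (((real^'m) \<times> real) \<times> real) measure)"
    unfolding X_weight_def[abs_def] by measurable
  show "0 \<le> X_weight s b z" for z :: "((real^'m) \<times> real) \<times> real" by (simp add: X_weight_def)
  show "X_weight s b ((fst w, sqrt (symb w) * y), snd w)
      \<le> 2 powr \<bar>s\<bar> * ((1 + (norm (fst w))\<^sup>2 + symb w) powr s * (1 + symb w)) * ((1 + y\<^sup>2) ^ (nat \<lceil>\<bar>s\<bar>\<rceil> + 1) * (min 1 \<bar>y\<bar>) powr (- max 0 (- 2 * s)))"
    if w: "0 < symb w" and y: "y \<noteq> 0" for w :: "(real^'m) \<times> real" and y
  proof -
    define m where "m = symb w"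
    define a where "a = 1 + (norm (fst w))\<^sup>2"
    define n where "n = norm (fst w, sqrt (symb w) * y)"
    have m: "0 < m" using w by (simp add: m_def)
    have n2: "n\<^sup>2 = (norm (fst w))\<^sup>2 + m * y\<^sup>2"
      using m unfolding n_def norm_pair_square by (simp add: power_mult_distrib m_def)
    have "snd w + n\<^sup>2 = m * (1 + y\<^sup>2)" unfolding n2 by (simp add: m_def algebra_simps)
    then have "X_weight s b ((fst w, sqrt (symb w) * y), snd w) = (1 + n) powr (2 * s) * (1 + \<bar>m * (1 + y\<^sup>2)\<bar>) powr (2 * b)"
      by (simp add: X_weight_def n_def)
    also have "\<dots> \<le> (2 powr \<bar>s\<bar> * ((a + m) powr s * ((1 + y\<^sup>2) ^ nat \<lceil>\<bar>s\<bar>\<rceil> * (min 1 \<bar>y\<bar>) powr (- max 0 (- 2 * s))))) * ((1 + m) * (1 + y\<^sup>2))"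
    proof (intro mult_mono modulation_weight_bound b)
      have "(1 + n) powr (2 * s) \<le> 2 powr \<bar>s\<bar> * (1 + n\<^sup>2) powr s" by (rule powr_two_mult_le) (simp add: n_def)
      also have "1 + n\<^sup>2 = a + m * y\<^sup>2" by (simp add: n2 a_def)
      also have "2 powr \<bar>s\<bar> * (a + m * y\<^sup>2) powr s \<le> 2 powr \<bar>s\<bar> * ((a + m) powr s * ((1 + y\<^sup>2) ^ nat \<lceil>\<bar>s\<bar>\<rceil> * (min 1 \<bar>y\<bar>) powr (- max 0 (- 2 * s))))"
        using m y by (intro mult_left_mono scaled_frequency_powr) (auto simp: a_def)
      finally show "(1 + n) powr (2 * s) \<le> 2 powr \<bar>s\<bar> * ((a + m) powr s * ((1 + y\<^sup>2) ^ nat \<lceil>\<bar>s\<bar>\<rceil> * (min 1 \<bar>y\<bar>) powr (- max 0 (- 2 * s))))" .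
    qed (use m in auto)
    also have "\<dots> = 2 powr \<bar>s\<bar> * ((a + m) powr s * (1 + m)) * ((1 + y\<^sup>2) ^ (nat \<lceil>\<bar>s\<bar>\<rceil> + 1) * (min 1 \<bar>y\<bar>) powr (- max 0 (- 2 * s)))"
      by (simp only: power_add power_one_right mult_ac)
    finally show ?thesis unfolding m_def a_def .
  qed
  show "X_weight s b (p, \<tau>) \<le> 2 powr \<bar>s\<bar> * (1 + (norm (fst p))\<^sup>2 + (snd p)\<^sup>2) powr s * (1 + \<bar>\<tau> - snd (par p)\<bar>) ^ 1"
    for p :: "(real^'m) \<times> real" and \<tau>
  proof -
    have "X_weight s b (p, \<tau>) = (1 + norm p) powr (2 * s) * (1 + \<bar>\<tau> + (norm p)\<^sup>2\<bar>) powr (2 * b)"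
      by (simp add: X_weight_def)
    also have "\<dots> \<le> (2 powr \<bar>s\<bar> * (1 + (norm p)\<^sup>2) powr s) * (1 + \<bar>\<tau> + (norm p)\<^sup>2\<bar>) powr 1"
      using b by (intro mult_mono powr_two_mult_le powr_mono) auto
    finally show ?thesis
      unfolding snd_par_eq by (simp add: norm_pair_square[of p] add.assoc)
  qed
qed (use s in auto)

lemma Y_bound:
  assumes s: "0 \<le> s" and b: "b < 1/2"
  shows "\<exists>c\<ge>0. \<forall>h :: (real^'m) \<times> real \<Rightarrow> complex. test_fun_on (UNIV \<times> {0<..<2}) h \<longrightarrow>
     restr_norm_sq (Y_weight s b) (vsol_st h) \<le> ennreal (c\<^sup>2) * Bnorm_sq s h"
\<comment> \<open>The weight in \<tau> does not see y, so the decaying modes cost only the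
  modulation factor and a = 0. For free waves 1 + |\<tau>| \<le> (1 + |p|^2) (1 + |\<tau> + |p|^2|),
  which moves up to s further powers onto the modulation and explains M.\<close>
proof (rule restr_norm_bound[where ?C1.0 = 1 and ?C2.0 = 1 and a = 0 and M = "nat \<lceil>s\<rceil> + 1" and k = 1])
  show "Y_weight s b \<in> borel_measurable (borel :: (((real^'m) \<times> real) \<times> real) measure)"
    unfolding Y_weight_def[abs_def] by measurable
  show "0 \<le> Y_weight s b z" for z :: "((real^'m) \<times> real) \<times> real" by (simp add: Y_weight_def)
  show "Y_weight s b ((fst w, sqrt (symb w) * y), snd w)
      \<le> 1 * ((1 + (norm (fst w))\<^sup>2 + symb w) powr s * (1 + symb w)) * ((1 + y\<^sup>2) ^ 1 * (min 1 \<bar>y\<bar>) powr (- 0))"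
    if w: "0 < symb w" and y: "y \<noteq> 0" for w :: "(real^'m) \<times> real" and y
  proof -
    define m where "m = symb w"
    define a where "a = 1 + (norm (fst w))\<^sup>2"
    define n where "n = norm (fst w, sqrt (symb w) * y)"
    have m: "0 < m" using w by (simp add: m_def)
    have n2: "n\<^sup>2 = (norm (fst w))\<^sup>2 + m * y\<^sup>2"
      using m unfolding n_def norm_pair_square by (simp add: power_mult_distrib m_def)
    have "snd w + n\<^sup>2 = m * (1 + y\<^sup>2)" unfolding n2 by (simp add: m_def algebra_simps)
    then have "Y_weight s b ((fst w, sqrt (symb w) * y), snd w) = (1 + \<bar>snd w\<bar>) powr s * (1 + \<bar>m * (1 + y\<^sup>2)\<bar>) powr (2 * b)"
      by (simp add: Y_weight_def n_def)
    also have "\<dots> \<le> (a + m) powr s * ((1 + m) * (1 + y\<^sup>2))"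
    proof (intro mult_mono modulation_weight_bound b powr_mono2 s)
      have "\<bar>snd w\<bar> \<le> \<bar>m\<bar> + \<bar>(norm (fst w))\<^sup>2\<bar>"
        using abs_triangle_ineq4[of m "(norm (fst w))\<^sup>2"] by (simp add: m_def)
      then show "1 + \<bar>snd w\<bar> \<le> a + m" using m by (simp add: a_def)
    qed (use m in auto)
    finally show ?thesis
      using y unfolding m_def[symmetric] a_def[symmetric] by (simp add: min_def mult.assoc)
  qed
  show "Y_weight s b (p, \<tau>) \<le> 1 * (1 + (norm (fst p))\<^sup>2 + (snd p)\<^sup>2) powr s * (1 + \<bar>\<tau> - snd (par p)\<bar>) ^ (nat \<lceil>s\<rceil> + 1)"
    for p :: "(real^'m) \<times> real" and \<tau>
  proof -
    define c where "c = \<bar>\<tau> + (norm p)\<^sup>2\<bar>"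
    have c: "0 \<le> c" by (simp add: c_def)
    have "\<bar>\<tau>\<bar> \<le> c + (norm p)\<^sup>2"
      using abs_triangle_ineq4[of "\<tau> + (norm p)\<^sup>2" "(norm p)\<^sup>2"] by (simp add: c_def)
    then have "1 + \<bar>\<tau>\<bar> \<le> (1 + (norm p)\<^sup>2) * (1 + c)"
      using mult_nonneg_nonneg[OF zero_le_power2[of "norm p"] c] by (simp add: algebra_simps)
    then have "(1 + \<bar>\<tau>\<bar>) powr s \<le> ((1 + (norm p)\<^sup>2) * (1 + c)) powr s"
      using s by (intro powr_mono2) auto
    also have "\<dots> = (1 + (norm p)\<^sup>2) powr s * (1 + c) powr s"
      using c by (intro powr_mult)
    finally have "(1 + \<bar>\<tau>\<bar>) powr s * (1 + c) powr (2 * b) \<le> ((1 + (norm p)\<^sup>2) powr s * (1 + c) powr s) * (1 + c) powr 1"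
      using b c by (intro mult_mono powr_mono) auto
    also have "\<dots> = (1 + (norm p)\<^sup>2) powr s * (1 + c) powr (s + 1)"
      by (simp only: powr_add mult.assoc)
    also have "\<dots> \<le> (1 + (norm p)\<^sup>2) powr s * (1 + c) powr (real (nat \<lceil>s\<rceil> + 1))"
      using c by (intro mult_left_mono powr_mono) (auto intro: real_nat_ceiling_ge)
    also have "(1 + c) powr (real (nat \<lceil>s\<rceil> + 1)) = (1 + c) ^ (nat \<lceil>s\<rceil> + 1)"
      using c by (intro powr_realpow) auto
    finally show ?thesis
      unfolding snd_par_eq by (simp add: Y_weight_def c_def norm_pair_square[of p] add.assoc)
  qed
qed (use s in auto)

theorem theorem2p1:
  shows "(\<forall>h :: (real^'m) \<times> real \<Rightarrow> complex.
            test_fun_on (UNIV \<times> {0<..<2}) h \<longrightarrow> solves_ibvp (vsol h) h)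
       \<and> (\<forall>s b. -3/2 < s \<and> 0 \<le> b \<and> b < 1/2 \<longrightarrow>
            (\<exists>c\<ge>0. \<forall>h :: (real^'m) \<times> real \<Rightarrow> complex.
               test_fun_on (UNIV \<times> {0<..<2}) h \<longrightarrow>
               restr_norm_sq (X_weight s b) (vsol_st h) \<le> ennreal (c\<^sup>2) * Bnorm_sq s h))
       \<and> (\<forall>s b. 0 \<le> s \<and> 0 \<le> b \<and> b < 1/2 \<longrightarrow>
            (\<exists>c\<ge>0. \<forall>h :: (real^'m) \<times> real \<Rightarrow> complex.
               test_fun_on (UNIV \<times> {0<..<2}) h \<longrightarrow>
               restr_norm_sq (Y_weight s b) (vsol_st h) \<le> ennreal (c\<^sup>2) * Bnorm_sq s h))"
  using solves_ibvp_vsol X_bound Y_bound by blast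

end
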